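(* Let $N\ge2$ and consider the eigenvalue problem $$-\Delta_{\mathbb S^{N-1}}\psi=\mu\psi\ \text{ on }\mathbb S^{N-1}\setminus\Sigma,\qquad\frac{\partial^+\psi}{\partial\nu^+}=\frac{\partial^-\psi}{\partial\nu^-}=0\ \text{ on }\Sigma,$$ in the weak sense given in the context. (i) The point spectrum of the problem is a diverging and increasing sequence of non-negative eigenvalues $\{\mu_k\}_{k\in\mathbb N}$ of finite multiplicity, and the eigenvalue $\mu_0=0$ is simple. Letting $N_k$ be the multiplicity of $\mu_k$ and $V_k$ the eigenspace associated to $\mu_k$, there exists an orthonormal basis of $L^2(\mathbb S^{N-1})$ consisting of eigenfunctions $\{Y_{k,i}\}_{k\in\mathbb N,\,i=1,\dots,N_k}$ such that $\{Y_{k,i}\}_{i=1,\dots,N_k}$ is a basis of $V_k$ for any $k\in\mathbb N$. (ii) For any $k\in\mathbb N$, $$\mu_k=\frac{k(k+2N-4)}4 .$$ Moreover any eigenfunction of the problem belongs to $L^\infty(\mathbb S^{N-1})$.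
   Context: $\mathbb N$ includes $0$. Points of $\mathbb R^N$ are written $x=(x',x_{N-1},x_N)\in\mathbb R^{N-2}\times\mathbb R\times\mathbb R$; $\mathbb S^{N-1}$ is the unit sphere of $\mathbb R^N$ and $\Sigma=\{(x',x_{N-1},0)\in\mathbb S^{N-1}:x_{N-1}\ge0\}$ is the half-equator. The conditions on $\Sigma$ are homogeneous Neumann conditions on both sides of $\Sigma$ (for the restrictions of $\psi$ to $\{x_N>0\}$ and $\{x_N<0\}$). Weak formulation: $\mu\in\mathbb R$ is an eigenvalue, with eigenfunction $\psi$, if $\psi\in H^1(\mathbb S^{N-1}\setminus\Sigma)\setminus\{0\}$ and $$\int_{\mathbb S^{N-1}\setminus\Sigma}\nabla_{\mathbb S^{N-1}\setminus\Sigma}\psi\cdot\nabla_{\mathbb S^{N-1}\setminus\Sigma}\phi\,dS=\mu\int_{\mathbb S^{N-1}\setminus\Sigma}\psi\phi\,dS\quad\text{for any }\phi\in H^1(\mathbb S^{N-1}\setminus\Sigma).$$ *)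

theory Defs
  imports "HOL-Analysis.Analysis"
begin

section \<open>Surface measure and the slit\<close>

text \<open>
  The surface measure \<open>dS\<close> on the unit sphere, in its polar-coordinate form: the measure of
  \<open>A\<close> is \<open>N\<close> times the Lebesgue measure of the cone \<open>{t x | x \<in> A, 0 < t \<le> 1}\<close>.
\<close>

definition sphere_measure :: "(real ^ 'n) measure" where
  "sphere_measure =
     scale_measure (ennreal (real CARD('n)))
       (distr (restrict_space lborel (cball 0 1 - {0})) (restrict_space borel (sphere 0 1))
         (\<lambda>x. x /\<^sub>R norm x))"

text \<open>
  The distinct indices \<open>p\<close> and \<open>q\<close> stand for the last two coordinates
  \<open>N - 1\<close> and \<open>N\<close>; the remaining indices make up \<open>x'\<close>.
\<close>

definition half_equator :: "'n::finite \<Rightarrow> 'n \<Rightarrow> (real ^ 'n) set" where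
  "half_equator p q = {x \<in> sphere 0 1. x $ p \<ge> 0 \<and> x $ q = 0}"

abbreviation slit_sphere :: "'n::finite \<Rightarrow> 'n \<Rightarrow> (real ^ 'n) set" where
  "slit_sphere p q \<equiv> sphere 0 1 - half_equator p q"


section \<open>The Sobolev space on the slit sphere\<close>

definition L2 :: "'a measure \<Rightarrow> ('a \<Rightarrow> 'b::{real_normed_vector, second_countable_topology}) set"
  where "L2 M = {f \<in> borel_measurable M. integrable M (\<lambda>x. (norm (f x))\<^sup>2)}"

primrec Ck :: "nat \<Rightarrow> ('a::real_normed_vector \<Rightarrow> 'b::real_normed_vector) \<Rightarrow> bool" where
  "Ck 0 f \<longleftrightarrow> continuous_on UNIV f"
| "Ck (Suc k) f \<longleftrightarrow>
     f differentiable_on UNIV \<and> (\<forall>v. Ck k (\<lambda>x. frechet_derivative f (at x) v))"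

text \<open>
  Smooth tangential vector fields with compact support in the slit sphere, each represented by
  a smooth extension to the whole of \<open>\<real>\<^sup>N\<close>.
\<close>

definition test_fields :: "'n::finite \<Rightarrow> 'n \<Rightarrow> (real ^ 'n \<Rightarrow> real ^ 'n) set" where
  "test_fields p q =
     {X. (\<forall>k. Ck k X) \<and> (\<forall>x \<in> sphere 0 1. X x \<bullet> x = 0) \<and>
         closure {x. X x \<noteq> 0} \<inter> half_equator p q = {}}"

text \<open>
  The divergence on the sphere: the trace of the derivative over the tangent space at \<open>x\<close>, that
  is, the full trace minus the contribution of the unit normal \<open>x\<close>. On the sphere it depends
  only on the values of \<open>X\<close> there.
\<close>

definition sphere_div :: "(real ^ 'n \<Rightarrow> real ^ 'n) \<Rightarrow> real ^ 'n \<Rightarrow> real" where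
  "sphere_div X x =
     (\<Sum>b\<in>Basis. frechet_derivative X (at x) b \<bullet> b) - frechet_derivative X (at x) x \<bullet> x"

text \<open>
  \<open>G\<close> is the weak gradient of \<open>\<psi>\<close> on the slit sphere. Test fields vanish near the half-equator, so
  \<open>\<psi>\<close> may jump across it.
\<close>

definition has_weak_gradient ::
    "'n::finite \<Rightarrow> 'n \<Rightarrow> (real ^ 'n \<Rightarrow> real) \<Rightarrow> (real ^ 'n \<Rightarrow> real ^ 'n) \<Rightarrow> bool" where
  "has_weak_gradient p q \<psi> G \<longleftrightarrow>
     G \<in> L2 sphere_measure \<and> (AE x in sphere_measure. G x \<bullet> x = 0) \<and>
     (\<forall>X \<in> test_fields p q.
        (LINT x:slit_sphere p q|sphere_measure. \<psi> x * sphere_div X x) =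
        - (LINT x:slit_sphere p q|sphere_measure. G x \<bullet> X x))"

text \<open>
  Elements of \<open>L\<^sup>2\<close> and \<open>H\<^sup>1\<close> are functions here, to be identified when they agree almost everywhere.
  Since the half-equator is a null set, a function on the slit sphere is taken as a
  function on the whole sphere.
\<close>

definition H1 :: "'n::finite \<Rightarrow> 'n \<Rightarrow> (real ^ 'n \<Rightarrow> real) set" where
  "H1 p q = {\<psi> \<in> L2 sphere_measure. \<exists>G. has_weak_gradient p q \<psi> G}"

text \<open>The weak gradient is unique up to null sets, so the choice below does not affect integrals.\<close>

definition sphere_grad :: "'n::finite \<Rightarrow> 'n \<Rightarrow> (real ^ 'n \<Rightarrow> real) \<Rightarrow> real ^ 'n \<Rightarrow> real ^ 'n" where
  "sphere_grad p q \<psi> = (SOME G. has_weak_gradient p q \<psi> G)"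


section \<open>The eigenvalue problem\<close>

definition eigenspace :: "'n::finite \<Rightarrow> 'n \<Rightarrow> real \<Rightarrow> (real ^ 'n \<Rightarrow> real) set" where
  "eigenspace p q \<mu> =
     {\<psi> \<in> H1 p q. \<forall>\<phi> \<in> H1 p q.
        (LINT x:slit_sphere p q|sphere_measure. sphere_grad p q \<psi> x \<bullet> sphere_grad p q \<phi> x) =
        \<mu> * (LINT x:slit_sphere p q|sphere_measure. \<psi> x * \<phi> x)}"

definition eigenfunction :: "'n::finite \<Rightarrow> 'n \<Rightarrow> real \<Rightarrow> (real ^ 'n \<Rightarrow> real) \<Rightarrow> bool" where
  "eigenfunction p q \<mu> \<psi> \<longleftrightarrow> \<psi> \<in> eigenspace p q \<mu> \<and> \<not> (AE x in sphere_measure. \<psi> x = 0)"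

definition point_spectrum :: "'n::finite \<Rightarrow> 'n \<Rightarrow> real set" where
  "point_spectrum p q = {\<mu>. \<exists>\<psi>. eigenfunction p q \<mu> \<psi>}"


section \<open>Bases and boundedness modulo null functions\<close>

text \<open>
  \<open>Y 1, \<dots>, Y n\<close> is a basis of the vector space \<open>V\<close> of functions modulo equality almost everywhere.
\<close>

definition AE_basis ::
    "'a measure \<Rightarrow> ('a \<Rightarrow> real) set \<Rightarrow> nat \<Rightarrow> (nat \<Rightarrow> 'a \<Rightarrow> real) \<Rightarrow> bool" where
  "AE_basis M V n Y \<longleftrightarrow>
     (\<forall>i\<in>{1..n}. Y i \<in> V) \<and>
     (\<forall>c. (AE x in M. (\<Sum>i=1..n. c i * Y i x) = 0) \<longrightarrow> (\<forall>i\<in>{1..n}. c i = 0)) \<and>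
     (\<forall>\<psi>\<in>V. \<exists>c. AE x in M. \<psi> x = (\<Sum>i=1..n. c i * Y i x))"

definition has_multiplicity :: "'n::finite \<Rightarrow> 'n \<Rightarrow> real \<Rightarrow> nat \<Rightarrow> bool" where
  "has_multiplicity p q \<mu> n \<longleftrightarrow> (\<exists>Y. AE_basis sphere_measure (eigenspace p q \<mu>) n Y)"

text \<open>An orthonormal family in \<open>L\<^sup>2\<close> whose linear span is dense.\<close>

definition L2_orthonormal_basis :: "'a measure \<Rightarrow> 'i set \<Rightarrow> ('i \<Rightarrow> 'a \<Rightarrow> real) \<Rightarrow> bool" where
  "L2_orthonormal_basis M I e \<longleftrightarrow>
     (\<forall>i\<in>I. e i \<in> L2 M) \<and>
     (\<forall>i\<in>I. \<forall>j\<in>I. (LINT x|M. e i x * e j x) = (if i = j then 1 else 0)) \<and>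
     (\<forall>f\<in>L2 M. \<forall>\<epsilon>>0. \<exists>F c. finite F \<and> F \<subseteq> I \<and>
        (LINT x|M. (f x - (\<Sum>i\<in>F. c i * e i x))\<^sup>2) < \<epsilon>)"

definition L_infinity :: "'a measure \<Rightarrow> ('a \<Rightarrow> real) set" where
  "L_infinity M = {f \<in> borel_measurable M. \<exists>C. AE x in M. \<bar>f x\<bar> \<le> C}"

end

theory Submission
  imports Defs
begin

text \<open>
  Write \<open>x\<^sub>p + \<i> x\<^sub>q = w\<^sup>2\<close> with \<open>Im w \<ge> 0\<close>. This square root unfolds the slit: the half-hyperplane
  \<open>x\<^sub>q = 0\<close>, \<open>x\<^sub>p \<ge> 0\<close> becomes \<open>Im w = 0\<close>, and a smooth function of \<open>(x', w)\<close> that is even in \<open>Im w\<close>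
  satisfies Neumann conditions on both sides. The functions \<open>Re (w\<^sup>j)\<close> are harmonic. Therefore the
  products \<open>u = Re (w\<^sup>j) x\<^sup>\<alpha>\<close>, with a monomial in \<open>x'\<close>, are homogeneous of degree \<open>d = j / 2 + |\<alpha>|\<close>, and
  on the sphere
    \<open>- \<Delta> u = d (d + N - 2) u - Re (w\<^sup>j) \<Delta> x\<^sup>\<alpha>\<close>.
  With the level \<open>k = j + 2 |\<alpha>|\<close> the first coefficient is \<open>k (k + 2 N - 4) / 4\<close>, and the last term is a
  combination of products of level \<open>k - 4\<close>. The operator is thus triangular with distinct diagonal
  entries, and every product becomes an eigenfunction after a correction of lower level
  (\<open>triangular_diagonalization\<close>). The products span a dense subspace of \<open>L\<^sup>2\<close> (\<open>slit_span_dense\<close>), so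
  there are no other eigenvalues or eigenfunctions, and all eigenfunctions are bounded. Every \<open>k\<close> occurs
  because of \<open>Re (w\<^sup>k)\<close>, and level zero contains only the constants.

  Two analytic facts justify this in the weak setting. Weak gradients are unique
  (\<open>weak_gradient_unique\<close>), which follows from density of the products. Green's identity
  (\<open>slit_poly_green\<close>) holds for a product against every function in the Sobolev space, although test
  fields have to vanish near the slit. Here the gradient of the product is multiplied by a cutoff in
  \<open>Im w / e\<close>. The error consists of the derivative of the cutoff along the gradient; since the root is
  conformal and the product is even in \<open>Im w\<close>, it is bounded by a multiple of \<open>|w|\<^sup>-\<^sup>2\<close> on the strip
  \<open>e \<le> Im w \<le> 2 e\<close>. A dyadic decomposition shows that this is bounded in \<open>L\<^sup>2\<close> uniformly in \<open>e\<close>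
  (\<open>nn_integral_strip_bound\<close>). As the strips shrink to nothing, the error tends weakly to zero.

  The passage from smooth to weak gradients of the products is the divergence theorem on the sphere
  (\<open>sphere_divergence_theorem\<close>), derived from the translation invariance of Lebesgue measure.
\<close>

section \<open>Continuously differentiable functions on an open set\<close>

text \<open>
  The local form of \<^const>\<open>Ck\<close>: a field that is given by different formulas on the two
  members of an open cover is handled by \<open>Ck_on_Un\<close>. The definition is only meaningful for open \<open>S\<close>.
\<close>

primrec Ck_on :: "nat \<Rightarrow> 'a set \<Rightarrow> ('a::real_normed_vector \<Rightarrow> 'b::real_normed_vector) \<Rightarrow> bool" where
  "Ck_on 0 S f \<longleftrightarrow> continuous_on S f"
| "Ck_on (Suc k) S f \<longleftrightarrow>
     (\<forall>x\<in>S. f differentiable (at x)) \<and> (\<forall>v. Ck_on k S (\<lambda>x. frechet_derivative f (at x) v))"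

lemma Ck_iff_Ck_on: "Ck k f \<longleftrightarrow> Ck_on k UNIV f"
  by (induction k arbitrary: f) (auto simp: differentiable_on_def)

lemma Ck_on_cong:
  assumes "open S" "\<And>x. x \<in> S \<Longrightarrow> f x = g x" "Ck_on k S f"
  shows "Ck_on k S g"
  using assms(2,3)
proof (induction k arbitrary: f g)
  case 0
  then show ?case by (auto cong: continuous_on_cong)
next
  case (Suc k)
  have d: "(g has_derivative frechet_derivative f (at x)) (at x)" if "x \<in> S" for x
  proof -
    have "(f has_derivative frechet_derivative f (at x)) (at x)"
      using Suc.prems that by (auto simp: frechet_derivative_works)
    then show ?thesis
      by (rule has_derivative_transform_within_open[OF _ assms(1) that]) (use Suc.prems in auto)
  qed
  have e: "frechet_derivative g (at x) = frechet_derivative f (at x)" if "x \<in> S" for x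
    using frechet_derivative_at[OF d[OF that]] by simp
  have "Ck_on k S (\<lambda>x. frechet_derivative g (at x) v)" for v
    by (rule Suc.IH[of "\<lambda>x. frechet_derivative f (at x) v"]) (use e Suc.prems in auto)
  moreover have "\<forall>x\<in>S. g differentiable (at x)"
    using d by (auto simp: differentiable_def)
  ultimately show ?case by simp
qed

lemma Ck_on_SucI:
  assumes "open S" "\<And>x. x \<in> S \<Longrightarrow> (f has_derivative f' x) (at x)"
    and "\<And>v. Ck_on k S (\<lambda>x. f' x v)"
  shows "Ck_on (Suc k) S f"
proof -
  have e: "frechet_derivative f (at x) = f' x" if "x \<in> S" for x
    using frechet_derivative_at[OF assms(2)[OF that]] by simp
  have "Ck_on k S (\<lambda>x. frechet_derivative f (at x) v)" for v
    by (rule Ck_on_cong[OF assms(1) _ assms(3)[of v]]) (use e in auto)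
  then show ?thesis using assms(2) by (auto simp: differentiable_def)
qed

lemma Ck_on_SucD:
  assumes "Ck_on (Suc k) S f" "x \<in> S"
  shows "(f has_derivative frechet_derivative f (at x)) (at x)"
  using assms by (auto simp: frechet_derivative_works)

lemma Ck_on_frechet_derivative:
  assumes "Ck_on (Suc k) S f"
  shows "Ck_on k S (\<lambda>x. frechet_derivative f (at x) v)"
  using assms by auto

lemma Ck_on_of_Suc: "Ck_on (Suc k) S f \<Longrightarrow> Ck_on k S f"
proof (induction k arbitrary: f)
  case 0
  then show ?case
    by (auto intro!: continuous_at_imp_continuous_on differentiable_imp_continuous_within)
next
  case (Suc k)
  then show ?case by (metis Ck_on.simps(2))
qed

lemma Ck_on_imp_continuous_on: "Ck_on k S f \<Longrightarrow> continuous_on S f"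
proof (induction k)
  case (Suc k)
  then show ?case by (blast dest: Ck_on_of_Suc)
qed simp

lemma Ck_on_subset: "Ck_on k T f \<Longrightarrow> S \<subseteq> T \<Longrightarrow> Ck_on k S f"
proof (induction k arbitrary: f)
  case 0
  then show ?case by (simp add: continuous_on_subset[of T f S])
next
  case (Suc k)
  then show ?case by (simp add: subset_iff)
qed

lemma Ck_on_Un:
  assumes "open S" "open T" "Ck_on k S f" "Ck_on k T f"
  shows "Ck_on k (S \<union> T) f"
  using assms(3,4)
proof (induction k arbitrary: f)
  case 0
  then show ?case using assms(1,2) by (simp add: continuous_on_open_Un)
next
  case (Suc k)
  then show ?case by (simp add: ball_Un)
qed

lemma Ck_on_const: "open S \<Longrightarrow> Ck_on k S (\<lambda>_. c)"
proof (induction k arbitrary: c)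
  case (Suc k)
  show ?case by (rule Ck_on_SucI[where f' = "\<lambda>_ _. 0"]) (use Suc in auto)
qed auto

lemma Ck_on_add:
  assumes "open S"
  shows "Ck_on k S f \<Longrightarrow> Ck_on k S g \<Longrightarrow> Ck_on k S (\<lambda>x. f x + g x)"
proof (induction k arbitrary: f g)
  case 0
  then show ?case by (auto intro: continuous_intros)
next
  case (Suc k)
  show ?case
    by (rule Ck_on_SucI[OF assms has_derivative_add[OF Ck_on_SucD[OF Suc.prems(1)] Ck_on_SucD[OF Suc.prems(2)]]])
      (auto intro!: Suc.IH Ck_on_frechet_derivative Suc.prems)
qed

lemma Ck_on_sum:
  assumes "open S" "\<And>i. i \<in> I \<Longrightarrow> Ck_on k S (f i)"
  shows "Ck_on k S (\<lambda>x. \<Sum>i\<in>I. f i x)"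
  using assms(2)
  by (induction I rule: infinite_finite_induct) (auto intro: Ck_on_const Ck_on_add assms(1))

lemma Ck_on_bilinear:
  assumes "bounded_bilinear prd" "open S"
  shows "Ck_on k S f \<Longrightarrow> Ck_on k S g \<Longrightarrow> Ck_on k S (\<lambda>x. prd (f x) (g x))"
proof (induction k arbitrary: f g)
  case 0
  then show ?case by (auto intro: bounded_bilinear.continuous_on[OF assms(1)])
next
  case (Suc k)
  show ?case
    by (rule Ck_on_SucI[OF assms(2) bounded_bilinear.FDERIV[OF assms(1) Ck_on_SucD[OF Suc.prems(1)] Ck_on_SucD[OF Suc.prems(2)]]])
      (assumption | rule Ck_on_add[OF assms(2)] Suc.IH Ck_on_frechet_derivative[OF Suc.prems(1)] Ck_on_frechet_derivative[OF Suc.prems(2)]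
        Ck_on_of_Suc[OF Suc.prems(1)] Ck_on_of_Suc[OF Suc.prems(2)])+
qed

lemmas Ck_on_mult = Ck_on_bilinear[OF bounded_bilinear_mult]
lemmas Ck_on_scaleR = Ck_on_bilinear[OF bounded_bilinear_scaleR]

lemma Ck_on_linear:
  assumes "bounded_linear L" "open S"
  shows "Ck_on k S f \<Longrightarrow> Ck_on k S (\<lambda>x. L (f x))"
proof (induction k arbitrary: f)
  case 0
  then show ?case by (auto intro: bounded_linear.continuous_on[OF assms(1)])
next
  case (Suc k)
  show ?case
    by (rule Ck_on_SucI[OF assms(2) bounded_linear.has_derivative[OF assms(1) Ck_on_SucD[OF Suc.prems(1)]]])
      (auto intro!: Suc.IH Ck_on_frechet_derivative Suc.prems)
qed

lemma Ck_on_bounded_linear: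
  assumes "bounded_linear L" "open S"
  shows "Ck_on k S L"
proof (cases k)
  case 0
  then show ?thesis using assms by (auto intro: linear_continuous_on)
next
  case (Suc n)
  show ?thesis unfolding Suc
    by (rule Ck_on_SucI[OF assms(2) bounded_linear_imp_has_derivative[OF assms(1)] Ck_on_const[OF assms(2)]])
qed

lemma Ck_on_compose_real:
  fixes h :: "real \<Rightarrow> real" and g :: "'a::real_normed_vector \<Rightarrow> real"
  assumes "open S" "open T" "g ` S \<subseteq> T"
  shows "Ck_on k T h \<Longrightarrow> Ck_on k S g \<Longrightarrow> Ck_on k S (\<lambda>x. h (g x))"
  using assms(3)
proof (induction k arbitrary: h)
  case 0
  then show ?case by (auto intro: continuous_on_compose2)
next
  case (Suc k)
  have d: "((\<lambda>x. h (g x)) has_derivative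
      (\<lambda>v. frechet_derivative g (at x) v * frechet_derivative h (at (g x)) 1)) (at x)" if "x \<in> S" for x
  proof -
    have "g x \<in> T" using that Suc.prems by auto
    from has_derivative_compose[OF Ck_on_SucD[OF Suc.prems(2) that] Ck_on_SucD[OF Suc.prems(1) this]]
    have *: "((\<lambda>x. h (g x)) has_derivative
      (\<lambda>v. frechet_derivative h (at (g x)) (frechet_derivative g (at x) v))) (at x)" .
    have "linear (frechet_derivative h (at (g x)))"
      using Ck_on_SucD[OF Suc.prems(1) \<open>g x \<in> T\<close>] by (rule has_derivative_linear)
    then have "(\<lambda>v. frechet_derivative h (at (g x)) (frechet_derivative g (at x) v)) =
        (\<lambda>v. frechet_derivative g (at x) v * frechet_derivative h (at (g x)) 1)"
      using linear_scale[of "frechet_derivative h (at (g x))" "frechet_derivative g (at x) v" 1 for v]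
      by (metis mult.right_neutral real_scaleR_def)
    then show ?thesis using * by simp
  qed
  show ?case
    by (rule Ck_on_SucI[OF assms(1) d])
     (assumption | rule Ck_on_mult[OF assms(1)] Suc.IH[of "\<lambda>t. frechet_derivative h (at t) 1"]
        Suc.prems(3) Ck_on_frechet_derivative[OF Suc.prems(1)] Ck_on_frechet_derivative[OF Suc.prems(2)]
        Ck_on_of_Suc[OF Suc.prems(2)])+
qed

section \<open>A smooth step function\<close>

text \<open>
  For \<open>n = 0\<close> this is the classical flat function \<open>exp (- 1 / t)\<close>. The powers of \<open>1 / t\<close> are carried
  along so that the family is closed, up to linear combinations, under differentiation.
\<close>

definition flat :: "nat \<Rightarrow> real \<Rightarrow> real" where
  "flat n t = (if t > 0 then (1 / t) ^ n * exp (- (1 / t)) else 0)"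

lemma flat_tendsto_0: "(flat n \<longlongrightarrow> 0) (at 0)"
proof -
  have "((\<lambda>s. s ^ n / exp s) \<longlongrightarrow> 0) (at_top :: real filter)"
    by (rule tendsto_power_div_exp_0)
  from filterlim_compose[OF this filterlim_inverse_at_top_right]
  have r: "((\<lambda>t::real. (inverse t) ^ n / exp (inverse t)) \<longlongrightarrow> 0) (at_right 0)" .
  have "(flat n \<longlongrightarrow> 0) (at_right 0)"
    by (rule Lim_transform_eventually[OF r])
      (auto simp: eventually_at_filter flat_def exp_minus inverse_eq_divide)
  moreover have "(flat n \<longlongrightarrow> 0) (at_left 0)"
    by (rule Lim_transform_eventually[OF tendsto_const])
      (auto simp: eventually_at_filter flat_def)
  ultimately show ?thesis by (simp add: filterlim_split_at)
qed

lemma recip_power_deriv: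
  assumes "t > (0::real)"
  shows "((\<lambda>t. (1 / t) ^ n) has_real_derivative - real n * (1 / t) ^ Suc n) (at t)"
proof -
  have "((\<lambda>t. 1 / t) has_real_derivative - (1 / t)\<^sup>2) (at t)"
    using assms by (auto intro!: derivative_eq_intros simp: power2_eq_square)
  from DERIV_power[OF this, of n] show ?thesis
    by (rule DERIV_cong) (cases n; simp add: power2_eq_square add_divide_distrib diff_divide_distrib algebra_simps)
qed

lemma flat_deriv: "(flat n has_real_derivative (flat (n+2) t - real n * flat (n+1) t)) (at t)"
proof -
  consider "t > 0" | "t < 0" | "t = 0" by linarith
  then show ?thesis
  proof cases
    case 1
    have *: "((\<lambda>t. exp (- (1 / t))) has_real_derivative exp (- (1 / t)) * (1 / t)\<^sup>2) (at t)"
      using 1 by (auto intro!: derivative_eq_intros simp: power2_eq_square)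
    have "((\<lambda>t. (1 / t) ^ n * exp (- (1 / t))) has_real_derivative (flat (n+2) t - real n * flat (n+1) t)) (at t)"
      by (rule DERIV_cong[OF DERIV_mult[OF recip_power_deriv[OF 1] *]])
        (use 1 in \<open>simp add: flat_def power2_eq_square algebra_simps\<close>)
    then show ?thesis
      by (rule has_field_derivative_transform_within_open[where S="{0<..}"]) (use 1 in \<open>auto simp: flat_def\<close>)
  next
    case 2
    have "((\<lambda>t. 0) has_real_derivative (flat (n+2) t - real n * flat (n+1) t)) (at t)"
      using 2 by (auto simp: flat_def)
    then show ?thesis
      by (rule has_field_derivative_transform_within_open[where S="{..<0}"]) (use 2 in \<open>auto simp: flat_def\<close>)
  next
    case 3
    have "((\<lambda>h. (flat n (0 + h) - flat n 0) / h) \<longlongrightarrow> 0) (at 0)"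
      by (rule Lim_transform_eventually[OF flat_tendsto_0[of "Suc n"]])
        (auto simp: eventually_at_filter flat_def)
    then show ?thesis using 3 by (simp add: DERIV_def flat_def)
  qed
qed

lemma Ck_on_flat: "Ck_on k UNIV (flat n)"
proof (induction k arbitrary: n)
  case 0
  show ?case using flat_deriv by (auto intro!: continuous_at_imp_continuous_on DERIV_isCont)
next
  case (Suc k)
  show ?case
  proof (rule Ck_on_SucI[OF open_UNIV])
    show "(flat n has_derivative (\<lambda>v. (flat (n+2) x + (- real n) * flat (n+1) x) * v)) (at x)" for x
      using flat_deriv[of n x] by (simp add: has_field_derivative_def)
    show "Ck_on k UNIV (\<lambda>x. (flat (n + 2) x + - real n * flat (n + 1) x) * v)" for v
      by (intro Ck_on_mult Ck_on_add Ck_on_const Suc.IH open_UNIV)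
  qed
qed

lemma Ck_on_recip_power: "Ck_on k {0<..} (\<lambda>t::real. (1 / t) ^ n)"
proof (induction k arbitrary: n)
  case 0
  show ?case by (auto intro!: continuous_intros)
next
  case (Suc k)
  show ?case
  proof (rule Ck_on_SucI[where f' = "\<lambda>x v. - real n * (1 / x) ^ Suc n * v"])
    show "((\<lambda>t. (1 / t) ^ n) has_derivative (\<lambda>v. - real n * (1 / x) ^ Suc n * v)) (at x)"
      if "x \<in> {0<..}" for x :: real
      by (rule recip_power_deriv[unfolded has_field_derivative_def]) (use that in simp)
    show "Ck_on k {0<..} (\<lambda>x. - real n * (1 / x) ^ Suc n * v)" for v
      by (intro Ck_on_mult Ck_on_const Suc.IH open_greaterThan)
  qed (rule open_greaterThan)
qed

text \<open>
  A partition of unity quotient: the two flat functions never vanish simultaneously, and one of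
  them vanishes for \<open>t \<le> 1\<close>, the other for \<open>t \<ge> 2\<close>.
\<close>

definition step :: "real \<Rightarrow> real" where
  "step t = flat 0 (t - 1) / (flat 0 (t - 1) + flat 0 (2 - t))"

lemma flat_nonneg: "flat n t \<ge> 0"
  by (simp add: flat_def)

lemma flat_pos: "t > 0 \<Longrightarrow> flat n t > 0"
  by (simp add: flat_def)

lemma step_denominator_pos: "flat 0 (t - 1) + flat 0 (2 - t) > 0"
proof (cases "t > 1")
  case True
  then show ?thesis by (intro add_pos_nonneg flat_pos flat_nonneg) simp
next
  case False
  then show ?thesis by (intro add_nonneg_pos flat_pos flat_nonneg) simp
qed

lemma step_eq_0: "t \<le> 1 \<Longrightarrow> step t = 0"
  by (simp add: step_def flat_def)

lemma step_eq_1: "t \<ge> 2 \<Longrightarrow> step t = 1"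
  by (simp add: step_def flat_def)

lemma step_nonneg: "0 \<le> step t"
  unfolding step_def by (intro divide_nonneg_pos flat_nonneg step_denominator_pos)

lemma step_le_1: "step t \<le> 1"
  using step_denominator_pos[of t] flat_nonneg[of 0 "2 - t"] by (simp add: step_def)

lemma Ck_on_step: "Ck_on k UNIV step"
proof -
  have lin: "Ck_on k UNIV (\<lambda>t::real. a + b * t)" for a b
    by (intro Ck_on_add Ck_on_mult Ck_on_const Ck_on_bounded_linear) auto
  have 1: "Ck_on k UNIV (\<lambda>t. flat 0 (- 1 + 1 * t))" "Ck_on k UNIV (\<lambda>t. flat 0 (2 + (-1) * t))"
    by (rule Ck_on_compose_real[OF open_UNIV open_UNIV _ Ck_on_flat lin]; simp)+
  have "Ck_on k UNIV (\<lambda>t. (1 / (flat 0 (- 1 + 1 * t) + flat 0 (2 + (-1) * t))) ^ 1)"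
    by (rule Ck_on_compose_real[OF open_UNIV _ _ Ck_on_recip_power Ck_on_add[OF _ 1]])
      (use step_denominator_pos in \<open>auto simp: algebra_simps\<close>)
  from Ck_on_mult[OF open_UNIV 1(1) this]
  show ?thesis
    by (rule Ck_on_cong[OF open_UNIV, rotated]) (simp add: step_def algebra_simps)
qed

definition step' :: "real \<Rightarrow> real" where
  "step' t = frechet_derivative step (at t) 1"

lemma step_deriv: "(step has_real_derivative step' t) (at t)"
proof -
  have d: "(step has_derivative frechet_derivative step (at t)) (at t)"
    by (rule Ck_on_SucD[OF Ck_on_step[of "Suc 0"] UNIV_I])
  have "frechet_derivative step (at t) = (\<lambda>v. step' t * v)"
  proof
    show "frechet_derivative step (at t) v = step' t * v" for v
      using linear_scale[OF has_derivative_linear[OF d], of v 1] by (simp add: step'_def)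
  qed
  then show ?thesis using d by (simp add: has_field_derivative_def)
qed

lemma continuous_on_step': "continuous_on S step'"
proof -
  have "continuous_on UNIV step'"
    using Ck_on_imp_continuous_on[OF Ck_on_frechet_derivative[OF Ck_on_step[of "Suc 0"], of 1]]
    unfolding step'_def .
  then show ?thesis by (rule continuous_on_subset) simp
qed

lemma step'_eq_0: assumes "t \<notin> {1..2}" shows "step' t = 0"
proof -
  have "(step has_real_derivative 0) (at t)"
  proof (cases "t < 1")
    case True
    show ?thesis
      by (rule has_field_derivative_transform_within_open[where S="{..<1}" and f="\<lambda>_. 0"])
        (use True in \<open>auto simp: step_eq_0\<close>)
  next
    case False
    show ?thesis
      by (rule has_field_derivative_transform_within_open[where S="{2<..}" and f="\<lambda>_. 1"])
        (use False assms in \<open>auto simp: step_eq_1\<close>)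
  qed
  then show ?thesis by (rule DERIV_unique[OF step_deriv])
qed

lemma step'_bounded: obtains C where "C > 0" "\<And>t. \<bar>step' t\<bar> \<le> C"
proof -
  have "bounded (step' ` {1..2})"
    by (intro compact_imp_bounded compact_continuous_image continuous_on_step') auto
  then obtain C where C: "C > 0" "\<And>t. t \<in> {1..2} \<Longrightarrow> \<bar>step' t\<bar> \<le> C"
    by (auto simp: bounded_pos)
  have "\<bar>step' t\<bar> \<le> C" for t
    by (cases "t \<in> {1..2}") (use C step'_eq_0 in simp_all)
  with C(1) show ?thesis by (rule that)
qed

section \<open>Integration over the sphere\<close>

lemma scale_measure_eq_density: "scale_measure c M = density M (\<lambda>_. c)"
  by (rule measure_eqI) (auto simp: emeasure_density nn_integral_cmult_indicator)

lemma space_sphere_measure [simp]: "space sphere_measure = sphere 0 1"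
  by (simp add: sphere_measure_def space_scale_measure space_restrict_space)

lemma sets_sphere_measure [measurable_cong]:
  "sets sphere_measure = sets (restrict_space borel (sphere 0 1))"
  by (simp add: sphere_measure_def)

lemma measurable_normalize:
  "(\<lambda>x. x /\<^sub>R norm x) \<in> measurable (restrict_space lborel (cball 0 1 - {0}))
     (restrict_space borel (sphere (0::real ^ 'n) 1))"
proof (rule measurable_restrict_space2)
  show "(\<lambda>x::real ^ 'n. x /\<^sub>R norm x) \<in> borel_measurable (restrict_space lborel (cball 0 1 - {0}))"
    by (rule measurable_restrict_space1) simp
qed (auto simp: space_restrict_space)

lemma nn_integral_sphere:
  fixes f :: "real ^ 'n \<Rightarrow> ennreal"
  assumes "f \<in> borel_measurable sphere_measure"
  shows "(\<integral>\<^sup>+x. f x \<partial>sphere_measure) =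
    ennreal (real CARD('n)) * (\<integral>\<^sup>+x. f (x /\<^sub>R norm x) * indicator (cball 0 1 - {0}) x \<partial>lborel)"
proof -
  have f: "f \<in> borel_measurable (restrict_space borel (sphere 0 1))"
    using assms by (simp cong: measurable_cong_sets add: sets_sphere_measure)
  show ?thesis
    unfolding sphere_measure_def
    by (subst nn_integral_scale_measure, use f in simp)
      (simp only: nn_integral_distr[OF measurable_normalize] f measurable_distr_eq1,
       subst nn_integral_restrict_space, simp_all)
qed

lemma integral_sphere:
  fixes f :: "real ^ 'n \<Rightarrow> real"
  assumes "f \<in> borel_measurable sphere_measure"
  shows "(LINT x|sphere_measure. f x) =
    real CARD('n) * (LINT x:cball 0 1 - {0}|lborel. f (x /\<^sub>R norm x))"
proof -
  have f: "f \<in> borel_measurable (restrict_space borel (sphere 0 1))"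
    using assms by (simp cong: measurable_cong_sets add: sets_sphere_measure)
  let ?D = "distr (restrict_space lborel (cball 0 1 - {0})) (restrict_space borel (sphere 0 1))
    (\<lambda>x::real ^ 'n. x /\<^sub>R norm x)"
  have "(LINT x|sphere_measure. f x) = (LINT x|?D. real CARD('n) *\<^sub>R f x)"
    unfolding sphere_measure_def scale_measure_eq_density
    by (subst integral_density) (use f in simp_all)
  also have "\<dots> = real CARD('n) * (LINT x|?D. f x)"
    by simp
  also have "(LINT x|?D. f x) = (LINT x:cball 0 1 - {0}|lborel. f (x /\<^sub>R norm x))"
    by (simp only: integral_distr[OF measurable_normalize f] set_lebesgue_integral_def)
      (subst integral_restrict_space, simp_all)
  finally show ?thesis .
qed

text \<open>
  The cone over a part of the sphere lies in the box with the same bounds on the coordinates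
  \<open>p\<close> and \<open>q\<close>, since shrinking towards the origin decreases the modulus of every coordinate. The constant is
  crude; only the factor \<open>a * b\<close> matters, which says that the edge of the slit has codimension two.
\<close>

lemma emeasure_sphere_box_le:
  fixes p q :: "'n::finite"
  assumes "p \<noteq> q" "a \<ge> 0" "b \<ge> 0"
    and A: "A \<in> sets sphere_measure" "\<And>x. x \<in> A \<Longrightarrow> \<bar>x $ p\<bar> \<le> a \<and> \<bar>x $ q\<bar> \<le> b"
  shows "emeasure sphere_measure A \<le> ennreal (real CARD('n) * 2 ^ CARD('n) * (a * b))"
proof -
  define u :: "real ^ 'n" where "u = (\<chi> i. if i = p then a else if i = q then b else 1)"
  have u0: "0 \<le> u $ i" for i using assms by (auto simp: u_def)
  have "(x /\<^sub>R norm x \<in> A \<and> x \<in> cball 0 1 - {0}) \<longrightarrow> x \<in> cbox (-u) u" for x :: "real ^ 'n"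
  proof (intro impI)
    assume x: "x /\<^sub>R norm x \<in> A \<and> x \<in> cball 0 1 - {0}"
    then have n: "0 < norm x" "norm x \<le> 1" by auto
    have "\<bar>x $ i\<bar> \<le> u $ i" for i
    proof -
      have le: "\<bar>x $ i\<bar> \<le> \<bar>(x /\<^sub>R norm x) $ i\<bar>"
        using n by (simp add: abs_mult field_simps mult_left_le_one_le)
      consider "i = p" | "i = q" "i \<noteq> p" | "i \<noteq> p" "i \<noteq> q" by blast
      then show ?thesis
      proof cases
        case 3
        then show ?thesis using component_le_norm_cart[of x i] n by (simp add: u_def)
      next
        case 1
        then show ?thesis using le A(2)[of "x /\<^sub>R norm x"] x by (simp add: u_def)
      next
        case 2
        then show ?thesis using le A(2)[of "x /\<^sub>R norm x"] x by (simp add: u_def)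
      qed
    qed
    then show "x \<in> cbox (-u) u" by (auto simp: mem_box_cart abs_le_iff minus_le_iff)
  qed
  then have le: "indicator A (x /\<^sub>R norm x) * indicator (cball 0 1 - {0}) x \<le> (indicator (cbox (-u) u) x :: ennreal)"
    for x by (auto simp: indicator_def)
  have "emeasure sphere_measure A = (\<integral>\<^sup>+x. indicator A x \<partial>sphere_measure)"
    using A by simp
  also have "\<dots> = ennreal (real CARD('n)) * (\<integral>\<^sup>+x. indicator A (x /\<^sub>R norm x) * indicator (cball 0 1 - {0}) x \<partial>lborel)"
    using A by (intro nn_integral_sphere) auto
  also have "\<dots> \<le> ennreal (real CARD('n)) * (\<integral>\<^sup>+x. indicator (cbox (-u) u) x \<partial>lborel)"
    by (intro mult_left_mono nn_integral_mono le) auto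
  also have "(\<integral>\<^sup>+x. indicator (cbox (-u) u) x \<partial>lborel) = ennreal (measure lborel (cbox (-u) u))"
    using emeasure_lborel_cbox_finite[of "-u" u]
    by (simp add: emeasure_eq_ennreal_measure del: emeasure_lborel_cbox)
  also have "measure lborel (cbox (-u) u) = (\<Prod>i\<in>UNIV. u $ i - (-u) $ i)"
    using u0 by (subst content_cbox_cart) (auto simp: interval_ne_empty_cart intro: order_trans[of _ 0])
  also have "\<dots> = (\<Prod>i\<in>UNIV. 2 * u $ i)" by (intro prod.cong) auto
  also have "\<dots> = 2 ^ CARD('n) * (\<Prod>i\<in>UNIV. u $ i)" by (simp add: prod.distrib)
  also have "(\<Prod>i\<in>UNIV. u $ i) = u $ p * (u $ q * (\<Prod>i\<in>UNIV - {p} - {q}. u $ i))"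
    using assms(1) by (simp add: prod.remove[of UNIV p] prod.remove[of "UNIV - {p}" q])
  also have "(\<Prod>i\<in>UNIV - {p} - {q}. u $ i) = 1"
    by (intro prod.neutral) (auto simp: u_def)
  finally show ?thesis using assms(1,2,3) by (simp add: u_def ennreal_mult'[symmetric] mult_ac)
qed

lemma emeasure_sphere_finite: "emeasure sphere_measure (sphere (0::real ^ 'n) 1) < \<infinity>"
proof -
  have "emeasure sphere_measure (sphere (0::real ^ 'n) 1) = (\<integral>\<^sup>+x. indicator (sphere (0::real ^ 'n) 1) x \<partial>sphere_measure)"
    by (subst nn_integral_indicator) (auto simp: sets_sphere_measure sets_restrict_space)
  also have "\<dots> = ennreal (real CARD('n)) * (\<integral>\<^sup>+x. indicator (sphere 0 1) (x /\<^sub>R norm x) * indicator (cball 0 1 - {0::real ^ 'n}) x \<partial>lborel)"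
    by (intro nn_integral_sphere borel_measurable_indicator) (auto simp: sets_sphere_measure sets_restrict_space)
  also have "\<dots> \<le> ennreal (real CARD('n)) * (\<integral>\<^sup>+x. indicator (cball 0 1) (x::real ^ 'n) \<partial>lborel)"
    by (intro mult_left_mono nn_integral_mono) (auto simp: indicator_def)
  also have "\<dots> < \<infinity>"
    using emeasure_lborel_cball_finite[of "0::real ^ 'n" 1] by (simp add: ennreal_mult_less_top)
  finally show ?thesis .
qed

lemma finite_measure_sphere: "finite_measure (sphere_measure :: (real ^ 'n) measure)"
  by (rule finite_measureI) (use emeasure_sphere_finite in \<open>auto simp: less_top\<close>)

lemma borel_in_sphere_sets: "A \<in> sets borel \<Longrightarrow> A \<inter> sphere 0 1 \<in> sets sphere_measure"
  by (auto simp: sets_sphere_measure sets_restrict_space)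

lemma borel_measurable_sphere: "f \<in> borel_measurable borel \<Longrightarrow> f \<in> borel_measurable sphere_measure"
  by (simp cong: measurable_cong_sets add: sets_sphere_measure measurable_restrict_space1)

lemma closed_half_equator: "closed (half_equator p q :: (real ^ 'n::finite) set)"
  unfolding half_equator_def Collect_conj_eq
  by (intro closed_Int) (auto intro!: closed_Collect_le closed_Collect_eq continuous_intros)

lemma half_equator_null:
  fixes p q :: "'n::finite"
  assumes "p \<noteq> q"
  shows "half_equator p q \<in> null_sets sphere_measure"
proof -
  have s: "half_equator p q \<in> sets sphere_measure"
    using borel_in_sphere_sets[OF borel_closed[OF closed_half_equator[of p q]]]
    by (metis (no_types, lifting) half_equator_def inf.orderE mem_Collect_eq subsetI)
  have "emeasure sphere_measure (half_equator p q) \<le> ennreal (real CARD('n) * 2 ^ CARD('n) * (1 * 0))"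
  proof (rule emeasure_sphere_box_le[OF assms _ _ s])
    fix x :: "real ^ 'n" assume "x \<in> half_equator p q"
    then show "\<bar>x $ p\<bar> \<le> 1 \<and> \<bar>x $ q\<bar> \<le> 0"
      using component_le_norm_cart[of x p] by (auto simp: half_equator_def)
  qed auto
  then show ?thesis using s by (auto intro: null_setsI)
qed

lemma integral_slit_sphere:
  fixes f :: "real ^ 'n::finite \<Rightarrow> real"
  assumes "p \<noteq> q" and f: "f \<in> borel_measurable sphere_measure"
  shows "(LINT x:slit_sphere p q|sphere_measure. f x) = (LINT x|sphere_measure. f x)"
proof -
  have "AE x in sphere_measure. x \<notin> half_equator p q"
    using half_equator_null[OF assms(1)] by (rule AE_not_in)
  then have "AE x in sphere_measure. x \<in> slit_sphere p q"
    by (rule AE_mp) (auto intro!: AE_I2)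
  then have ae: "AE x in sphere_measure. indicator (slit_sphere p q) x *\<^sub>R f x = f x"
    by (rule AE_mp) (auto intro!: AE_I2)
  have m: "slit_sphere p q \<in> sets sphere_measure"
    by (metis half_equator_null[OF assms(1)] null_setsD2 sets.compl_sets space_sphere_measure)
  show ?thesis unfolding set_lebesgue_integral_def using ae m f
    by (intro integral_cong_AE) auto
qed

section \<open>The divergence theorem on the sphere\<close>

text \<open>
  The integral of a difference quotient in direction \<open>b\<close> vanishes by translation invariance, and
  the mean value theorem bounds the difference quotients, so that dominated convergence applies.
\<close>

lemma directional_derivative_integral_zero:
  fixes f :: "'a::euclidean_space \<Rightarrow> real"
  assumes d: "\<And>x. (f has_derivative f' x) (at x)"
    and B: "\<And>x. \<bar>f' x b\<bar> \<le> B"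
    and supp: "\<And>x. norm x > R \<Longrightarrow> f x = 0"
  shows "has_bochner_integral lborel (\<lambda>x. f' x b) 0"
proof -
  define h where "h n = 1 / real (Suc n)" for n
  have h: "0 < h n" "h n \<le> 1" for n by (auto simp: h_def)
  have hlim: "filterlim h (at 0) sequentially"
    unfolding filterlim_at h_def
    using LIMSEQ_inverse_real_of_nat by (auto simp: inverse_eq_divide)
  define s where "s n x = (f (h n *\<^sub>R b + x) - f x) / h n" for n x
  have cont: "continuous_on UNIV f"
    using d by (auto intro!: continuous_at_imp_continuous_on has_derivative_continuous)
  then have [measurable]: "f \<in> borel_measurable borel"
    by (rule borel_measurable_continuous_onI)
  have "integrable lborel (\<lambda>x. indicator (cball 0 R) x *\<^sub>R f x)"
    by (intro borel_integrable_compact continuous_on_subset[OF cont]) auto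
  also have "(\<lambda>x. indicator (cball 0 R) x *\<^sub>R f x) = f"
    using supp by (auto simp: indicator_def fun_eq_iff not_le)
  finally have int: "integrable lborel f" .
  have shift: "has_bochner_integral lborel (\<lambda>x. f (c + x)) (LINT x|lborel. f x)" for c
  proof -
    have "integrable (distr lborel borel ((+) c)) f" using int by (simp add: lborel_distr_plus)
    then have 1: "integrable lborel (\<lambda>x. f (c + x))" by (subst (asm) integrable_distr_eq) auto
    have "(LINT x|distr lborel borel ((+) c). f x) = (LINT x|lborel. f (c + x))"
      by (rule integral_distr) auto
    then show ?thesis using 1 by (simp add: has_bochner_integral_iff lborel_distr_plus)
  qed
  have s0: "has_bochner_integral lborel (s n) 0" for n
  proof -
    have "has_bochner_integral lborel (\<lambda>x. (f (h n *\<^sub>R b + x) - f x) / h n)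
      (((LINT x|lborel. f x) - (LINT x|lborel. f x)) / h n)"
      by (intro has_bochner_integral_divide_zero has_bochner_integral_diff shift has_bochner_integral_integrable int)
    then show ?thesis by (simp add: s_def[abs_def])
  qed
  have line: "((\<lambda>t. f (t *\<^sub>R b + x)) has_real_derivative f' (t *\<^sub>R b + x) b) (at t)" for x t
  proof -
    have "((\<lambda>t. t *\<^sub>R b + x) has_derivative (\<lambda>r. r *\<^sub>R b)) (at t)"
      by (auto intro!: derivative_eq_intros)
    from has_derivative_compose[OF this d]
    have "((\<lambda>t. f (t *\<^sub>R b + x)) has_derivative (\<lambda>r. f' (t *\<^sub>R b + x) (r *\<^sub>R b))) (at t)" .
    moreover have "f' (t *\<^sub>R b + x) (r *\<^sub>R b) = f' (t *\<^sub>R b + x) b * r" for r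
      using linear_scale[OF has_derivative_linear[OF d], of "t *\<^sub>R b + x" r b] by simp
    ultimately show ?thesis by (simp add: has_field_derivative_def)
  qed
  have lim: "(\<lambda>n. s n x) \<longlonglongrightarrow> f' x b" for x
  proof -
    have "((\<lambda>e. (f ((0 + e) *\<^sub>R b + x) - f (0 *\<^sub>R b + x)) / e) \<longlongrightarrow> f' (0 *\<^sub>R b + x) b) (at 0)"
      using line[of x 0] unfolding DERIV_def .
    from filterlim_compose[OF this hlim] show ?thesis by (simp add: s_def)
  qed
  have bound: "\<bar>s n x\<bar> \<le> B * indicator (cball 0 (R + norm b)) x" for n x
  proof (cases "x \<in> cball 0 (R + norm b)")
    case True
    have "\<exists>z>0. z < h n \<and> f (h n *\<^sub>R b + x) - f (0 *\<^sub>R b + x) = (h n - 0) * f' (z *\<^sub>R b + x) b"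
      by (rule MVT2[OF h(1)]) (rule line)
    then obtain z where "f (h n *\<^sub>R b + x) - f x = h n * f' (z *\<^sub>R b + x) b" by auto
    then have "s n x = f' (z *\<^sub>R b + x) b" using h(1)[of n] by (simp add: s_def)
    then show ?thesis using B True by simp
  next
    case False
    then have x: "norm x > R + norm b" by simp
    then have "norm x > R" using norm_ge_zero[of b] by linarith
    moreover have "norm (h n *\<^sub>R b + x) > R"
    proof -
      have "norm (h n *\<^sub>R b) \<le> norm b" using h[of n] by (simp add: mult_left_le_one_le)
      moreover have "norm x \<le> norm (h n *\<^sub>R b + x) + norm (h n *\<^sub>R b)"
        using norm_triangle_ineq4[of "h n *\<^sub>R b + x" "h n *\<^sub>R b"] by simp
      ultimately show ?thesis using x by linarith
    qed
    ultimately show ?thesis using supp False by (simp add: s_def)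
  qed
  have m: "(\<lambda>x. f' x b) \<in> borel_measurable lborel"
    by (rule borel_measurable_LIMSEQ_real[OF lim]) (auto simp: s_def[abs_def])
  have w: "integrable lborel (\<lambda>x::'a. B * indicator (cball 0 (R + norm b)) x :: real)"
    using emeasure_lborel_cball_finite[of "0::'a" "R + norm b"]
    by (intro integrable_mult_right integrable_real_indicator) (auto simp: less_top)
  have "integrable lborel (\<lambda>x. f' x b)"
    by (rule integrable_dominated_convergence[OF m _ w, of s])
      (use lim bound in \<open>auto simp: s_def[abs_def]\<close>)
  moreover have "(\<lambda>n. LINT x|lborel. s n x) \<longlonglongrightarrow> (LINT x|lborel. f' x b)"
    by (rule integral_dominated_convergence[OF m _ w])
      (use lim bound in \<open>auto simp: s_def[abs_def]\<close>)
  then have "(LINT x|lborel. f' x b) = 0"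
    using s0 by (simp add: has_bochner_integral_iff LIMSEQ_const_iff)
  ultimately show ?thesis by (simp add: has_bochner_integral_iff)
qed

lemma linear_as_basis_sum:
  fixes L :: "'a::euclidean_space \<Rightarrow> 'b::real_vector"
  assumes "linear L"
  shows "L u = (\<Sum>b\<in>Basis. (u \<bullet> b) *\<^sub>R L b)"
proof -
  have "L u = L (\<Sum>b\<in>Basis. (u \<bullet> b) *\<^sub>R b)" by (simp add: euclidean_representation)
  also have "\<dots> = (\<Sum>b\<in>Basis. (u \<bullet> b) *\<^sub>R L b)"
    by (simp add: linear_sum[OF assms] linear_scale[OF assms])
  finally show ?thesis .
qed

lemma continuous_on_sphere_div:
  fixes X :: "real ^ 'n \<Rightarrow> real ^ 'n"
  assumes "Ck_on (Suc 0) U X"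
  shows "continuous_on U (sphere_div X)"
proof -
  have c: "continuous_on U (\<lambda>x. frechet_derivative X (at x) v)" for v
    using assms by simp
  have "continuous_on U (\<lambda>x. (\<Sum>b\<in>Basis. frechet_derivative X (at x) b \<bullet> b) -
     (\<Sum>b\<in>Basis. (x \<bullet> b) *\<^sub>R frechet_derivative X (at x) b) \<bullet> x)"
    by (intro continuous_intros c)
  then show ?thesis
  proof (rule continuous_on_eq)
    fix x assume "x \<in> U"
    then show "(\<Sum>b\<in>Basis. frechet_derivative X (at x) b \<bullet> b) -
     (\<Sum>b\<in>Basis. (x \<bullet> b) *\<^sub>R frechet_derivative X (at x) b) \<bullet> x = sphere_div X x"
      unfolding sphere_div_def
      using linear_as_basis_sum[OF has_derivative_linear[OF Ck_on_SucD[OF assms]], of x x] by simp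
  qed
qed

lemma borel_measurable_sphere_continuous:
  assumes "continuous_on (sphere 0 1) f"
  shows "f \<in> borel_measurable sphere_measure"
  using borel_measurable_continuous_on_restrict[OF assms]
  by (simp cong: measurable_cong_sets add: sets_sphere_measure)

text \<open>
  A field on the sphere is extended to be homogeneous of degree one and is then multiplied by a
  radial factor \<open>k\<close>. For a tangential field only the last summand contributes to the trace, and it
  contributes the divergence on the sphere.
\<close>

lemma derivative_of_homogeneous_extension:
  fixes X :: "real ^ 'n \<Rightarrow> real ^ 'n"
  assumes "x \<noteq> 0" and X: "(X has_derivative X') (at (x /\<^sub>R norm x))"
    and k: "(k has_real_derivative k') (at (norm x))"
  shows "((\<lambda>x. (k (norm x) * norm x) *\<^sub>R X (x /\<^sub>R norm x)) has_derivative
     (\<lambda>v. (k' * norm x * (v \<bullet> (x /\<^sub>R norm x))) *\<^sub>R X (x /\<^sub>R norm x) +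
        k (norm x) *\<^sub>R ((v \<bullet> (x /\<^sub>R norm x)) *\<^sub>R X (x /\<^sub>R norm x) +
          X' (v - (v \<bullet> (x /\<^sub>R norm x)) *\<^sub>R (x /\<^sub>R norm x))))) (at x)"
proof -
  define n where "n = x /\<^sub>R norm x"
  have pos: "norm x > 0" using assms by simp
  have dn: "(norm has_derivative (\<lambda>v. v \<bullet> n)) (at x)"
    using has_derivative_norm[OF assms(1)] by (simp add: sgn_div_norm n_def)
  have "((\<lambda>x. inverse (norm x) *\<^sub>R x) has_derivative
      (\<lambda>v. inverse (norm x) *\<^sub>R v + (- (inverse (norm x) * (v \<bullet> n) * inverse (norm x))) *\<^sub>R x)) (at x)"
    by (rule has_derivative_scaleR[OF Deriv.has_derivative_inverse[OF _ dn] has_derivative_ident])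
      (use assms in simp)
  moreover have "(\<lambda>v. inverse (norm x) *\<^sub>R v + (- (inverse (norm x) * (v \<bullet> n) * inverse (norm x))) *\<^sub>R x)
     = (\<lambda>v. inverse (norm x) *\<^sub>R (v - (v \<bullet> n) *\<^sub>R n))"
    by (auto simp: n_def algebra_simps)
  ultimately have dnorm: "((\<lambda>x. x /\<^sub>R norm x) has_derivative
      (\<lambda>v. inverse (norm x) *\<^sub>R (v - (v \<bullet> n) *\<^sub>R n))) (at x)" by simp
  have dX: "((\<lambda>x. X (x /\<^sub>R norm x)) has_derivative (\<lambda>v. inverse (norm x) *\<^sub>R X' (v - (v \<bullet> n) *\<^sub>R n))) (at x)"
    using has_derivative_compose[OF dnorm X] linear_scale[OF has_derivative_linear[OF X]] by simp
  have dk: "((\<lambda>x. k (norm x)) has_derivative (\<lambda>v. k' * (v \<bullet> n))) (at x)"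
    using has_derivative_compose[OF dn k[unfolded has_field_derivative_def]] by simp
  show ?thesis
    by (rule has_derivative_eq_rhs[OF has_derivative_scaleR[OF has_derivative_mult[OF dk dn] dX]])
      (use pos in \<open>auto simp: n_def[symmetric] fun_eq_iff algebra_simps\<close>)
qed

text \<open>
  A smooth function of the radius that vanishes near zero and beyond \<open>1 + 1 / m\<close>, and equals one on
  \<open>[2 / m, 1]\<close>. The upper transition lies outside the unit ball, so that the limit for growing \<open>m\<close>
  is the indicator of the half-open interval \<open>(0, 1]\<close> occurring in the cone measure.
\<close>

definition annulus_cutoff :: "real \<Rightarrow> real \<Rightarrow> real" where
  "annulus_cutoff m t = step (m * t) * step (2 + m * (1 - t))"

definition annulus_cutoff' :: "real \<Rightarrow> real \<Rightarrow> real" where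
  "annulus_cutoff' m t =
     m * step' (m * t) * step (2 + m * (1 - t)) - step (m * t) * (m * step' (2 + m * (1 - t)))"

lemma annulus_cutoff_deriv: "(annulus_cutoff m has_real_derivative annulus_cutoff' m t) (at t)"
proof -
  have "((\<lambda>t. step (m * t)) has_real_derivative step' (m * t) * m) (at t)"
    by (rule DERIV_chain'[OF _ step_deriv]) (auto intro!: derivative_eq_intros)
  moreover have "((\<lambda>t. step (2 + m * (1 - t))) has_real_derivative step' (2 + m * (1 - t)) * (- m)) (at t)"
    by (rule DERIV_chain'[OF _ step_deriv]) (auto intro!: derivative_eq_intros)
  ultimately have "((\<lambda>t. step (m * t) * step (2 + m * (1 - t))) has_real_derivative
      (step' (m * t) * m) * step (2 + m * (1 - t)) + (step' (2 + m * (1 - t)) * (- m)) * step (m * t)) (at t)"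
    by (rule DERIV_mult)
  then show ?thesis
    unfolding annulus_cutoff_def[abs_def] annulus_cutoff'_def by (simp add: algebra_simps)
qed

lemma annulus_cutoff_bounds: "0 \<le> annulus_cutoff m t" "annulus_cutoff m t \<le> 1"
  unfolding annulus_cutoff_def using step_nonneg step_le_1 by (auto intro: mult_le_one)

lemma annulus_cutoff_inner:
  assumes "m > 0" "t < 1 / m" shows "annulus_cutoff m t = 0" "annulus_cutoff' m t = 0"
proof -
  have "m * t < 1" using assms by (simp add: field_simps)
  then show "annulus_cutoff m t = 0" "annulus_cutoff' m t = 0"
    by (simp_all add: annulus_cutoff_def annulus_cutoff'_def step_eq_0 step'_eq_0)
qed

lemma annulus_cutoff_outer:
  assumes "m \<ge> 1" "t > 2" shows "annulus_cutoff m t = 0" "annulus_cutoff' m t = 0"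
proof -
  have "1 * (t - 1) \<le> m * (t - 1)" using assms by (intro mult_right_mono) auto
  then have "2 + m * (1 - t) < 1" using assms by (simp add: algebra_simps)
  then show "annulus_cutoff m t = 0" "annulus_cutoff' m t = 0"
    by (simp_all add: annulus_cutoff_def annulus_cutoff'_def step_eq_0 step'_eq_0)
qed

lemma annulus_cutoff_tendsto:
  assumes "t > 0"
  shows "(\<lambda>j. annulus_cutoff (real (Suc j)) t) \<longlonglongrightarrow> (if t \<le> 1 then 1 else 0)"
proof (rule tendsto_eventually)
  show "\<forall>\<^sub>F j in sequentially. annulus_cutoff (real (Suc j)) t = (if t \<le> 1 then 1 else 0)"
  proof (cases "t \<le> 1")
    case True
    obtain J :: nat where J: "2 / t < real J" using reals_Archimedean2 by blast
    have "annulus_cutoff (real (Suc j)) t = 1" if "j \<ge> J" for j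
    proof -
      have "2 / t \<le> real (Suc j)" using J that by linarith
      then have "2 \<le> real (Suc j) * t" using assms by (simp add: field_simps)
      moreover have "0 \<le> real (Suc j) * (1 - t)" using True by (intro mult_nonneg_nonneg) auto
      ultimately show ?thesis by (simp add: annulus_cutoff_def step_eq_1)
    qed
    then show ?thesis using True by (auto simp: eventually_sequentially)
  next
    case False
    obtain J :: nat where J: "1 / (t - 1) < real J" using reals_Archimedean2 by blast
    have "annulus_cutoff (real (Suc j)) t = 0" if "j \<ge> J" for j
    proof -
      have "1 / (t - 1) \<le> real (Suc j)" using J that by linarith
      then have "1 \<le> real (Suc j) * (t - 1)" using False by (simp add: field_simps)
      then have "2 + real (Suc j) * (1 - t) \<le> 1" by (simp add: algebra_simps)
      then show ?thesis by (simp add: annulus_cutoff_def step_eq_0)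
    qed
    then show ?thesis using False by (auto simp: eventually_sequentially)
  qed
qed

text \<open>
  The degree one extension of a tangential field, cut off radially by a function \<open>\<kappa>\<close>, is a compactly
  supported field on \<open>\<real>\<^sup>N\<close> whose divergence is \<open>\<kappa>(|x|) div\<^sub>S X (x / |x|)\<close>: the radial derivative of
  \<open>\<kappa>\<close> is paired with the radial component of the field, which is zero. Its integral over \<open>\<real>\<^sup>N\<close>
  vanishes, and letting \<open>\<kappa>\<close> tend to the indicator of the punctured unit ball gives the claim, because
  the surface measure is the cone measure.
\<close>

theorem sphere_divergence_theorem:
  fixes X :: "real ^ 'n \<Rightarrow> real ^ 'n"
  assumes U: "sphere 0 1 \<subseteq> U" and X: "Ck_on (Suc 0) U X"
    and tang: "\<And>x. x \<in> sphere 0 1 \<Longrightarrow> X x \<bullet> x = 0"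
  shows "(LINT x|sphere_measure. sphere_div X x) = 0"
proof -
  define DX where "DX y = frechet_derivative X (at y)" for y
  define nm where "nm x = x /\<^sub>R norm x" for x :: "real ^ 'n"
  have nm_in: "nm x \<in> sphere 0 1" if "x \<noteq> 0" for x
    using that by (simp add: nm_def)
  have DX: "(X has_derivative DX (nm x)) (at (x /\<^sub>R norm x))" if "x \<noteq> 0" for x
    using Ck_on_SucD[OF X subsetD[OF U nm_in[OF that]]] by (simp add: DX_def nm_def)
  have lin: "linear (DX (nm x))" if "x \<noteq> 0" for x
    using has_derivative_linear[OF DX[OF that]] .
  have "\<exists>B. \<forall>y\<in>sphere 0 1. norm (F y) \<le> B" if "continuous_on U F" for F :: "real ^ 'n \<Rightarrow> real ^ 'n"
  proof -
    have "bounded (F ` sphere 0 1)"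
      by (intro compact_imp_bounded compact_continuous_image continuous_on_subset[OF that U]) auto
    then show ?thesis by (auto simp: bounded_iff)
  qed
  then obtain B1 where B1: "\<And>y. y \<in> sphere 0 1 \<Longrightarrow> norm (X y) \<le> B1"
    using Ck_on_imp_continuous_on[OF X] by blast
  have "\<exists>B. \<forall>y\<in>sphere 0 1. norm (DX y b) \<le> B" for b
    unfolding DX_def using Ck_on_imp_continuous_on[OF Ck_on_frechet_derivative[OF X, of b]]
    by (rule \<open>\<And>F. continuous_on U F \<Longrightarrow> \<exists>B. \<forall>y\<in>sphere 0 1. norm (F y) \<le> B\<close>)
  then obtain B2 where B2: "\<And>b y. y \<in> sphere 0 1 \<Longrightarrow> norm (DX y b) \<le> B2 b" by metis
  have e: "axis undefined 1 \<in> sphere (0 :: real ^ 'n) 1" by (simp add: norm_axis_1)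
  have B1_0: "0 \<le> B1" by (rule order_trans[OF norm_ge_zero B1[OF e]])
  have B2_0: "0 \<le> B2 b" for b by (rule order_trans[OF norm_ge_zero B2[OF e]])
  obtain C where C: "C > 0" "\<And>t. \<bar>step' t\<bar> \<le> C" using step'_bounded by blast

  define Z where "Z m x = (annulus_cutoff m (norm x) * norm x) *\<^sub>R X (nm x)" for m x
  define Z' where "Z' m x v = (annulus_cutoff' m (norm x) * norm x * (v \<bullet> nm x)) *\<^sub>R X (nm x) +
        annulus_cutoff m (norm x) *\<^sub>R ((v \<bullet> nm x) *\<^sub>R X (nm x) + DX (nm x) (v - (v \<bullet> nm x) *\<^sub>R nm x))" for m x v
  have dZ: "(Z m has_derivative Z' m x) (at x)" if m: "m \<ge> 1" for m x
  proof (cases "norm x < 1 / m")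
    case True
    then have Z'0: "Z' m x = (\<lambda>v. 0)" using annulus_cutoff_inner[of m "norm x"] m
      by (auto simp: Z'_def)
    have "((\<lambda>x. 0) has_derivative (\<lambda>v. 0)) (at x)" by simp
    then show ?thesis unfolding Z'0
      by (rule has_derivative_transform_within_open[where s="ball 0 (1/m)"])
        (use True m annulus_cutoff_inner[of m] in \<open>auto simp: Z_def\<close>)
  next
    case False
    then have x: "x \<noteq> 0" using m by auto
    show ?thesis
      using derivative_of_homogeneous_extension[OF x DX[OF x] annulus_cutoff_deriv[of m]]
      unfolding Z_def Z'_def nm_def .
  qed
  have Z'_trace: "(\<Sum>b\<in>Basis. Z' m x b \<bullet> b) = annulus_cutoff m (norm x) * sphere_div X (nm x)"
    if x: "x \<noteq> 0" for m x
  proof -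
    have t: "X (nm x) \<bullet> nm x = 0" using tang nm_in[OF x] by blast
    have s1: "(\<Sum>b\<in>Basis. (b \<bullet> nm x) * (w \<bullet> b)) = w \<bullet> nm x" for w
      using euclidean_inner[of w "nm x"] by (simp add: inner_commute mult.commute)
    have "(\<Sum>b\<in>Basis. Z' m x b \<bullet> b) =
      (annulus_cutoff' m (norm x) * norm x + annulus_cutoff m (norm x)) * (\<Sum>b\<in>Basis. (b \<bullet> nm x) * (X (nm x) \<bullet> b)) +
      annulus_cutoff m (norm x) * ((\<Sum>b\<in>Basis. DX (nm x) b \<bullet> b) - (\<Sum>b\<in>Basis. (b \<bullet> nm x) * (DX (nm x) (nm x) \<bullet> b)))"
      unfolding Z'_def linear_diff[OF lin[OF x]] linear_scale[OF lin[OF x]] sum_distrib_left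
        sum_subtractf[symmetric] sum.distrib[symmetric]
      by (intro sum.cong) (auto simp: inner_simps algebra_simps)
    then show ?thesis by (simp add: s1 t sphere_div_def DX_def)
  qed
  have bounds: "\<exists>B. \<forall>x. \<bar>Z' m x b \<bullet> b\<bar> \<le> B" if m: "m \<ge> 1" and b: "b \<in> Basis" for m b
  proof -
    define B3 where "B3 = (\<Sum>d\<in>Basis. 2 * B2 d)"
    have B3: "norm (DX (nm x) (b - (b \<bullet> nm x) *\<^sub>R nm x)) \<le> B3" if x: "x \<noteq> 0" for x
    proof -
      have n1: "norm (nm x) = 1" using nm_in[OF x] by simp
      have b1: "\<bar>b \<bullet> nm x\<bar> \<le> 1" using Cauchy_Schwarz_ineq2[of b "nm x"] b n1 by simp
      have "norm (b - (b \<bullet> nm x) *\<^sub>R nm x) \<le> norm b + norm ((b \<bullet> nm x) *\<^sub>R nm x)"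
        by (rule norm_triangle_ineq4)
      also have "\<dots> \<le> 2" using b1 n1 b by simp
      finally have n2: "norm (b - (b \<bullet> nm x) *\<^sub>R nm x) \<le> 2" .
      have n3: "\<bar>(b - (b \<bullet> nm x) *\<^sub>R nm x) \<bullet> d\<bar> \<le> 2" if "d \<in> Basis" for d
        using Basis_le_norm[OF that, of "b - (b \<bullet> nm x) *\<^sub>R nm x"] n2 by linarith
      have "norm (DX (nm x) (b - (b \<bullet> nm x) *\<^sub>R nm x)) \<le> (\<Sum>d\<in>Basis. norm (((b - (b \<bullet> nm x) *\<^sub>R nm x) \<bullet> d) *\<^sub>R DX (nm x) d))"
        unfolding linear_as_basis_sum[OF lin[OF x], of "b - (b \<bullet> nm x) *\<^sub>R nm x"] by (rule norm_sum)
      also have "\<dots> \<le> B3" unfolding B3_def norm_scaleR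
        by (intro sum_mono mult_mono n3 B2 nm_in x) auto
      finally show ?thesis .
    qed
    have B3_0: "0 \<le> B3" unfolding B3_def using B2_0 by (intro sum_nonneg) auto
    \<comment> \<open>the cutoff vanishes for \<open>t > 2\<close>\<close>
    have k': "\<bar>annulus_cutoff' m t * t\<bar> \<le> 2 * m * C * 2" if "t \<ge> 0" for t
    proof (cases "t \<le> 2")
      case True
      have s: "\<bar>step r\<bar> \<le> 1" for r using step_nonneg[of r] step_le_1[of r] by simp
      have "\<bar>annulus_cutoff' m t\<bar> \<le> \<bar>m * step' (m * t) * step (2 + m * (1 - t))\<bar> + \<bar>step (m * t) * (m * step' (2 + m * (1 - t)))\<bar>"
        unfolding annulus_cutoff'_def by (rule abs_triangle_ineq4)
      also have "\<dots> \<le> m * C * 1 + 1 * (m * C)"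
        unfolding abs_mult using m C s by (intro add_mono mult_mono) auto
      finally have "\<bar>annulus_cutoff' m t\<bar> * \<bar>t\<bar> \<le> (2 * m * C) * 2"
        using True that m C by (intro mult_mono) (auto simp: mult_ac)
      then show ?thesis by (simp add: abs_mult)
    next
      case False
      then show ?thesis using annulus_cutoff_outer[of m t] m C by simp
    qed
    have "\<bar>Z' m x b \<bullet> b\<bar> \<le> 2 * m * C * 2 * B1 + (B1 + B3)" for x
    proof (cases "x = 0")
      case True
      then show ?thesis using annulus_cutoff_inner[of m 0] m C B1_0 B3_0 by (simp add: Z'_def)
    next
      case False
      have n1: "norm (nm x) = 1" using nm_in[OF False] by simp
      have b1: "\<bar>b \<bullet> nm x\<bar> \<le> 1" using Cauchy_Schwarz_ineq2[of b "nm x"] b n1 by simp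
      have X1: "norm (X (nm x)) \<le> B1" using B1 nm_in[OF False] by blast
      have "\<bar>Z' m x b \<bullet> b\<bar> \<le> norm (Z' m x b)" using Cauchy_Schwarz_ineq2[of "Z' m x b" b] b by simp
      also have "\<dots> \<le> \<bar>annulus_cutoff' m (norm x) * norm x\<bar> * \<bar>b \<bullet> nm x\<bar> * norm (X (nm x)) +
          \<bar>annulus_cutoff m (norm x)\<bar> * (\<bar>b \<bullet> nm x\<bar> * norm (X (nm x)) + norm (DX (nm x) (b - (b \<bullet> nm x) *\<^sub>R nm x)))"
        unfolding Z'_def
        by (rule order_trans[OF norm_triangle_ineq])
          (auto intro!: add_mono mult_left_mono order_trans[OF norm_triangle_ineq] simp: abs_mult)
      also have "\<dots> \<le> 2 * m * C * 2 * 1 * B1 + 1 * (1 * B1 + B3)"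
        using m C B1_0 B3_0 annulus_cutoff_bounds[of m "norm x"] k'[of "norm x"]
        by (intro add_mono mult_mono b1 X1 B3 False) auto
      finally show ?thesis by simp
    qed
    then show ?thesis by blast
  qed
  have hb: "has_bochner_integral lborel (\<lambda>x. Z' m x b \<bullet> b) 0" if m: "m \<ge> 1" and b: "b \<in> Basis" for m b
  proof -
    obtain B where B: "\<And>x. \<bar>Z' m x b \<bullet> b\<bar> \<le> B" using bounds[OF m b] by blast
    show ?thesis
    proof (rule directional_derivative_integral_zero[where R=2 and f="\<lambda>x. Z m x \<bullet> b" and f'="\<lambda>x v. Z' m x v \<bullet> b", OF _ B])
      show "((\<lambda>x. Z m x \<bullet> b) has_derivative (\<lambda>v. Z' m x v \<bullet> b)) (at x)" for x
        by (rule has_derivative_inner_left[OF dZ[OF m]])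
      show "Z m x \<bullet> b = 0" if "norm x > 2" for x
      proof -
        show ?thesis using annulus_cutoff_outer[of m "norm x"] m that by (simp add: Z_def)
      qed
    qed
  qed
  define g where "g m x = (\<Sum>b\<in>Basis. Z' m x b \<bullet> b)" for m x
  have gint: "has_bochner_integral lborel (g m) 0" if m: "m \<ge> 1" for m
    using has_bochner_integral_sum[of Basis lborel "\<lambda>b x. Z' m x b \<bullet> b" "\<lambda>_. 0"] hb[OF m]
    by (simp add: g_def[abs_def])
  define f where "f x = indicator (cball 0 1 - {0}) x *\<^sub>R sphere_div X (nm x)" for x
  have g_eq: "g m x = (if x = 0 then 0 else annulus_cutoff m (norm x) * sphere_div X (nm x))" if "m \<ge> 1" for m x
    using Z'_trace[of x m] annulus_cutoff_inner[of m 0] that by (simp add: g_def Z'_def)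
  have lim: "(\<lambda>j. g (real (Suc j)) x) \<longlonglongrightarrow> f x" for x
  proof (cases "x = 0")
    case False
    have "(\<lambda>j. annulus_cutoff (real (Suc j)) (norm x) * sphere_div X (nm x)) \<longlonglongrightarrow> (if norm x \<le> 1 then 1 else 0) * sphere_div X (nm x)"
      using False by (intro tendsto_mult annulus_cutoff_tendsto tendsto_const) auto
    moreover have "f x = (if norm x \<le> 1 then 1 else 0) * sphere_div X (nm x)"
      using False by (simp add: f_def)
    ultimately show ?thesis using False by (simp add: g_eq)
  qed (simp add: g_eq f_def)
  have "bounded (sphere_div X ` sphere 0 1)"
    by (intro compact_imp_bounded compact_continuous_image continuous_on_subset[OF continuous_on_sphere_div[OF X] U]) auto
  then obtain B where B: "\<And>y. y \<in> sphere 0 1 \<Longrightarrow> \<bar>sphere_div X y\<bar> \<le> B"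
    unfolding bounded_iff by (metis imageI real_norm_def)
  have bd: "norm (g (real (Suc j)) x) \<le> B * indicator (cball 0 2) x" for j x
  proof (cases "x = 0 \<or> norm x > 2")
    case True
    have "0 \<le> B" using B[OF e] by simp
    then show ?thesis using True annulus_cutoff_outer[of "real (Suc j)" "norm x"] by (auto simp: g_eq)
  next
    case False
    then have "\<bar>annulus_cutoff (real (Suc j)) (norm x)\<bar> * \<bar>sphere_div X (nm x)\<bar> \<le> 1 * B"
      using annulus_cutoff_bounds[of "real (Suc j)" "norm x"] B nm_in[of x] by (intro mult_mono) auto
    then show ?thesis using False by (simp add: g_eq abs_mult)
  qed
  have w: "integrable lborel (\<lambda>x::real ^ 'n. B * indicator (cball 0 2) x :: real)"
    using emeasure_lborel_cball_finite[of "0::real ^ 'n" 2]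
    by (intro integrable_mult_right integrable_real_indicator) (auto simp: less_top)
  have gm: "g (real (Suc j)) \<in> borel_measurable lborel" for j
    using gint[of "real (Suc j)"] by (auto simp: has_bochner_integral_iff)
  have fm: "f \<in> borel_measurable lborel"
    by (rule borel_measurable_LIMSEQ_real[OF lim gm])
  have "(\<lambda>j. LINT x|lborel. g (real (Suc j)) x) \<longlonglongrightarrow> (LINT x|lborel. f x)"
    by (rule integral_dominated_convergence[OF fm gm w]) (use lim bd in auto)
  moreover have "(LINT x|lborel. g (real (Suc j)) x) = 0" for j
    using gint[of "real (Suc j)"] by (auto simp: has_bochner_integral_iff)
  ultimately have "(LINT x|lborel. f x) = 0" by (simp add: LIMSEQ_const_iff)
  moreover have "sphere_div X \<in> borel_measurable sphere_measure"
    by (intro borel_measurable_sphere_continuous continuous_on_subset[OF continuous_on_sphere_div[OF X] U])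
  ultimately show ?thesis
    by (subst integral_sphere) (auto simp: set_lebesgue_integral_def f_def[abs_def] nm_def)
qed

section \<open>Approximation in the mean square\<close>

lemma L2_I: "f \<in> borel_measurable M \<Longrightarrow> integrable M (\<lambda>x. (f x)\<^sup>2) \<Longrightarrow> f \<in> L2 M" for f :: "'a \<Rightarrow> real"
  by (simp add: L2_def)

lemma L2_measurable: "f \<in> L2 M \<Longrightarrow> f \<in> borel_measurable M"
  by (simp add: L2_def)

lemma L2_square_integrable: "f \<in> L2 M \<Longrightarrow> integrable M (\<lambda>x. (f x)\<^sup>2)" for f :: "'a \<Rightarrow> real"
  by (simp add: L2_def)

lemma L2_mult_integrable:
  fixes f g :: "'a \<Rightarrow> real"
  assumes "f \<in> L2 M" "g \<in> L2 M"
  shows "integrable M (\<lambda>x. f x * g x)"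
proof (rule Bochner_Integration.integrable_bound)
  show "integrable M (\<lambda>x. (f x)\<^sup>2 + (g x)\<^sup>2)"
    using assms by (auto intro: L2_square_integrable)
  show "(\<lambda>x. f x * g x) \<in> borel_measurable M"
    using assms by (auto intro: L2_measurable borel_measurable_times)
  have "\<bar>a * b\<bar> \<le> a\<^sup>2 + b\<^sup>2" for a b :: real
  proof -
    have "0 \<le> \<bar>a\<bar> * \<bar>b\<bar>" by simp
    with sum_squares_bound[of "\<bar>a\<bar>" "\<bar>b\<bar>"] show ?thesis
      unfolding abs_mult power2_abs by linarith
  qed
  then show "AE x in M. norm (f x * g x) \<le> norm ((f x)\<^sup>2 + (g x)\<^sup>2)" by simp
qed

lemma L2_add: "f \<in> L2 M \<Longrightarrow> g \<in> L2 M \<Longrightarrow> (\<lambda>x. f x + g x) \<in> L2 M" for f g :: "'a \<Rightarrow> real"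
proof (rule L2_I)
  assume fg: "f \<in> L2 M" "g \<in> L2 M"
  then show "(\<lambda>x. f x + g x) \<in> borel_measurable M" by (auto intro: L2_measurable borel_measurable_add)
  have "integrable M (\<lambda>x. (f x)\<^sup>2 + (g x)\<^sup>2 + 2 * (f x * g x))"
    using fg by (intro Bochner_Integration.integrable_add integrable_mult_right L2_mult_integrable L2_square_integrable)
  then show "integrable M (\<lambda>x. (f x + g x)\<^sup>2)" by (simp add: power2_sum mult.assoc)
qed

lemma L2_scale: "f \<in> L2 M \<Longrightarrow> (\<lambda>x. c * f x) \<in> L2 M" for f :: "'a \<Rightarrow> real"
  by (rule L2_I)
    (simp_all add: power_mult_distrib borel_measurable_times L2_measurable L2_square_integrable)

lemma L2_diff: "f \<in> L2 M \<Longrightarrow> g \<in> L2 M \<Longrightarrow> (\<lambda>x. f x - g x) \<in> L2 M" for f g :: "'a \<Rightarrow> real"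
  using L2_add[of f M "\<lambda>x. -1 * g x"] L2_scale[of g M "-1"] by simp

lemma L2_zero: "(\<lambda>x. 0) \<in> L2 M" for M :: "'a measure"
  by (simp add: L2_def)

lemma L2_sum:
  fixes f :: "'i \<Rightarrow> 'a \<Rightarrow> real"
  shows "(\<And>i. i \<in> I \<Longrightarrow> f i \<in> L2 M) \<Longrightarrow> (\<lambda>x. \<Sum>i\<in>I. f i x) \<in> L2 M"
  by (induction I rule: infinite_finite_induct) (auto intro: L2_zero L2_add)

lemma L2_cong: "f \<in> L2 M \<Longrightarrow> (\<And>x. x \<in> space M \<Longrightarrow> f x = g x) \<Longrightarrow> g \<in> L2 M" for f g :: "'a \<Rightarrow> real"
  unfolding L2_def by (auto cong: measurable_cong Bochner_Integration.integrable_cong)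

lemma (in finite_measure) L2_bounded:
  fixes f :: "'a \<Rightarrow> real"
  assumes "f \<in> borel_measurable M" "\<And>x. x \<in> space M \<Longrightarrow> \<bar>f x\<bar> \<le> B"
  shows "f \<in> L2 M"
proof (rule L2_I[OF assms(1)])
  show "integrable M (\<lambda>x. (f x)\<^sup>2)"
  proof (rule integrable_const_bound[where B="B\<^sup>2"])
    show "AE x in M. norm ((f x)\<^sup>2) \<le> B\<^sup>2"
    proof (rule AE_I2)
      fix x assume "x \<in> space M"
      then have "\<bar>f x\<bar>\<^sup>2 \<le> B\<^sup>2" using assms(2) by (intro power_mono) auto
      then show "norm ((f x)\<^sup>2) \<le> B\<^sup>2" by simp
    qed
  qed (use assms in auto)
qed

inductive_set lin_span :: "('a \<Rightarrow> real) set \<Rightarrow> ('a \<Rightarrow> real) set" for B where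
  zero: "(\<lambda>_. 0) \<in> lin_span B"
| step: "b \<in> B \<Longrightarrow> f \<in> lin_span B \<Longrightarrow> (\<lambda>x. c * b x + f x) \<in> lin_span B"

lemma lin_span_base: "b \<in> B \<Longrightarrow> b \<in> lin_span B"
  using lin_span.step[OF _ lin_span.zero, of b B 1] by simp

lemma lin_span_add: "f \<in> lin_span B \<Longrightarrow> g \<in> lin_span B \<Longrightarrow> (\<lambda>x. f x + g x) \<in> lin_span B"
  by (induction rule: lin_span.induct) (auto simp: add.assoc intro: lin_span.step)

lemma lin_span_scale: "f \<in> lin_span B \<Longrightarrow> (\<lambda>x. a * f x) \<in> lin_span B"
proof (induction rule: lin_span.induct)
  case (step b f c)
  from lin_span.step[OF step(1) step(3), of "a * c"] show ?case by (simp add: algebra_simps)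
qed (simp add: lin_span.zero)

lemma lin_span_sum: "(\<And>i. i \<in> I \<Longrightarrow> f i \<in> lin_span B) \<Longrightarrow> (\<lambda>x. \<Sum>i\<in>I. f i x) \<in> lin_span B"
  by (induction I rule: infinite_finite_induct) (auto intro: lin_span.zero lin_span_add)

lemma lin_span_in:
  assumes "f \<in> lin_span B" "\<And>b. b \<in> B \<Longrightarrow> b \<in> V" "(\<lambda>_. 0) \<in> V"
    "\<And>f g. f \<in> V \<Longrightarrow> g \<in> V \<Longrightarrow> (\<lambda>x. f x + g x) \<in> V"
    "\<And>c f. f \<in> V \<Longrightarrow> (\<lambda>x. c * f x) \<in> V"
  shows "f \<in> V"
  using assms(1)
proof (induction rule: lin_span.induct)
  case zero
  show ?case by (rule assms(3))
next
  case (step b f c)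
  show ?case by (rule assms(4)[OF assms(5)[OF assms(2)[OF step(1)]] step(3)])
qed

lemma lin_span_subset:
  assumes "B \<subseteq> lin_span B'" shows "lin_span B \<subseteq> lin_span B'"
proof
  fix f assume "f \<in> lin_span B"
  then show "f \<in> lin_span B'"
    by (rule lin_span_in) (use assms in \<open>auto intro: lin_span.zero lin_span_add lin_span_scale\<close>)
qed

lemma lin_span_mono: "B \<subseteq> B' \<Longrightarrow> lin_span B \<subseteq> lin_span B'"
  by (rule lin_span_subset) (auto intro: lin_span_base)

lemma lin_span_image_finite_sum:
  assumes "f \<in> lin_span (e ` I)"
  shows "\<exists>A c. finite A \<and> A \<subseteq> I \<and> (\<forall>x. f x = (\<Sum>i\<in>A. c i * e i x))"
  using assms
proof (induction rule: lin_span.induct)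
  case zero
  show ?case by (intro exI[of _ "{}"]) auto
next
  case (step b f d)
  then obtain A c where A: "finite A" "A \<subseteq> I" "\<And>x. f x = (\<Sum>i\<in>A. c i * e i x)" by blast
  obtain i where i: "i \<in> I" "b = e i" using step(1) by blast
  define c' where "c' k = (if k \<in> A then c k else 0) + (if k = i then d else 0)" for k
  have "d * b x + f x = (\<Sum>k\<in>insert i A. c' k * e k x)" for x
  proof -
    have fin: "finite (insert i A)" using A by simp
    have "(\<Sum>k\<in>insert i A. c' k * e k x) =
        (\<Sum>k\<in>insert i A. (if k \<in> A then c k else 0) * e k x) + (\<Sum>k\<in>insert i A. (if k = i then d else 0) * e k x)"
      by (simp add: c'_def distrib_right sum.distrib)
    also have "(\<Sum>k\<in>insert i A. (if k \<in> A then c k else 0) * e k x) = (\<Sum>k\<in>A. c k * e k x)"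
      by (rule sum.mono_neutral_cong_right[OF fin]) auto
    also have "(\<Sum>k\<in>insert i A. (if k = i then d else 0) * e k x) = (\<Sum>k\<in>insert i A. if k = i then d * e k x else 0)"
      by (intro sum.cong) auto
    also have "\<dots> = d * e i x" using fin by simp
    finally show ?thesis using A(3) i by simp
  qed
  then show ?case using A i by (intro exI[of _ "insert i A"] exI[of _ c']) auto
qed

lemma lin_span_L2: "B \<subseteq> L2 M \<Longrightarrow> lin_span B \<subseteq> L2 M"
  by (auto elim!: lin_span_in intro: L2_zero L2_add L2_scale)

lemma L2_orthogonal_lin_span:
  assumes h: "h \<in> L2 M" and B: "B \<subseteq> L2 M" and o: "\<And>b. b \<in> B \<Longrightarrow> (LINT x|M. h x * b x) = 0"
    and f: "f \<in> lin_span B"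
  shows "(LINT x|M. h x * f x) = 0"
proof -
  let ?V = "{f \<in> L2 M. (LINT x|M. h x * f x) = 0}"
  have "f \<in> ?V" using f
  proof (rule lin_span_in)
    show "(\<lambda>x. f x + g x) \<in> ?V" if "f \<in> ?V" "g \<in> ?V" for f g
      using that L2_mult_integrable[OF h, of f] L2_mult_integrable[OF h, of g]
      by (auto simp: distrib_left intro: L2_add)
    show "(\<lambda>x. d * f x) \<in> ?V" if "f \<in> ?V" for d f
      using that by (auto simp: mult.left_commute[of _ d] intro: L2_scale)
  qed (use B o in \<open>auto simp: L2_zero\<close>)
  then show ?thesis by simp
qed

text \<open>
  Convergence in \<open>L\<^sup>2\<close> is expressed by integrals of squares of functions, without passing to
  equivalence classes.
\<close>

definition L2_closure :: "'a measure \<Rightarrow> ('a \<Rightarrow> real) set \<Rightarrow> ('a \<Rightarrow> real) set" where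
  "L2_closure M A = {f \<in> L2 M. \<forall>e>0. \<exists>g\<in>A. (LINT x|M. (f x - g x)\<^sup>2) < e}"

lemma L2_closure_trans:
  fixes f :: "'a \<Rightarrow> real"
  assumes A: "A \<subseteq> L2 M" and f: "f \<in> L2 M"
    and "\<And>e. e > 0 \<Longrightarrow> \<exists>h\<in>L2_closure M A. (LINT x|M. (f x - h x)\<^sup>2) < e"
  shows "f \<in> L2_closure M A"
proof -
  have "\<exists>g\<in>A. (LINT x|M. (f x - g x)\<^sup>2) < e" if e: "e > 0" for e
  proof -
    obtain h where h: "h \<in> L2_closure M A" "(LINT x|M. (f x - h x)\<^sup>2) < e / 4"
      using assms(3)[of "e/4"] e by auto
    obtain g where g: "g \<in> A" "(LINT x|M. (h x - g x)\<^sup>2) < e / 4"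
      using h(1) e unfolding L2_closure_def by (auto dest!: spec[of _ "e/4"])
    have L: "f \<in> L2 M" "h \<in> L2 M" "g \<in> L2 M" using f h g A by (auto simp: L2_closure_def)
    have "(LINT x|M. (f x - g x)\<^sup>2) \<le> (LINT x|M. 2 * (f x - h x)\<^sup>2 + 2 * (h x - g x)\<^sup>2)"
    proof (rule integral_mono)
      show "(f x - g x)\<^sup>2 \<le> 2 * (f x - h x)\<^sup>2 + 2 * (h x - g x)\<^sup>2" for x
        using sum_squares_bound[of "f x - h x" "h x - g x"] by (simp add: power2_eq_square algebra_simps)
    qed (intro Bochner_Integration.integrable_add integrable_mult_right L2_square_integrable L2_diff L)+
    also have "\<dots> = 2 * (LINT x|M. (f x - h x)\<^sup>2) + 2 * (LINT x|M. (h x - g x)\<^sup>2)"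
      by (subst Bochner_Integration.integral_add)
        (intro integrable_mult_right L2_square_integrable L2_diff L | simp)+
    also have "\<dots> < e" using h(2) g(2) e by simp
    finally show ?thesis using g(1) by blast
  qed
  then show ?thesis using f by (auto simp: L2_closure_def)
qed

lemma L2_closure_L2: "f \<in> L2_closure M A \<Longrightarrow> f \<in> L2 M"
  by (simp add: L2_closure_def)

lemma L2_closure_cong:
  assumes "f \<in> L2_closure M A" "\<And>x. x \<in> space M \<Longrightarrow> f x = g x"
  shows "g \<in> L2_closure M A"
proof -
  have "(LINT x|M. (g x - h x)\<^sup>2) = (LINT x|M. (f x - h x)\<^sup>2)" for h
    by (rule Bochner_Integration.integral_cong) (use assms(2) in auto)
  then show ?thesis using assms L2_cong[of f M g] by (auto simp: L2_closure_def)
qed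

lemma L2_closure_add:
  fixes f g :: "'a \<Rightarrow> real"
  assumes A: "A \<subseteq> L2 M" and add: "\<And>f g. f \<in> A \<Longrightarrow> g \<in> A \<Longrightarrow> (\<lambda>x. f x + g x) \<in> A"
    and f: "f \<in> L2_closure M A" and g: "g \<in> L2_closure M A"
  shows "(\<lambda>x. f x + g x) \<in> L2_closure M A"
proof -
  have "\<exists>h\<in>A. (LINT x|M. (f x + g x - h x)\<^sup>2) < e" if e: "e > 0" for e
  proof -
    obtain a where a: "a \<in> A" "(LINT x|M. (f x - a x)\<^sup>2) < e / 4"
      using f e unfolding L2_closure_def by (auto dest!: spec[of _ "e/4"])
    obtain b where b: "b \<in> A" "(LINT x|M. (g x - b x)\<^sup>2) < e / 4"
      using g e unfolding L2_closure_def by (auto dest!: spec[of _ "e/4"])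
    have L: "f \<in> L2 M" "g \<in> L2 M" "a \<in> L2 M" "b \<in> L2 M" using f g a b A by (auto simp: L2_closure_def)
    have "(LINT x|M. (f x + g x - (a x + b x))\<^sup>2) \<le> (LINT x|M. 2 * (f x - a x)\<^sup>2 + 2 * (g x - b x)\<^sup>2)"
    proof (rule integral_mono)
      show "(f x + g x - (a x + b x))\<^sup>2 \<le> 2 * (f x - a x)\<^sup>2 + 2 * (g x - b x)\<^sup>2" for x
        using sum_squares_bound[of "f x - a x" "g x - b x"] by (simp add: power2_eq_square algebra_simps)
    qed (intro Bochner_Integration.integrable_add integrable_mult_right L2_square_integrable L2_diff L2_add L)+
    also have "\<dots> = 2 * (LINT x|M. (f x - a x)\<^sup>2) + 2 * (LINT x|M. (g x - b x)\<^sup>2)"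
      by (subst Bochner_Integration.integral_add)
        (intro integrable_mult_right L2_square_integrable L2_diff L | simp)+
    also have "\<dots> < e" using a(2) b(2) e by simp
    finally show ?thesis using add[OF a(1) b(1)] by (intro bexI)
  qed
  then show ?thesis using f g by (auto simp: L2_closure_def intro: L2_add)
qed

lemma L2_closure_scale:
  fixes f :: "'a \<Rightarrow> real"
  assumes scale: "\<And>c f. f \<in> A \<Longrightarrow> (\<lambda>x. c * f x) \<in> A"
    and f: "f \<in> L2_closure M A"
  shows "(\<lambda>x. c * f x) \<in> L2_closure M A"
proof -
  have "\<exists>h\<in>A. (LINT x|M. (c * f x - h x)\<^sup>2) < e" if e: "e > 0" for e
  proof -
    have "e / (c\<^sup>2 + 1) > 0" using e by (simp add: add_nonneg_pos)
    then obtain a where a: "a \<in> A" "(LINT x|M. (f x - a x)\<^sup>2) < e / (c\<^sup>2 + 1)"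
      using f unfolding L2_closure_def by blast
    have "(LINT x|M. (c * f x - c * a x)\<^sup>2) = c\<^sup>2 * (LINT x|M. (f x - a x)\<^sup>2)"
      by (simp add: right_diff_distrib[symmetric] power_mult_distrib)
    also have "\<dots> \<le> (c\<^sup>2 + 1) * (LINT x|M. (f x - a x)\<^sup>2)"
      by (intro mult_right_mono) auto
    also have "\<dots> < e" using a(2) by (simp add: pos_less_divide_eq add_nonneg_pos mult.commute)
    finally show ?thesis using scale[OF a(1), of c] by (intro bexI)
  qed
  then show ?thesis using f by (auto simp: L2_closure_def intro: L2_scale)
qed

lemma L2_closure_dominated:
  fixes f :: "'a \<Rightarrow> real"
  assumes A: "A \<subseteq> L2 M" and s: "\<And>n. s n \<in> L2_closure M A"
    and lim: "\<And>x. x \<in> space M \<Longrightarrow> (\<lambda>n. s n x) \<longlonglongrightarrow> f x"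
    and w: "w \<in> L2 M" "\<And>n x. x \<in> space M \<Longrightarrow> \<bar>s n x\<bar> \<le> w x"
  shows "f \<in> L2_closure M A"
proof -
  have sm: "s n \<in> borel_measurable M" for n using s by (auto simp: L2_closure_def intro: L2_measurable)
  have fm: "f \<in> borel_measurable M" by (rule borel_measurable_LIMSEQ_real[OF lim sm])
  have fw: "\<bar>f x\<bar> \<le> w x" if "x \<in> space M" for x
    by (rule LIMSEQ_le_const2[OF tendsto_rabs[OF lim[OF that]]]) (use w(2)[OF that] in blast)
  have w2: "integrable M (\<lambda>x. 4 * (w x)\<^sup>2)" using L2_square_integrable[OF w(1)] by simp
  have dom: "(f x - s n x)\<^sup>2 \<le> 4 * (w x)\<^sup>2" if "x \<in> space M" for n x
  proof -
    have "\<bar>f x - s n x\<bar> \<le> 2 * w x" using fw[OF that] w(2)[OF that, of n] by linarith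
    then have "\<bar>f x - s n x\<bar>\<^sup>2 \<le> (2 * w x)\<^sup>2" by (intro power_mono) auto
    then show ?thesis by (simp add: power_mult_distrib)
  qed
  have "(\<lambda>n. LINT x|M. (f x - s n x)\<^sup>2) \<longlonglongrightarrow> (LINT x|M. 0)"
  proof (rule integral_dominated_convergence[OF _ _ w2])
    show "AE x in M. (\<lambda>n. (f x - s n x)\<^sup>2) \<longlonglongrightarrow> 0"
    proof (rule AE_I2)
      fix x assume "x \<in> space M"
      from tendsto_power[OF tendsto_diff[OF tendsto_const[of "f x"] lim[OF this]], of 2]
      show "(\<lambda>n. (f x - s n x)\<^sup>2) \<longlonglongrightarrow> 0" by simp
    qed
  qed (use fm sm dom in auto)
  then have t: "(\<lambda>n. LINT x|M. (f x - s n x)\<^sup>2) \<longlonglongrightarrow> 0" by simp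
  have "integrable M (\<lambda>x. (f x)\<^sup>2)"
  proof (rule Bochner_Integration.integrable_bound[OF L2_square_integrable[OF w(1)]])
    show "AE x in M. norm ((f x)\<^sup>2) \<le> norm ((w x)\<^sup>2)"
      by (rule AE_I2) (use fw abs_le_square_iff in fastforce)
  qed (use fm in auto)
  then have "f \<in> L2 M" using fm by (rule L2_I[rotated])
  then show ?thesis
  proof (rule L2_closure_trans[OF A])
    show "\<exists>h\<in>L2_closure M A. (LINT x|M. (f x - h x)\<^sup>2) < e" if "e > 0" for e
      using order_tendstoD(2)[OF t that] s by (auto simp: eventually_sequentially)
  qed
qed

text \<open>
  Indicators of closed sets are bounded limits of continuous functions of the distance; Dynkin's
  lemma extends the claim to Borel sets, and simple functions then exhaust \<open>L\<^sup>2\<close> by dominated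
  convergence.
\<close>

lemma L2_dense_if_continuous_approximable:
  fixes S :: "'a::euclidean_space set"
  assumes fin: "finite_measure M" and M: "space M = S" "sets M = sets (restrict_space borel S)"
    and A: "A \<subseteq> L2 M" and add: "\<And>f g. f \<in> A \<Longrightarrow> g \<in> A \<Longrightarrow> (\<lambda>x. f x + g x) \<in> A"
    and scale: "\<And>c f. f \<in> A \<Longrightarrow> (\<lambda>x. c * f x) \<in> A"
    and unif: "\<And>f e. continuous_on S f \<Longrightarrow> e > 0 \<Longrightarrow> \<exists>g\<in>A. \<forall>x\<in>S. \<bar>f x - g x\<bar> < e"
  shows "L2 M \<subseteq> L2_closure M A"
proof
  interpret finite_measure M by fact
  fix f :: "'a \<Rightarrow> real" assume f: "f \<in> L2 M"
  have cl_add: "(\<lambda>x. f x + g x) \<in> L2_closure M A" if "f \<in> L2_closure M A" "g \<in> L2_closure M A" for f g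
    using L2_closure_add[OF A add that] .
  have cl_scale: "(\<lambda>x. c * f x) \<in> L2_closure M A" if "f \<in> L2_closure M A" for f c
    using L2_closure_scale[OF scale that] .
  have cont: "f \<in> L2_closure M A" if c: "continuous_on S f" and b: "\<And>x. x \<in> S \<Longrightarrow> \<bar>f x\<bar> \<le> B" for f B
  proof -
    have "f \<in> borel_measurable (restrict_space borel S)" by (rule borel_measurable_continuous_on_restrict[OF c])
    then have m: "f \<in> borel_measurable M" by (simp cong: measurable_cong_sets add: M)
    have fL: "f \<in> L2 M" by (rule L2_bounded[OF m]) (use b M in auto)
    have "\<exists>g\<in>A. (LINT x|M. (f x - g x)\<^sup>2) < e" if e: "e > 0" for e
    proof -
      define d where "d = sqrt (e / (measure M S + 1))"
      have mS: "measure M S + 1 > 0" by (simp add: add_nonneg_pos)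
      have d: "d > 0" "d\<^sup>2 = e / (measure M S + 1)" using e mS by (auto simp: d_def)
      obtain g where g: "g \<in> A" "\<And>x. x \<in> S \<Longrightarrow> \<bar>f x - g x\<bar> < d" using unif[OF c d(1)] by blast
      have "(LINT x|M. (f x - g x)\<^sup>2) \<le> (LINT x|M. d\<^sup>2)"
      proof (rule integral_mono)
        show "integrable M (\<lambda>x. (f x - g x)\<^sup>2)" using fL g A by (intro L2_square_integrable L2_diff) auto
        show "(f x - g x)\<^sup>2 \<le> d\<^sup>2" if "x \<in> space M" for x
          using power_mono[of "\<bar>f x - g x\<bar>" d 2] g(2)[of x] that M by simp
      qed auto
      also have "\<dots> = measure M S * e / (measure M S + 1)" using M d by simp
      also have "\<dots> < e" using e mS by (simp add: field_simps)
      finally show ?thesis using g(1) by blast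
    qed
    then show ?thesis using fL by (auto simp: L2_closure_def)
  qed
  have one: "(\<lambda>_. 1 :: real) \<in> L2 M" by (rule L2_bounded[where B=1]) auto
  have ind: "indicator B \<in> L2_closure M A" if "B \<in> sets borel" for B
  proof -
    have B: "B \<in> sigma_sets UNIV (Collect closed)"
      using that by (simp add: borel_eq_closed)
    show ?thesis
    proof (rule sigma_sets_induct_disjoint[OF _ _ B, where P="\<lambda>B. indicator B \<in> L2_closure M A"])
      show "Int_stable (Collect closed :: 'a set set)" by (auto simp: Int_stable_def)
      show "(indicator {} :: 'a \<Rightarrow> real) \<in> L2_closure M A" by (rule cont[where B=0]) auto
      fix K :: "'a set" assume "K \<in> Collect closed"
      then have K: "closed K" by simp
      show "(indicator K :: 'a \<Rightarrow> real) \<in> L2_closure M A"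
      proof (cases "K = {}")
        case True
        then show ?thesis by (intro cont[where B=0]) auto
      next
        case False
        show ?thesis
        proof (rule L2_closure_dominated[OF A _ _ one])
          show "(\<lambda>x. max 0 (1 - real n * infdist x K)) \<in> L2_closure M A" for n
            by (rule cont[where B=1]) (auto intro!: continuous_intros simp: infdist_nonneg)
          show "(\<lambda>n. max 0 (1 - real n * infdist x K)) \<longlonglongrightarrow> indicator K x" for x
          proof (cases "x \<in> K")
            case True
            then show ?thesis by simp
          next
            case nK: False
            then have pos: "infdist x K > 0" using in_closed_iff_infdist_zero[OF K False] infdist_nonneg[of x K] by force
            obtain J :: nat where J: "1 / infdist x K < real J" using reals_Archimedean2 by blast
            have "max 0 (1 - real n * infdist x K) = 0" if "n \<ge> J" for n
            proof -
              have "1 / infdist x K \<le> real n" using J that by linarith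
              then show ?thesis using pos by (simp add: field_simps)
            qed
            then show ?thesis using nK by (intro tendsto_eventually) (auto simp: eventually_sequentially)
          qed
          show "\<bar>max 0 (1 - real n * infdist x K)\<bar> \<le> 1" for n x by (auto simp: infdist_nonneg)
        qed
      qed
    next
      fix B :: "'a set" assume "indicator B \<in> L2_closure M A"
      from cl_add[OF cont[of "\<lambda>_. 1" 1] cl_scale[OF this, of "-1"]]
      have "(\<lambda>x. 1 + - 1 * indicator B x) \<in> L2_closure M A" by simp
      also have "(\<lambda>x. 1 + - 1 * indicator B x) = (indicator (UNIV - B) :: 'a \<Rightarrow> real)"
        by (auto simp: indicator_def)
      finally show "(indicator (UNIV - B) :: 'a \<Rightarrow> real) \<in> L2_closure M A" .
    next
      fix F :: "nat \<Rightarrow> 'a set"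
      assume F: "disjoint_family F" "\<And>i. indicator (F i) \<in> L2_closure M A"
      have p: "(indicator (\<Union>i<n. F i) :: 'a \<Rightarrow> real) \<in> L2_closure M A" for n
      proof (induction n)
        case 0
        show ?case by (rule cont[where B=0]) auto
      next
        case (Suc n)
        have "(\<lambda>x. indicator (\<Union>i<n. F i) x + indicator (F n) x) = (indicator (\<Union>i<Suc n. F i) :: 'a \<Rightarrow> real)"
        proof
          fix x
          have "x \<in> F n \<Longrightarrow> i < n \<Longrightarrow> x \<notin> F i" for i
            using disjoint_family_onD[OF F(1), of i n] by auto
          then show "indicator (\<Union>i<n. F i) x + indicator (F n) x = (indicator (\<Union>i<Suc n. F i) x :: real)"
            by (auto simp: indicator_def less_Suc_eq)
        qed
        with cl_add[OF Suc F(2)[of n]] show ?case by simp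
      qed
      show "(indicator (\<Union>i. F i) :: 'a \<Rightarrow> real) \<in> L2_closure M A"
      proof (rule L2_closure_dominated[OF A p _ one])
        show "(\<lambda>n. indicator (\<Union>i<n. F i) x) \<longlonglongrightarrow> (indicator (\<Union>i. F i) x :: real)" for x
          by (rule LIMSEQ_indicator_UN)
      qed (auto simp: indicator_def)
    qed auto
  qed
  have ind': "indicator B \<in> L2_closure M A" if "B \<in> sets M" for B
  proof -
    have "B \<in> (\<inter>) S ` sets borel" using that unfolding M(2) sets_restrict_space .
    then obtain B' where B': "B' \<in> sets borel" "B = S \<inter> B'" by (rule imageE)
    show ?thesis
    proof (rule L2_closure_cong[OF ind[OF B'(1)]])
      show "indicator B' x = (indicator B x :: real)" if "x \<in> space M" for x
        using that unfolding B'(2) M(1) by (simp add: indicator_def)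
    qed
  qed
  have simp_fun: "h \<in> L2_closure M A" if h: "simple_function M h" for h
  proof -
    have fin: "finite (h ` space M)" using h by (simp add: simple_function_def)
    have "(\<lambda>x. \<Sum>y\<in>T. y * indicator (h -` {y} \<inter> space M) x) \<in> L2_closure M A" if "finite T" "T \<subseteq> h ` space M" for T
      using that
    proof (induction T rule: finite_induct)
      case empty
      then show ?case using cont[of "\<lambda>_. 0" 0] by simp
    next
      case (insert y T)
      have "h -` {y} \<inter> space M \<in> sets M" using h insert by (auto simp: simple_function_def)
      then have "(\<lambda>x. y * indicator (h -` {y} \<inter> space M) x + (\<Sum>y\<in>T. y * indicator (h -` {y} \<inter> space M) x)) \<in> L2_closure M A"
        using insert by (intro cl_add cl_scale ind') auto
      then show ?case unfolding sum.insert[OF insert(1,2)] .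
    qed
    from this[OF fin] have "(\<lambda>x. \<Sum>y\<in>h ` space M. y * indicator (h -` {y} \<inter> space M) x) \<in> L2_closure M A" by simp
    then show ?thesis
    proof (rule L2_closure_cong)
      fix x assume x: "x \<in> space M"
      have "(\<Sum>y\<in>h ` space M. y * indicator (h -` {y} \<inter> space M) x) = (\<Sum>y\<in>h ` space M. if y = h x then y else 0)"
        using x by (intro sum.cong) (auto simp: indicator_def)
      also have "\<dots> = h x" using x fin by simp
      finally show "(\<Sum>y\<in>h ` space M. y * indicator (h -` {y} \<inter> space M) x) = h x" .
    qed
  qed
  obtain F where F: "\<And>i. simple_function M (F i)" "\<And>x. x \<in> space M \<Longrightarrow> (\<lambda>i. F i x) \<longlonglongrightarrow> f x"
      "\<And>i x. x \<in> space M \<Longrightarrow> dist (F i x) 0 \<le> 2 * dist (f x) 0"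
    using borel_measurable_implies_sequence_metric[OF L2_measurable[OF f], of 0] by blast
  have "(\<lambda>x. \<bar>f x\<bar>) \<in> L2 M"
    using L2_square_integrable[OF f] borel_measurable_abs[OF L2_measurable[OF f]] by (simp add: L2_def)
  then have w: "(\<lambda>x. 2 * \<bar>f x\<bar>) \<in> L2 M" by (rule L2_scale)
  show "f \<in> L2_closure M A"
    by (rule L2_closure_dominated[OF A simp_fun[OF F(1)] F(2) w]) (use F(3) in auto)
qed

section \<open>The square root of the plane coordinate\<close>

text \<open>
  The square root of \<open>x\<^sub>p + \<i> x\<^sub>q\<close> with nonnegative imaginary part. The branch cut of the principal
  root is the negative real axis, so the signs turn it into the ray \<open>x\<^sub>q = 0\<close>, \<open>x\<^sub>p \<ge> 0\<close>, over which
  the half-equator lies.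
\<close>

definition slit_root :: "'n::finite \<Rightarrow> 'n \<Rightarrow> real ^ 'n \<Rightarrow> complex" where
  "slit_root p q x = \<i> * csqrt (- Complex (x $ p) (x $ q))"

lemma slit_root_square: "(slit_root p q x)\<^sup>2 = Complex (x $ p) (x $ q)"
  by (simp add: slit_root_def power_mult_distrib)

lemma Im_slit_root_nonneg: "0 \<le> Im (slit_root p q x)"
  using csqrt_principal[of "- Complex (x $ p) (x $ q)"] by (auto simp: slit_root_def)

lemma norm_slit_root_square: "(cmod (slit_root p q x))\<^sup>2 = sqrt ((x $ p)\<^sup>2 + (x $ q)\<^sup>2)"
  by (simp add: norm_power[symmetric] slit_root_square complex_norm)

definition monom_fun :: "('n::finite \<Rightarrow> nat) \<Rightarrow> real ^ 'n \<Rightarrow> real" where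
  "monom_fun \<alpha> x = (\<Prod>i\<in>UNIV. (x $ i) ^ \<alpha> i)"

lemma monom_fun_zero [simp]: "monom_fun (\<lambda>_. 0) x = 1"
  by (simp add: monom_fun_def)

lemma monom_fun_add: "monom_fun (\<lambda>i. \<alpha> i + \<beta> i) x = monom_fun \<alpha> x * monom_fun \<beta> x"
  by (simp add: monom_fun_def power_add prod.distrib)

lemma monom_fun_single: "monom_fun (\<lambda>j. if j = i then k else 0) x = (x $ i) ^ k"
proof -
  have "monom_fun (\<lambda>j. if j = i then k else 0) x = (\<Prod>j\<in>UNIV. if j = i then (x $ i) ^ k else 1)"
    unfolding monom_fun_def by (intro prod.cong) auto
  then show ?thesis by simp
qed

lemma monom_fun_le_1:
  assumes "norm x \<le> 1"
  shows "\<bar>monom_fun \<alpha> x\<bar> \<le> 1"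
proof -
  have "\<bar>x $ i\<bar> \<le> 1" for i using component_le_norm_cart[of x i] assms by linarith
  then show ?thesis unfolding monom_fun_def abs_prod power_abs
    by (intro prod_le_1) (auto intro: power_le_one)
qed

text \<open>
  The exponents of monomials in \<open>x'\<close>.
\<close>

definition exponents :: "'n::finite \<Rightarrow> 'n \<Rightarrow> ('n \<Rightarrow> nat) set" where
  "exponents p q = {\<alpha>. \<alpha> p = 0 \<and> \<alpha> q = 0}"

text \<open>
  The function \<open>Re (w\<^sup>j) x\<^sup>\<alpha>\<close>. Since \<open>Re (w\<^sup>j)\<close> is even in \<open>Im w\<close> and \<open>Im w\<close> vanishes exactly on the
  slit, it satisfies Neumann conditions on both sides; for even \<open>j\<close> it is a polynomial.
\<close>

definition slit_poly :: "'n::finite \<Rightarrow> 'n \<Rightarrow> nat \<Rightarrow> ('n \<Rightarrow> nat) \<Rightarrow> real ^ 'n \<Rightarrow> real" where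
  "slit_poly p q j \<alpha> x = Re (slit_root p q x ^ j) * monom_fun \<alpha> x"

lemma norm_slit_root_le_1:
  assumes "norm x \<le> 1" "p \<noteq> q"
  shows "cmod (slit_root p q x) \<le> 1"
proof -
  have "(x $ p)\<^sup>2 + (x $ q)\<^sup>2 = (\<Sum>i\<in>{p,q}. (x $ i)\<^sup>2)" using assms(2) by simp
  also have "\<dots> \<le> (\<Sum>i\<in>UNIV. (x $ i)\<^sup>2)" by (rule sum_mono2) auto
  also have "\<dots> = (norm x)\<^sup>2" by (simp add: norm_vec_def L2_set_def sum_nonneg)
  also have "\<dots> \<le> 1" using assms(1) by (simp add: power_le_one)
  finally have "(cmod (slit_root p q x))\<^sup>2 \<le> 1" by (simp add: norm_slit_root_square)
  then show ?thesis by (simp add: abs_square_le_1)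
qed

section \<open>Uniform density of the products\<close>

text \<open>
  On the slit sphere \<open>w\<close> has different limits on the two sides of the slit. The closure of its graph is
  the compact space on which it becomes continuous; over a point of the slit with \<open>x\<^sub>p > 0\<close> it has two
  points.
\<close>

definition slit_graph :: "'n::finite \<Rightarrow> 'n \<Rightarrow> ((real ^ 'n) \<times> complex) set" where
  "slit_graph p q = {(x, w). norm x = 1 \<and> w\<^sup>2 = Complex (x $ p) (x $ q) \<and> 0 \<le> Im w}"

definition graph_poly :: "nat \<Rightarrow> ('n::finite \<Rightarrow> nat) \<Rightarrow> (real ^ 'n) \<times> complex \<Rightarrow> real" where
  "graph_poly j \<alpha> z = Re (snd z ^ j) * monom_fun \<alpha> (fst z)"

definition uniform_closure :: "'a set \<Rightarrow> ('a \<Rightarrow> real) set \<Rightarrow> ('a::topological_space \<Rightarrow> real) set" where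
  "uniform_closure K A = {f. continuous_on K f \<and> (\<forall>e>0. \<exists>g\<in>A. \<forall>z\<in>K. \<bar>f z - g z\<bar> < e)}"

lemma uniform_closure_trans:
  assumes "continuous_on K f" "\<And>e. e > 0 \<Longrightarrow> \<exists>g\<in>uniform_closure K A. \<forall>z\<in>K. \<bar>f z - g z\<bar> < e"
  shows "f \<in> uniform_closure K A"
proof -
  have "\<exists>g\<in>A. \<forall>z\<in>K. \<bar>f z - g z\<bar> < e" if "e > 0" for e
  proof -
    obtain h where h: "h \<in> uniform_closure K A" "\<And>z. z \<in> K \<Longrightarrow> \<bar>f z - h z\<bar> < e / 2"
      using assms(2)[of "e/2"] \<open>e > 0\<close> by auto
    obtain g where g: "g \<in> A" "\<And>z. z \<in> K \<Longrightarrow> \<bar>h z - g z\<bar> < e / 2"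
      using h(1) \<open>e > 0\<close> unfolding uniform_closure_def by (auto dest!: spec[of _ "e/2"])
    have "\<bar>f z - g z\<bar> < e" if "z \<in> K" for z using h(2)[OF that] g(2)[OF that] by linarith
    then show ?thesis using g(1) by blast
  qed
  then show ?thesis using assms(1) by (simp add: uniform_closure_def)
qed

lemma uniform_closure_add:
  assumes "\<And>f g. f \<in> A \<Longrightarrow> g \<in> A \<Longrightarrow> (\<lambda>x. f x + g x) \<in> A"
    and f: "f \<in> uniform_closure K A" and g: "g \<in> uniform_closure K A"
  shows "(\<lambda>x. f x + g x) \<in> uniform_closure K A"
proof -
  have "\<exists>h\<in>A. \<forall>z\<in>K. \<bar>f z + g z - h z\<bar> < e" if "e > 0" for e
  proof -
    obtain a where a: "a \<in> A" "\<And>z. z \<in> K \<Longrightarrow> \<bar>f z - a z\<bar> < e / 2"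
      using f \<open>e > 0\<close> unfolding uniform_closure_def by (auto dest!: spec[of _ "e/2"])
    obtain b where b: "b \<in> A" "\<And>z. z \<in> K \<Longrightarrow> \<bar>g z - b z\<bar> < e / 2"
      using g \<open>e > 0\<close> unfolding uniform_closure_def by (auto dest!: spec[of _ "e/2"])
    have "\<bar>f z + g z - (a z + b z)\<bar> < e" if "z \<in> K" for z using a(2)[OF that] b(2)[OF that] by linarith
    then show ?thesis using assms(1)[OF a(1) b(1)] by (intro bexI) auto
  qed
  then show ?thesis using f g by (auto simp: uniform_closure_def intro: continuous_on_add)
qed

text \<open>
  Multiplication by a bounded function is continuous for uniform convergence, so it suffices to
  multiply the generators.
\<close>

lemma uniform_closure_mult:
  assumes h: "continuous_on K h" "compact K"
    and A: "\<And>g. g \<in> A \<Longrightarrow> (\<lambda>z. h z * g z) \<in> uniform_closure K A"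
    and f: "f \<in> uniform_closure K A"
  shows "(\<lambda>z. h z * f z) \<in> uniform_closure K A"
proof (rule uniform_closure_trans)
  show "continuous_on K (\<lambda>z. h z * f z)" using f h by (auto simp: uniform_closure_def intro: continuous_on_mult)
  have "bounded (h ` K)" by (intro compact_imp_bounded compact_continuous_image h)
  then obtain B where B: "B > 0" "\<And>z. z \<in> K \<Longrightarrow> \<bar>h z\<bar> \<le> B" unfolding bounded_pos by auto
  fix e :: real assume "e > 0"
  then have "e / B > 0" using B by simp
  then obtain g where g: "g \<in> A" "\<And>z. z \<in> K \<Longrightarrow> \<bar>f z - g z\<bar> < e / B"
    using f unfolding uniform_closure_def by blast
  have "\<bar>h z * f z - h z * g z\<bar> < e" if "z \<in> K" for z
  proof -
    have "\<bar>h z * f z - h z * g z\<bar> = \<bar>h z\<bar> * \<bar>f z - g z\<bar>" by (simp add: abs_mult[symmetric] right_diff_distrib)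
    also have "\<dots> \<le> B * \<bar>f z - g z\<bar>" using B(2)[OF that] by (intro mult_right_mono) auto
    also have "\<dots> < e" using g(2)[OF that] B(1) by (simp add: pos_less_divide_eq mult.commute)
    finally show ?thesis .
  qed
  then show "\<exists>g\<in>uniform_closure K A. \<forall>z\<in>K. \<bar>h z * f z - g z\<bar> < e" using A[OF g(1)] by (intro bexI) auto
qed

lemma compact_slit_graph:
  fixes p q :: "'n::finite"
  assumes "p \<noteq> q"
  shows "compact (slit_graph p q)"
proof -
  have "closed {z :: (real ^ 'n) \<times> complex. norm (fst z) = 1 \<and> (snd z)\<^sup>2 = Complex (fst z $ p) (fst z $ q) \<and> 0 \<le> Im (snd z)}"
    unfolding complex_eq_iff complex.sel
    by (intro closed_Collect_conj closed_Collect_eq closed_Collect_le continuous_intros)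
  then have "closed (slit_graph p q)" by (simp add: slit_graph_def case_prod_unfold)
  moreover have "slit_graph p q \<subseteq> cball 0 1 \<times> cball 0 1"
  proof
    fix z assume z: "z \<in> slit_graph p q"
    obtain x w where [simp]: "z = (x, w)" by (cases z)
    have x: "norm x = 1" "w\<^sup>2 = (slit_root p q x)\<^sup>2" using z by (auto simp: slit_graph_def slit_root_square)
    then have "(cmod w)\<^sup>2 = (cmod (slit_root p q x))\<^sup>2" by (metis norm_power)
    also have "\<dots> \<le> 1" using norm_slit_root_le_1[of x p q] x assms by (simp add: power_le_one)
    finally have "cmod w \<le> 1" by (simp add: abs_square_le_1)
    then show "z \<in> cball 0 1 \<times> cball 0 1" using x by simp
  qed
  then have "bounded (slit_graph p q)" by (rule bounded_subset[rotated]) (simp add: bounded_Times)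
  ultimately show ?thesis by (simp add: compact_eq_bounded_closed)
qed

text \<open>
  The product formula for cosines. The factor \<open>|w|\<close> to the power \<open>2 i\<close> is what keeps the linear span of
  the products from being an algebra.
\<close>

lemma Re_power_mult:
  fixes w :: complex
  assumes "i \<le> j"
  shows "Re (w ^ i) * Re (w ^ j) = (Re (w ^ (i + j)) + ((cmod w)\<^sup>2) ^ i * Re (w ^ (j - i))) / 2"
proof -
  have "w ^ j = w ^ i * w ^ (j - i)" using assms by (simp add: power_add[symmetric])
  then have "cnj (w ^ i) * w ^ j = (w * cnj w) ^ i * w ^ (j - i)" by (simp add: power_mult_distrib mult_ac)
  also have "\<dots> = of_real (((cmod w)\<^sup>2) ^ i) * w ^ (j - i)" by (simp add: complex_norm_square[symmetric])
  finally have 1: "Re (cnj (w ^ i) * w ^ j) = ((cmod w)\<^sup>2) ^ i * Re (w ^ (j - i))"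
    by (simp add: Re_complex_of_real flip: of_real_power)
  have "Re (w ^ (i + j)) = Re (w ^ i) * Re (w ^ j) - Im (w ^ i) * Im (w ^ j)" by (simp add: power_add)
  moreover have "Re (cnj (w ^ i) * w ^ j) = Re (w ^ i) * Re (w ^ j) + Im (w ^ i) * Im (w ^ j)"
    by (simp del: complex_cnj_power)
  ultimately show ?thesis using 1 by simp
qed

lemma continuous_on_monom_fun: "continuous_on S (monom_fun \<alpha>)"
  unfolding monom_fun_def by (intro continuous_intros)

lemma continuous_on_graph_poly: "continuous_on S (graph_poly j \<alpha>)"
  unfolding graph_poly_def[abs_def]
  by (intro continuous_intros continuous_on_compose2[OF continuous_on_monom_fun[of UNIV]]) auto

lemma uniform_closure_cong:
  assumes "f \<in> uniform_closure K A" "\<And>z. z \<in> K \<Longrightarrow> f z = g z"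
  shows "g \<in> uniform_closure K A"
proof (rule uniform_closure_trans)
  show "continuous_on K g" using assms continuous_on_cong[of K K f g] by (simp add: uniform_closure_def)
  show "\<exists>h\<in>uniform_closure K A. \<forall>z\<in>K. \<bar>g z - h z\<bar> < e" if "e > 0" for e
    using assms that by (intro bexI[OF _ assms(1)]) auto
qed

definition graph_span :: "'n::finite \<Rightarrow> 'n \<Rightarrow> ((real ^ 'n) \<times> complex \<Rightarrow> real) set" where
  "graph_span p q = lin_span {graph_poly j \<alpha> |j \<alpha>. \<alpha> \<in> exponents p q}"

lemma graph_poly_in_span: "\<alpha> \<in> exponents p q \<Longrightarrow> graph_poly j \<alpha> \<in> graph_span p q"
  unfolding graph_span_def by (rule lin_span_base) auto

lemma exponents_add: "\<alpha> \<in> exponents p q \<Longrightarrow> \<beta> \<in> exponents p q \<Longrightarrow> (\<lambda>i. \<alpha> i + \<beta> i) \<in> exponents p q"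
  by (simp add: exponents_def)

lemma exponents_zero: "(\<lambda>_. 0) \<in> exponents p q"
  by (simp add: exponents_def)

lemma exponents_single: "i \<noteq> p \<Longrightarrow> i \<noteq> q \<Longrightarrow> (\<lambda>j. if j = i then k else 0) \<in> exponents p q"
  by (simp add: exponents_def)

text \<open>
  The span \<open>A\<close> of the products is a module over the polynomials in \<open>x'\<close>, but not an algebra, since
  multiplication produces powers of \<open>|w|\<^sup>2\<close>. On the sphere, however, \<open>|w|\<^sup>2\<close> is the square root of
  \<open>1 - |x'|\<^sup>2\<close>, which is a uniform limit of polynomials in \<open>x'\<close>. Therefore the uniform closure \<open>R\<close> of
  \<open>A\<close> is an algebra, and the Stone--Weierstrass theorem applies to it. Points of the graph are separated
  by \<open>x'\<close>, \<open>Re w\<close> and \<open>|w|\<^sup>2\<close>, because \<open>Im w \<ge> 0\<close>.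
\<close>

lemma graph_span_uniformly_dense:
  fixes p q :: "'n::finite"
  assumes pq: "p \<noteq> q" and f: "continuous_on (slit_graph p q) f"
  shows "f \<in> uniform_closure (slit_graph p q) (graph_span p q)"
proof -
  define K where "K = slit_graph p q"
  define A where "A = graph_span p q"
  \<comment> \<open>the algebra to which the Stone--Weierstrass theorem is applied\<close>
  define R where "R = uniform_closure K A"
  have cpt: "compact K" unfolding K_def by (rule compact_slit_graph[OF pq])
  have A_add: "(\<lambda>z. f z + g z) \<in> A" if "f \<in> A" "g \<in> A" for f g
    using that unfolding A_def graph_span_def by (rule lin_span_add)
  have A_scale: "(\<lambda>z. c * f z) \<in> A" if "f \<in> A" for c f
    using that unfolding A_def graph_span_def by (rule lin_span_scale)
  have A_zero: "(\<lambda>z. 0) \<in> A" unfolding A_def graph_span_def by (rule lin_span.zero)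
  have A_ind: "f \<in> V" if "f \<in> A" "\<And>j \<alpha>. \<alpha> \<in> exponents p q \<Longrightarrow> graph_poly j \<alpha> \<in> V" "(\<lambda>_. 0) \<in> V"
    "\<And>f g. f \<in> V \<Longrightarrow> g \<in> V \<Longrightarrow> (\<lambda>x. f x + g x) \<in> V"
    "\<And>c f. f \<in> V \<Longrightarrow> (\<lambda>x. c * f x) \<in> V" for f V
    using that(1) unfolding A_def graph_span_def
    by (rule lin_span_in) (use that(2-) in auto)
  have gpA: "graph_poly j \<alpha> \<in> A" if "\<alpha> \<in> exponents p q" for j \<alpha>
    using graph_poly_in_span[OF that] by (simp add: A_def)
  have A_cont: "continuous_on K f" if "f \<in> A" for f
  proof -
    have "f \<in> {f. continuous_on K f}" using that
      by (rule A_ind) (auto intro: continuous_on_graph_poly continuous_on_add continuous_on_mult)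
    then show ?thesis by simp
  qed
  have AR: "f \<in> R" if "f \<in> A" for f
    using A_cont[OF that] that by (auto simp: R_def uniform_closure_def intro!: bexI[of _ f])
  have R_cont: "continuous_on K f" if "f \<in> R" for f
    using that by (simp add: R_def uniform_closure_def)
  have R_add: "(\<lambda>z. f z + g z) \<in> R" if "f \<in> R" "g \<in> R" for f g
    unfolding R_def by (rule uniform_closure_add) (use that A_add R_def in auto)
  have R_mult: "(\<lambda>z. h z * f z) \<in> R" if "continuous_on K h" "\<And>g. g \<in> A \<Longrightarrow> (\<lambda>z. h z * g z) \<in> R" "f \<in> R" for h f
    unfolding R_def by (rule uniform_closure_mult) (use that cpt R_def in auto)
  have R_cong: "g \<in> R" if "f \<in> R" "\<And>z. z \<in> K \<Longrightarrow> f z = g z" for f g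
    using uniform_closure_cong[of f K A g] that by (simp add: R_def)
  have R_scale: "(\<lambda>z. c * f z) \<in> R" if "f \<in> R" for c f
    by (rule R_mult[OF _ _ that]) (auto intro: AR A_scale)
  have R_zero: "(\<lambda>z. 0) \<in> R" by (rule AR[OF A_zero])
  have gp0: "graph_poly 0 (\<lambda>_. 0) = (\<lambda>_. 1)" by (simp add: graph_poly_def fun_eq_iff)
  have R_one: "(\<lambda>z. 1) \<in> R" using AR[OF gpA[OF exponents_zero, of 0]] by (simp add: gp0)
  have R_const: "(\<lambda>z. c) \<in> R" for c using R_scale[OF R_one, of c] by simp
  have R_monom: "(\<lambda>z. monom_fun \<beta> (fst z) * f z) \<in> R" if \<beta>: "\<beta> \<in> exponents p q" and "f \<in> R" for \<beta> f
  proof (rule R_mult[OF _ _ that(2)])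
    show "continuous_on K (\<lambda>z. monom_fun \<beta> (fst z))"
      by (intro continuous_on_compose2[OF continuous_on_monom_fun[of UNIV]] continuous_intros) auto
    fix g assume "g \<in> A"
    then have "g \<in> {g. (\<lambda>z. monom_fun \<beta> (fst z) * g z) \<in> A}"
    proof (rule A_ind)
      fix j \<alpha> assume "\<alpha> \<in> exponents p q"
      then have "graph_poly j (\<lambda>i. \<alpha> i + \<beta> i) \<in> A" by (intro gpA exponents_add \<beta>)
      also have "graph_poly j (\<lambda>i. \<alpha> i + \<beta> i) = (\<lambda>z. monom_fun \<beta> (fst z) * graph_poly j \<alpha> z)"
        by (auto simp: graph_poly_def monom_fun_add fun_eq_iff)
      finally show "graph_poly j \<alpha> \<in> {g. (\<lambda>z. monom_fun \<beta> (fst z) * g z) \<in> A}" by simp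
    next
      show "(\<lambda>x. c * f x) \<in> {g. (\<lambda>z. monom_fun \<beta> (fst z) * g z) \<in> A}"
        if "f \<in> {g. (\<lambda>z. monom_fun \<beta> (fst z) * g z) \<in> A}" for c f
        using A_scale[of "\<lambda>z. monom_fun \<beta> (fst z) * f z" c] that by (simp add: mult.left_commute)
    qed (auto simp: A_zero distrib_left intro: A_add)
    then show "(\<lambda>z. monom_fun \<beta> (fst z) * g z) \<in> R" by (auto intro: AR)
  qed
  have R_sum: "(\<lambda>z. \<Sum>i\<in>I. g i z) \<in> R" if "\<And>i. i \<in> I \<Longrightarrow> g i \<in> R" for I :: "'n set" and g
    using that by (induction I rule: infinite_finite_induct) (auto intro: R_zero R_add)
  \<comment> \<open>\<open>|x'|\<^sup>2\<close>, a combination of monomials\<close>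
  define s where "s z = (\<Sum>i\<in>- {p, q}. (fst z $ i)\<^sup>2)" for z :: "(real ^ 'n) \<times> complex"
  have R_s: "(\<lambda>z. s z * f z) \<in> R" if "f \<in> R" for f
  proof -
    have "(\<lambda>z. \<Sum>i\<in>- {p, q}. monom_fun (\<lambda>j. if j = i then 2 else 0) (fst z) * f z) \<in> R"
      by (rule R_sum[OF R_monom[OF exponents_single that]]) auto
    then show ?thesis by (simp add: monom_fun_single s_def sum_distrib_right)
  qed
  have R_poly: "real_polynomial_function P \<Longrightarrow> \<forall>f\<in>R. (\<lambda>z. P (s z) * f z) \<in> R" for P :: "real \<Rightarrow> real"
  proof (induction rule: real_polynomial_function.induct)
    case (linear L)
    have "L t = t * L 1" for t using linear_scale[OF bounded_linear.linear[OF linear], of t 1] by simp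
    then show ?case using R_scale[OF R_s, of _ "L 1"] by (metis (no_types, lifting) ext mult.assoc mult.commute)
  next
    case (const c)
    then show ?case by (auto intro: R_scale)
  next
    case (add P Q)
    then show ?case by (auto simp: distrib_right intro: R_add)
  next
    case (mult P Q)
    show ?case
    proof
      fix f assume "f \<in> R"
      then have "(\<lambda>z. Q (s z) * f z) \<in> R" using mult.IH(2) by (rule bspec[rotated])
      then have "(\<lambda>z. P (s z) * (Q (s z) * f z)) \<in> R" using mult.IH(1) by (rule bspec[rotated])
      then show "(\<lambda>z. P (s z) * Q (s z) * f z) \<in> R" by (simp add: mult.assoc)
    qed
  qed
  have s_norm: "s z + ((fst z $ p)\<^sup>2 + (fst z $ q)\<^sup>2) = 1" if "z \<in> K" for z
  proof -
    have "(norm (fst z))\<^sup>2 = (\<Sum>i\<in>UNIV. (fst z $ i)\<^sup>2)" by (simp add: norm_vec_def L2_set_def sum_nonneg)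
    also have "\<dots> = s z + (\<Sum>i\<in>{p, q}. (fst z $ i)\<^sup>2)"
      unfolding s_def by (subst sum.union_disjoint[symmetric]) (auto intro: sum.cong)
    finally show ?thesis using that pq by (auto simp: K_def slit_graph_def)
  qed
  have s01: "s z \<in> {0..1}" if "z \<in> K" for z
  proof -
    have "0 \<le> s z" unfolding s_def by (intro sum_nonneg) auto
    moreover have "0 \<le> (fst z $ p)\<^sup>2 + (fst z $ q)\<^sup>2" by simp
    ultimately show ?thesis using s_norm[OF that] unfolding atLeastAtMost_iff by (intro conjI; linarith)
  qed
  have s_cont: "continuous_on K s" unfolding s_def by (intro continuous_intros)
  have R_h: "(\<lambda>z. h (s z) * f z) \<in> R" if h: "continuous_on {0..1} h" and f: "f \<in> R" for h :: "real \<Rightarrow> real" and f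
    unfolding R_def
  proof (rule uniform_closure_trans)
    show "continuous_on K (\<lambda>z. h (s z) * f z)"
      using s01 by (intro continuous_intros R_cont f continuous_on_compose2[OF h s_cont]) auto
    have "bounded (f ` K)" by (intro compact_imp_bounded compact_continuous_image R_cont f cpt)
    then obtain B where B: "B > 0" "\<And>z. z \<in> K \<Longrightarrow> \<bar>f z\<bar> \<le> B" unfolding bounded_pos by auto
    fix e :: real assume "e > 0"
    then have eB: "e / B > 0" using B by simp
    obtain P where P: "real_polynomial_function P" "\<And>t. t \<in> {0..1} \<Longrightarrow> \<bar>h t - P t\<bar> < e / B"
      using Stone_Weierstrass_real_polynomial_function[OF _ h eB] by (metis compact_Icc)
    have "\<bar>h (s z) * f z - P (s z) * f z\<bar> < e" if "z \<in> K" for z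
    proof -
      have "\<bar>h (s z) * f z - P (s z) * f z\<bar> = \<bar>h (s z) - P (s z)\<bar> * \<bar>f z\<bar>"
        by (simp add: abs_mult[symmetric] left_diff_distrib)
      also have "\<dots> \<le> \<bar>h (s z) - P (s z)\<bar> * B" using B(2)[OF that] by (intro mult_left_mono) auto
      also have "\<dots> < e" using P(2)[OF s01[OF that]] B(1) by (simp add: pos_less_divide_eq)
      finally show ?thesis .
    qed
    moreover have "(\<lambda>z. P (s z) * f z) \<in> uniform_closure K A" using R_poly[OF P(1)] f by (auto simp: R_def)
    ultimately show "\<exists>g\<in>uniform_closure K A. \<forall>z\<in>K. \<bar>h (s z) * f z - g z\<bar> < e" by (intro bexI) auto
  qed
  \<comment> \<open>on the graph \<open>|w|\<^sup>4 = x\<^sub>p\<^sup>2 + x\<^sub>q\<^sup>2 = 1 - |x'|\<^sup>2\<close>\<close>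
  have norm_s: "(cmod (snd z))\<^sup>2 = sqrt (1 - s z)" if "z \<in> K" for z
  proof -
    have "(cmod (snd z))\<^sup>2 = cmod (Complex (fst z $ p) (fst z $ q))"
      using that by (auto simp: K_def slit_graph_def norm_power[symmetric])
    then show ?thesis using s_norm[OF that] by (simp add: complex_norm algebra_simps)
  qed
  have R_norm: "(\<lambda>z. ((cmod (snd z))\<^sup>2) ^ n * f z) \<in> R" if "f \<in> R" for n f
  proof (rule R_cong[OF R_h[OF _ that]])
    show "continuous_on {0..1} (\<lambda>t. sqrt (1 - t) ^ n)" by (intro continuous_intros)
  qed (simp add: norm_s)
  have gp_gp_le: "(\<lambda>z. graph_poly i \<alpha> z * graph_poly j \<beta> z) \<in> R"
    if "i \<le> j" "\<alpha> \<in> exponents p q" "\<beta> \<in> exponents p q" for i j \<alpha> \<beta>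
  proof -
    let ?g = "\<lambda>k. graph_poly k (\<lambda>i. \<alpha> i + \<beta> i)"
    have g: "?g k \<in> R" for k using that by (intro AR gpA exponents_add)
    have "(\<lambda>z. (1/2) * ?g (i + j) z + (1/2) * (((cmod (snd z))\<^sup>2) ^ i * ?g (j - i) z)) \<in> R"
      by (intro R_add R_scale R_norm g)
    also have "(\<lambda>z. (1/2) * ?g (i + j) z + (1/2) * (((cmod (snd z))\<^sup>2) ^ i * ?g (j - i) z)) = (\<lambda>z. graph_poly i \<alpha> z * graph_poly j \<beta> z)"
    proof
      fix z :: "(real ^ 'n) \<times> complex"
      have "graph_poly i \<alpha> z * graph_poly j \<beta> z = (Re (snd z ^ i) * Re (snd z ^ j)) * (monom_fun \<alpha> (fst z) * monom_fun \<beta> (fst z))"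
        by (simp add: graph_poly_def)
      also have "\<dots> = (1/2) * ?g (i + j) z + (1/2) * (((cmod (snd z))\<^sup>2) ^ i * ?g (j - i) z)"
        unfolding Re_power_mult[OF that(1)] graph_poly_def monom_fun_add by (simp add: field_simps)
      finally show "(1/2) * ?g (i + j) z + (1/2) * (((cmod (snd z))\<^sup>2) ^ i * ?g (j - i) z) = graph_poly i \<alpha> z * graph_poly j \<beta> z" by simp
    qed
    finally show ?thesis .
  qed
  have gp_gp: "(\<lambda>z. graph_poly i \<alpha> z * graph_poly j \<beta> z) \<in> R"
    if "\<alpha> \<in> exponents p q" "\<beta> \<in> exponents p q" for i j \<alpha> \<beta>
    using gp_gp_le[of i j \<alpha> \<beta>] gp_gp_le[of j i \<beta> \<alpha>] that by (cases "i \<le> j") (auto simp: mult.commute)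
  have gp_R: "(\<lambda>z. graph_poly i \<alpha> z * f z) \<in> R" if \<alpha>: "\<alpha> \<in> exponents p q" and f: "f \<in> R" for i \<alpha> f
  proof (rule R_mult[OF continuous_on_graph_poly _ f])
    fix g assume "g \<in> A"
    then have "g \<in> {g. (\<lambda>z. graph_poly i \<alpha> z * g z) \<in> R}"
    proof (rule A_ind)
      show "(\<lambda>x. c * f x) \<in> {g. (\<lambda>z. graph_poly i \<alpha> z * g z) \<in> R}"
        if "f \<in> {g. (\<lambda>z. graph_poly i \<alpha> z * g z) \<in> R}" for c f
        using R_scale[of "\<lambda>z. graph_poly i \<alpha> z * f z" c] that by (simp add: mult.left_commute)
    qed (auto simp: R_zero distrib_left gp_gp \<alpha> intro: R_add)
    then show "(\<lambda>z. graph_poly i \<alpha> z * g z) \<in> R" by simp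
  qed
  have A_R: "(\<lambda>z. g z * f z) \<in> R" if g: "g \<in> A" and f: "f \<in> R" for f g
  proof -
    have "g \<in> {g. (\<lambda>z. g z * f z) \<in> R}" using g
    proof (rule A_ind)
      show "(\<lambda>x. c * h x) \<in> {g. (\<lambda>z. g z * f z) \<in> R}" if "h \<in> {g. (\<lambda>z. g z * f z) \<in> R}" for c h
        using R_scale[of "\<lambda>z. h z * f z" c] that by (simp add: mult.assoc)
    qed (auto simp: R_zero distrib_right gp_R f intro: R_add)
    then show ?thesis by simp
  qed
  have R_R: "(\<lambda>z. f z * g z) \<in> R" if f: "f \<in> R" and g: "g \<in> R" for f g
    by (rule R_mult[OF R_cont[OF f] _ g]) (use A_R[OF _ f] in \<open>simp add: mult.commute\<close>)
  interpret function_ring_on R K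
  proof
    show "\<exists>f\<in>R. f x \<noteq> f y" if xy: "x \<in> K" "y \<in> K" "x \<noteq> y" for x y
    proof -
      obtain a w where x: "x = (a, w)" by (cases x)
      obtain b v where y: "y = (b, v)" by (cases y)
      have w: "w\<^sup>2 = Complex (a $ p) (a $ q)" "0 \<le> Im w" and v: "v\<^sup>2 = Complex (b $ p) (b $ q)" "0 \<le> Im v"
        using xy by (auto simp: K_def slit_graph_def x y)
      consider "w = v" | "Re w \<noteq> Re v" | "Re w = Re v" "Im w \<noteq> Im v" by (auto simp: complex_eq_iff)
      then show ?thesis
      proof cases
        case 1
        then have "a \<noteq> b" using xy by (simp add: x y)
        then obtain i where i: "a $ i \<noteq> b $ i" by (auto simp: vec_eq_iff)
        have "a $ p = b $ p" "a $ q = b $ q" using w v 1 by auto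
        then have "i \<noteq> p" "i \<noteq> q" using i by auto
        then have "graph_poly 0 (\<lambda>j. if j = i then 1 else 0) \<in> R" by (intro AR gpA exponents_single)
        moreover have "graph_poly 0 (\<lambda>j. if j = i then 1 else 0) x \<noteq> graph_poly 0 (\<lambda>j. if j = i then 1 else 0) y"
          using i by (simp add: graph_poly_def monom_fun_single x y)
        ultimately show ?thesis by blast
      next
        case 2
        have "graph_poly 1 (\<lambda>_. 0) \<in> R" by (intro AR gpA exponents_zero)
        moreover have "graph_poly 1 (\<lambda>_. 0) x \<noteq> graph_poly 1 (\<lambda>_. 0) y"
          using 2 by (simp add: graph_poly_def x y)
        ultimately show ?thesis by blast
      next
        case 3
        define g where "g z = ((cmod (snd z))\<^sup>2) ^ 1 * 1" for z :: "(real ^ 'n) \<times> complex"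
        have "g \<in> R" unfolding g_def by (rule R_norm[OF R_one])
        moreover have "(Im w)\<^sup>2 \<noteq> (Im v)\<^sup>2" using 3 w v by (simp add: power2_eq_iff_nonneg)
        then have "g x \<noteq> g y"
          using 3 by (simp add: g_def x y cmod_power2)
        ultimately show ?thesis by blast
      qed
    qed
  qed (use cpt R_cont R_add R_R R_const in auto)
  show ?thesis
    unfolding K_def[symmetric] A_def[symmetric]
  proof (rule uniform_closure_trans)
    show "continuous_on K f" using f by (simp add: K_def)
    then show "\<exists>g\<in>uniform_closure K A. \<forall>z\<in>K. \<bar>f z - g z\<bar> < e" if "e > 0" for e
      using Stone_Weierstrass_basic[of f e] that by (simp add: R_def)
  qed
qed

definition slit_span :: "'n::finite \<Rightarrow> 'n \<Rightarrow> (real ^ 'n \<Rightarrow> real) set" where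
  "slit_span p q = lin_span {slit_poly p q j \<alpha> |j \<alpha>. \<alpha> \<in> exponents p q}"

lemma graph_to_slit_span:
  "g \<in> graph_span p q \<Longrightarrow> (\<lambda>x. g (x, slit_root p q x)) \<in> slit_span p q"
proof -
  assume "g \<in> graph_span p q"
  then have "g \<in> {g. (\<lambda>x. g (x, slit_root p q x)) \<in> slit_span p q}"
    unfolding graph_span_def
  proof (rule lin_span_in)
    fix b assume "b \<in> {graph_poly j \<alpha> |j \<alpha>. \<alpha> \<in> exponents p q}"
    then obtain j \<alpha> where b: "b = graph_poly j \<alpha>" "\<alpha> \<in> exponents p q" by auto
    have "slit_poly p q j \<alpha> \<in> slit_span p q" unfolding slit_span_def
      by (rule lin_span_base) (use b in auto)
    moreover have "slit_poly p q j \<alpha> = (\<lambda>x. b (x, slit_root p q x))"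
      by (simp add: b slit_poly_def graph_poly_def fun_eq_iff)
    ultimately show "b \<in> {g. (\<lambda>x. g (x, slit_root p q x)) \<in> slit_span p q}" by simp
  qed (auto simp: slit_span_def intro: lin_span.zero lin_span_add lin_span_scale)
  then show ?thesis by simp
qed

lemma borel_measurable_slit_root [measurable]: "slit_root p q \<in> borel_measurable borel"
proof -
  have c: "continuous_on (- \<real>\<^sub>\<le>\<^sub>0) csqrt" by (rule continuous_on_csqrt)
  have r: "csqrt = (\<lambda>z. Complex (sqrt ((cmod z + Re z) / 2)) ((if Im z = 0 then 1 else sgn (Im z)) * sqrt ((cmod z - Re z) / 2)))"
    by (simp add: fun_eq_iff complex_eq_iff)
  have "csqrt = (\<lambda>z. of_real (sqrt ((cmod z + Re z) / 2)) + \<i> * of_real ((if Im z = 0 then 1 else sgn (Im z)) * sqrt ((cmod z - Re z) / 2)))"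
    by (subst r) (simp add: Complex_eq)
  moreover have "(\<lambda>z. of_real (sqrt ((cmod z + Re z) / 2)) + \<i> * of_real ((if Im z = 0 then 1 else sgn (Im z)) * sqrt ((cmod z - Re z) / 2)) :: complex) \<in> borel_measurable borel"
    by measurable
  ultimately have cs [measurable]: "csqrt \<in> borel_measurable borel" by simp
  have "continuous_on UNIV (\<lambda>x::real ^ 'a. - Complex (x $ p) (x $ q))"
    unfolding Complex_eq by (intro continuous_intros)
  then have [measurable]: "(\<lambda>x::real ^ 'a. - Complex (x $ p) (x $ q)) \<in> borel_measurable borel"
    by (rule borel_measurable_continuous_onI)
  show ?thesis unfolding slit_root_def[abs_def] by measurable
qed

lemma borel_measurable_monom_fun [measurable]: "monom_fun \<alpha> \<in> borel_measurable borel"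
  by (rule borel_measurable_continuous_onI[OF continuous_on_monom_fun])

lemma borel_measurable_slit_poly [measurable]: "slit_poly p q j \<alpha> \<in> borel_measurable borel"
  unfolding slit_poly_def[abs_def] by measurable

lemma slit_poly_bounded:
  assumes "p \<noteq> q" "norm x \<le> 1" shows "\<bar>slit_poly p q j \<alpha> x\<bar> \<le> 1"
proof -
  have "\<bar>Re (slit_root p q x ^ j)\<bar> \<le> cmod (slit_root p q x) ^ j"
    using abs_Re_le_cmod[of "slit_root p q x ^ j"] by (simp add: norm_power)
  also have "\<dots> \<le> 1" using norm_slit_root_le_1[OF assms(2,1)] by (simp add: power_le_one)
  finally show ?thesis using monom_fun_le_1[OF assms(2), of \<alpha>]
    unfolding slit_poly_def abs_mult by (intro mult_le_one) auto
qed

lemma slit_poly_L2: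
  assumes "p \<noteq> q" shows "slit_poly p q j \<alpha> \<in> L2 sphere_measure"
proof -
  interpret finite_measure "sphere_measure :: (real ^ 'a) measure" by (rule finite_measure_sphere)
  show ?thesis
  proof (rule L2_bounded[where B=1])
    show "\<bar>slit_poly p q j \<alpha> x\<bar> \<le> 1" if "x \<in> space sphere_measure" for x
      using that by (intro slit_poly_bounded[OF assms]) simp
  qed (intro borel_measurable_sphere borel_measurable_slit_poly)
qed

lemma slit_span_L2: "p \<noteq> q \<Longrightarrow> slit_span p q \<subseteq> L2 sphere_measure"
  unfolding slit_span_def by (rule lin_span_L2) (auto intro: slit_poly_L2)

text \<open>
  A continuous function on the sphere is a continuous function on the graph, so it can be approximated
  uniformly by the products.
\<close>

theorem slit_span_dense:
  fixes p q :: "'n::finite"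
  assumes pq: "p \<noteq> q"
  shows "L2 sphere_measure \<subseteq> L2_closure sphere_measure (slit_span p q)"
proof (rule L2_dense_if_continuous_approximable[OF finite_measure_sphere space_sphere_measure sets_sphere_measure])
  show "slit_span p q \<subseteq> L2 sphere_measure" by (rule slit_span_L2[OF pq])
  fix f :: "real ^ 'n \<Rightarrow> real" and e :: real assume f: "continuous_on (sphere 0 1) f" and e: "e > 0"
  have "continuous_on (slit_graph p q) (\<lambda>z. f (fst z))"
    by (rule continuous_on_compose2[OF f]) (auto simp: slit_graph_def intro!: continuous_intros)
  from graph_span_uniformly_dense[OF pq this]
  obtain g where g: "g \<in> graph_span p q" "\<And>z. z \<in> slit_graph p q \<Longrightarrow> \<bar>f (fst z) - g z\<bar> < e"
    using e unfolding uniform_closure_def by blast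
  have "\<bar>f x - g (x, slit_root p q x)\<bar> < e" if "x \<in> sphere 0 1" for x
    using g(2)[of "(x, slit_root p q x)"] that by (simp add: slit_graph_def slit_root_square Im_slit_root_nonneg)
  then show "\<exists>g\<in>slit_span p q. \<forall>x\<in>sphere 0 1. \<bar>f x - g x\<bar> < e"
    using graph_to_slit_span[OF g(1)] by (intro bexI) auto
qed (auto simp: slit_span_def intro: lin_span_add lin_span_scale)

section \<open>Differential calculus off the slit\<close>

definition plane_part :: "'n::finite \<Rightarrow> 'n \<Rightarrow> real ^ 'n \<Rightarrow> complex" where
  "plane_part p q v = Complex (v $ p) (v $ q)"

text \<open>
  A defining function of the slit that is positive off it. It serves as the distance to the slit in
  all cutoffs, because it is the coordinate \<open>Im w\<close> in which the products are even.
\<close>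

definition slit_height :: "'n::finite \<Rightarrow> 'n \<Rightarrow> real ^ 'n \<Rightarrow> real" where
  "slit_height p q x = Im (slit_root p q x)"

abbreviation slit_dom :: "'n::finite \<Rightarrow> 'n \<Rightarrow> (real ^ 'n) set" where
  "slit_dom p q \<equiv> {x. 0 < slit_height p q x}"

lemma bounded_linear_plane_part: "bounded_linear (plane_part p q)"
  unfolding plane_part_def[abs_def] Complex_eq
  by (intro bounded_linear_add bounded_linear_compose[OF bounded_linear_of_real]
      bounded_linear_vec_nth bounded_linear_compose[OF bounded_linear_mult_right])

lemma slit_height_eq: "slit_height p q x = sqrt ((cmod (plane_part p q x) - x $ p) / 2)"
  by (simp add: slit_height_def slit_root_def plane_part_def)

lemma continuous_on_slit_height: "continuous_on S (slit_height p q)"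
  unfolding slit_height_eq[abs_def]
  by (intro continuous_intros linear_continuous_on[OF bounded_linear_plane_part]) auto

lemma open_slit_dom: "open (slit_dom p q)"
  by (intro open_Collect_less continuous_on_const continuous_on_slit_height)

lemma slit_height_nonneg: "0 \<le> slit_height p q x"
  by (simp add: slit_height_def Im_slit_root_nonneg)

lemma slit_height_half_equator: "x \<in> half_equator p q \<Longrightarrow> slit_height p q x = 0"
  by (simp add: slit_height_eq half_equator_def plane_part_def complex_norm)

lemma slit_sphere_subset_slit_dom: "slit_sphere p q \<subseteq> slit_dom p q"
proof
  fix x assume x: "x \<in> slit_sphere p q"
  have "slit_height p q x \<noteq> 0"
  proof
    assume "slit_height p q x = 0"
    then have "sqrt ((x $ p)\<^sup>2 + (x $ q)\<^sup>2) = x $ p"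
      by (simp add: slit_height_eq plane_part_def complex_norm)
    then have "0 \<le> x $ p" "(x $ p)\<^sup>2 + (x $ q)\<^sup>2 = (x $ p)\<^sup>2"
      by (metis real_sqrt_ge_zero sum_power2_ge_zero, metis real_sqrt_pow2 sum_power2_ge_zero)
    then show False using x by (auto simp: half_equator_def)
  qed
  then show "x \<in> slit_dom p q" using slit_height_nonneg[of p q x] by simp
qed

lemma slit_dom_root_nonzero: "x \<in> slit_dom p q \<Longrightarrow> slit_root p q x \<noteq> 0"
  by (auto simp: slit_height_def)

lemma slit_root_deriv:
  assumes "x \<in> slit_dom p q"
  shows "(slit_root p q has_derivative (\<lambda>v. plane_part p q v / (2 * slit_root p q x))) (at x)"
proof -
  define z where "z = - plane_part p q x"
  have w: "slit_root p q x = \<i> * csqrt z" by (simp add: slit_root_def z_def plane_part_def)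
  have pos: "Re (csqrt z) > 0" using assms by (simp add: slit_height_def w)
  have z: "z \<notin> \<real>\<^sub>\<le>\<^sub>0"
  proof
    assume "z \<in> \<real>\<^sub>\<le>\<^sub>0"
    then have "Re (csqrt z) = 0" by (auto elim!: nonpos_Reals_cases)
    with pos show False by simp
  qed
  have "((\<lambda>x. - plane_part p q x) has_derivative (\<lambda>v. - plane_part p q v)) (at x)"
    by (intro has_derivative_minus bounded_linear_imp_has_derivative bounded_linear_plane_part)
  from has_derivative_compose[OF this has_field_derivative_csqrt[OF z, unfolded has_field_derivative_def z_def]]
  have "((\<lambda>x. csqrt (- plane_part p q x)) has_derivative (\<lambda>v. inverse (2 * csqrt z) * - plane_part p q v)) (at x)"
    by (simp add: z_def)
  from has_derivative_mult_right[OF this, of \<i>]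
  have "((\<lambda>x. \<i> * csqrt (- plane_part p q x)) has_derivative (\<lambda>v. \<i> * (inverse (2 * csqrt z) * - plane_part p q v))) (at x)" .
  moreover have "\<i> * (inverse (2 * csqrt z) * - plane_part p q v) = plane_part p q v / (2 * slit_root p q x)" for v
  proof -
    have "csqrt z \<noteq> 0" using pos by auto
    then show ?thesis by (simp add: w field_simps)
  qed
  ultimately show ?thesis by (simp add: slit_root_def[abs_def] plane_part_def)
qed

lemma slit_root_powi_deriv:
  assumes "x \<in> slit_dom p q"
  shows "((\<lambda>x. slit_root p q x powi m) has_derivative
    (\<lambda>v. of_int m / 2 * slit_root p q x powi (m - 2) * plane_part p q v)) (at x)"
proof -
  let ?w = "slit_root p q x"
  have w0: "?w \<noteq> 0" by (rule slit_dom_root_nonzero[OF assms])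
  have "((\<lambda>z. z powi m) has_field_derivative (of_int m * ?w powi (m - 1))) (at ?w)"
    using DERIV_power_int[OF DERIV_ident disjI2[OF w0], of m] by simp
  from has_derivative_compose[OF slit_root_deriv[OF assms] this[unfolded has_field_derivative_def]]
  have "((\<lambda>x. slit_root p q x powi m) has_derivative
    (\<lambda>v. of_int m * ?w powi (m - 1) * (plane_part p q v / (2 * ?w)))) (at x)" .
  moreover have "of_int m * ?w powi (m - 1) * (plane_part p q v / (2 * ?w)) =
      of_int m / 2 * ?w powi (m - 2) * plane_part p q v" for v
  proof -
    have "?w powi (m - 1) = ?w powi (m - 2) * ?w"
      using power_int_add_1[of ?w "m - 2"] w0 by simp
    then show ?thesis using w0 by simp
  qed
  ultimately show ?thesis by (simp only:)
qed

text \<open>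
  All integer powers are treated at once, because differentiation lowers the exponent by two.
\<close>

lemma Ck_on_slit_root_powi: "Ck_on k (slit_dom p q) (\<lambda>x. slit_root p q x powi m)"
proof (induction k arbitrary: m)
  case 0
  show ?case
    using slit_root_powi_deriv by (auto intro!: continuous_at_imp_continuous_on has_derivative_continuous)
next
  case (Suc k)
  show ?case
  proof (rule Ck_on_SucI[OF open_slit_dom slit_root_powi_deriv])
    show "Ck_on k (slit_dom p q) (\<lambda>x. of_int m / 2 * slit_root p q x powi (m - 2) * plane_part p q v)" for v
      by (intro Ck_on_mult Ck_on_const Suc.IH open_slit_dom)
  qed
qed

lemma Ck_on_slit_height: "Ck_on k (slit_dom p q) (slit_height p q)"
  using Ck_on_linear[OF bounded_linear_Im open_slit_dom Ck_on_slit_root_powi[where m=1]]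
  by (simp add: slit_height_def[abs_def])

lemma slit_height_deriv:
  assumes "x \<in> slit_dom p q"
  shows "(slit_height p q has_derivative (\<lambda>v. Im (plane_part p q v / (2 * slit_root p q x)))) (at x)"
  unfolding slit_height_def[abs_def]
  by (rule bounded_linear.has_derivative[OF bounded_linear_Im slit_root_deriv[OF assms]])

section \<open>Derivatives of monomials\<close>

text \<open>
  For \<open>\<alpha> i = 0\<close> the exponent stays zero; the coefficient \<open>\<alpha> i\<close> then removes the term.
\<close>

definition lower :: "('n \<Rightarrow> nat) \<Rightarrow> 'n \<Rightarrow> 'n \<Rightarrow> nat" where
  "lower \<alpha> i = \<alpha>(i := \<alpha> i - 1)"

definition monom_grad :: "('n::finite \<Rightarrow> nat) \<Rightarrow> real ^ 'n \<Rightarrow> real ^ 'n" where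
  "monom_grad \<alpha> x = (\<Sum>i\<in>UNIV. (real (\<alpha> i) * monom_fun (lower \<alpha> i) x) *\<^sub>R axis i 1)"

definition monom_lap :: "('n::finite \<Rightarrow> nat) \<Rightarrow> real ^ 'n \<Rightarrow> real" where
  "monom_lap \<alpha> x = (\<Sum>i\<in>UNIV. real (\<alpha> i) * real (\<alpha> i - 1) * monom_fun (lower (lower \<alpha> i) i) x)"

abbreviation tdeg :: "('n::finite \<Rightarrow> nat) \<Rightarrow> nat" where
  "tdeg \<alpha> \<equiv> (\<Sum>i\<in>UNIV. \<alpha> i)"

lemma monom_grad_nth: "monom_grad \<alpha> x $ i = real (\<alpha> i) * monom_fun (lower \<alpha> i) x"
proof -
  have "monom_grad \<alpha> x $ i = (\<Sum>j\<in>UNIV. if j = i then real (\<alpha> i) * monom_fun (lower \<alpha> i) x else 0)"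
    unfolding monom_grad_def sum_component by (intro sum.cong) (auto simp: axis_def)
  then show ?thesis by simp
qed

lemma monom_fun_split: "monom_fun \<alpha> x = (x $ i) ^ \<alpha> i * (\<Prod>j\<in>UNIV - {i}. (x $ j) ^ \<alpha> j)"
  unfolding monom_fun_def by (rule prod.remove) auto

lemma monom_fun_deriv: "(monom_fun \<alpha> has_derivative (\<lambda>v. monom_grad \<alpha> x \<bullet> v)) (at x)"
proof -
  have "((\<lambda>x::real ^ 'a. (x $ i) ^ \<alpha> i) has_derivative (\<lambda>v. real (\<alpha> i) * v $ i * (x $ i) ^ (\<alpha> i - 1))) (at x)" for i
    by (rule has_derivative_eq_rhs[OF has_derivative_power[OF bounded_linear_imp_has_derivative[OF bounded_linear_vec_nth]]])
      (auto simp: mult_ac)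
  then have "((\<lambda>x::real ^ 'a. \<Prod>i\<in>UNIV. (x $ i) ^ \<alpha> i) has_derivative
      (\<lambda>v. \<Sum>i\<in>UNIV. (real (\<alpha> i) * v $ i * (x $ i) ^ (\<alpha> i - 1)) * (\<Prod>j\<in>UNIV - {i}. (x $ j) ^ \<alpha> j))) (at x)"
    by (intro has_derivative_prod) auto
  moreover have "(\<Sum>i\<in>UNIV. (real (\<alpha> i) * v $ i * (x $ i) ^ (\<alpha> i - 1)) * (\<Prod>j\<in>UNIV - {i}. (x $ j) ^ \<alpha> j)) = monom_grad \<alpha> x \<bullet> v" for v
    unfolding inner_vec_def monom_grad_nth
  proof (intro sum.cong refl)
    fix i
    have "(\<Prod>j\<in>UNIV - {i}. (x $ j) ^ lower \<alpha> i j) = (\<Prod>j\<in>UNIV - {i}. (x $ j) ^ \<alpha> j)"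
      by (intro prod.cong) (auto simp: lower_def)
    then have "monom_fun (lower \<alpha> i) x = (x $ i) ^ (\<alpha> i - 1) * (\<Prod>j\<in>UNIV - {i}. (x $ j) ^ \<alpha> j)"
      unfolding monom_fun_split[of "lower \<alpha> i" x i] by (simp add: lower_def)
    then show "(real (\<alpha> i) * v $ i * (x $ i) ^ (\<alpha> i - 1)) * (\<Prod>j\<in>UNIV - {i}. (x $ j) ^ \<alpha> j) = (real (\<alpha> i) * monom_fun (lower \<alpha> i) x) \<bullet> (v $ i)"
      by simp
  qed
  ultimately show ?thesis by (simp add: monom_fun_def[abs_def])
qed

lemma monom_grad_deriv:
  "(monom_grad \<alpha> has_derivative
     (\<lambda>v. \<Sum>i\<in>UNIV. (real (\<alpha> i) * (monom_grad (lower \<alpha> i) x \<bullet> v)) *\<^sub>R axis i 1)) (at x)"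
  by (subst monom_grad_def[abs_def])
    (intro has_derivative_sum has_derivative_scaleR_left has_derivative_mult_right monom_fun_deriv)

lemma Ck_on_monom_fun: "Ck_on k UNIV (monom_fun \<alpha>)"
proof (induction k arbitrary: \<alpha>)
  case 0
  show ?case by (simp add: continuous_on_monom_fun)
next
  case (Suc k)
  show ?case
  proof (rule Ck_on_SucI[OF open_UNIV monom_fun_deriv])
    show "Ck_on k UNIV (\<lambda>x. monom_grad \<alpha> x \<bullet> v)" for v
      unfolding inner_vec_def monom_grad_nth inner_real_def
      by (intro Ck_on_sum Ck_on_mult Ck_on_const Suc.IH open_UNIV)
  qed
qed

lemma Ck_on_monom_grad: "Ck_on k UNIV (monom_grad \<alpha>)"
  unfolding monom_grad_def[abs_def]
  by (intro Ck_on_sum Ck_on_scaleR Ck_on_mult Ck_on_const Ck_on_monom_fun open_UNIV)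

lemma monom_grad_euler: "monom_grad \<alpha> x \<bullet> x = real (tdeg \<alpha>) * monom_fun \<alpha> x"
proof -
  have "(real (\<alpha> i) * monom_fun (lower \<alpha> i) x) * x $ i = real (\<alpha> i) * monom_fun \<alpha> x" for i
  proof (cases "\<alpha> i")
    case (Suc k)
    have "(\<Prod>j\<in>UNIV - {i}. (x $ j) ^ lower \<alpha> i j) = (\<Prod>j\<in>UNIV - {i}. (x $ j) ^ \<alpha> j)"
      by (intro prod.cong) (auto simp: lower_def)
    then show ?thesis
      unfolding monom_fun_split[of "lower \<alpha> i" x i] monom_fun_split[of \<alpha> x i] by (simp add: Suc lower_def)
  qed simp
  then show ?thesis
    unfolding inner_vec_def monom_grad_nth inner_real_def of_nat_sum sum_distrib_right
    by (intro sum.cong refl)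
qed

lemma tdeg_lower: "\<alpha> i \<noteq> 0 \<Longrightarrow> Suc (tdeg (lower \<alpha> i)) = tdeg \<alpha>"
proof -
  assume "\<alpha> i \<noteq> 0"
  have "(\<Sum>j\<in>UNIV - {i}. lower \<alpha> i j) = (\<Sum>j\<in>UNIV - {i}. \<alpha> j)"
    by (intro sum.cong) (auto simp: lower_def)
  then show ?thesis using \<open>\<alpha> i \<noteq> 0\<close>
    by (simp add: sum.remove[of UNIV i] lower_def)
qed

text \<open>
  Euler's identity for the gradient, which is homogeneous of one degree less.
\<close>

lemma monom_hess_euler:
  "(\<Sum>i\<in>UNIV. (real (\<alpha> i) * (monom_grad (lower \<alpha> i) x \<bullet> x)) *\<^sub>R axis i 1) = (real (tdeg \<alpha>) - 1) *\<^sub>R monom_grad \<alpha> x"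
  unfolding monom_grad_def[of \<alpha>] scaleR_sum_right
proof (intro sum.cong refl)
  fix i
  have "real (\<alpha> i) * (monom_grad (lower \<alpha> i) x \<bullet> x) = (real (tdeg \<alpha>) - 1) * (real (\<alpha> i) * monom_fun (lower \<alpha> i) x)"
  proof (cases "\<alpha> i = 0")
    case False
    then show ?thesis using tdeg_lower[of \<alpha> i] by (simp add: monom_grad_euler flip: tdeg_lower[of \<alpha> i])
  qed simp
  then show "(real (\<alpha> i) * (monom_grad (lower \<alpha> i) x \<bullet> x)) *\<^sub>R axis i 1 =
      (real (tdeg \<alpha>) - 1) *\<^sub>R (real (\<alpha> i) * monom_fun (lower \<alpha> i) x) *\<^sub>R (axis i 1 :: real ^ 'a)"
    by simp
qed

lemma sum_Basis_cart:
  fixes f :: "real ^ 'n::finite \<Rightarrow> 'b::comm_monoid_add"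
  shows "(\<Sum>b\<in>Basis. f b) = (\<Sum>i\<in>UNIV. f (axis i 1))"
proof -
  have B: "Basis = range (\<lambda>i. axis i (1::real) :: real ^ 'n)" by (auto simp: Basis_vec_def)
  have "inj (\<lambda>i. axis i (1::real) :: real ^ 'n)" by (auto simp: inj_on_def axis_eq_axis)
  then show ?thesis unfolding B by (simp add: sum.reindex)
qed

definition tr :: "(real ^ 'n::finite \<Rightarrow> real ^ 'n) \<Rightarrow> real" where
  "tr L = (\<Sum>b\<in>Basis. L b \<bullet> b)"

lemma tr_add: "tr (\<lambda>v. L v + M v) = tr L + tr M"
  by (simp add: tr_def inner_add_left sum.distrib)

lemma tr_diff: "tr (\<lambda>v. L v - M v) = tr L - tr M"
  by (simp add: tr_def inner_diff_left sum_subtractf)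

lemma tr_scale: "tr (\<lambda>v. c *\<^sub>R L v) = c * tr L"
  by (simp add: tr_def sum_distrib_left)

lemma tr_rank_one:
  assumes "linear f"
  shows "tr (\<lambda>v. f v *\<^sub>R u) = f u"
  using linear_as_basis_sum[OF assms, of u] by (simp add: tr_def mult.commute)

lemma tr_id: "tr (\<lambda>v. v :: real ^ 'n::finite) = real CARD('n)"
  by (simp add: tr_def inner_Basis sum_Basis_cart inner_axis_axis)

lemma tr_monom_hess:
  "tr (\<lambda>v. \<Sum>i\<in>UNIV. (real (\<alpha> i) * (monom_grad (lower \<alpha> i) x \<bullet> v)) *\<^sub>R axis i 1) = monom_lap \<alpha> x"
proof -
  have "tr (\<lambda>v. \<Sum>i\<in>UNIV. (real (\<alpha> i) * (monom_grad (lower \<alpha> i) x \<bullet> v)) *\<^sub>R axis i 1)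
      = (\<Sum>i\<in>UNIV. tr (\<lambda>v. (real (\<alpha> i) * (monom_grad (lower \<alpha> i) x \<bullet> v)) *\<^sub>R axis i 1))"
    unfolding tr_def by (subst sum.swap) (simp add: inner_sum_left)
  also have "\<dots> = (\<Sum>i\<in>UNIV. real (\<alpha> i) * (monom_grad (lower \<alpha> i) x \<bullet> axis i 1))"
    by (intro sum.cong refl tr_rank_one bounded_linear.linear bounded_linear_compose[OF bounded_linear_mult_right] bounded_linear_inner_right)
  also have "\<dots> = monom_lap \<alpha> x"
    unfolding monom_lap_def inner_axis monom_grad_nth by (intro sum.cong) (auto simp: lower_def mult_ac)
  finally show ?thesis .
qed

section \<open>Gradient and spherical Laplacian of a product\<close>

text \<open>
  The real gradient of \<open>Re f\<close> for a holomorphic function \<open>f\<close> of the plane coordinate is the conjugate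
  of \<open>f'\<close>, regarded as a vector in the plane of the coordinates \<open>p\<close> and \<open>q\<close>.
\<close>

definition conj_embed :: "'n::finite \<Rightarrow> 'n \<Rightarrow> complex \<Rightarrow> real ^ 'n" where
  "conj_embed p q c = Re c *\<^sub>R axis p 1 - Im c *\<^sub>R axis q 1"

lemma bounded_linear_conj_embed: "bounded_linear (conj_embed p q)"
  unfolding conj_embed_def[abs_def]
  by (intro bounded_linear_sub bounded_linear_compose[OF bounded_linear_scaleR_left] bounded_linear_Re bounded_linear_Im)

lemma conj_embed_inner: "conj_embed p q c \<bullet> v = Re (c * plane_part p q v)"
  by (simp add: conj_embed_def plane_part_def inner_diff_left inner_axis' mult_ac)

text \<open>
  The real part of a holomorphic function is harmonic.
\<close>

lemma tr_conj_embed: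
  assumes "p \<noteq> q"
  shows "tr (\<lambda>v. conj_embed p q (c * plane_part p q v)) = 0"
proof -
  have "tr (\<lambda>v. conj_embed p q (c * plane_part p q v)) = Re (c * (\<Sum>i\<in>UNIV. (plane_part p q (axis i 1))\<^sup>2))"
    by (simp add: tr_def conj_embed_inner sum_Basis_cart sum_distrib_left mult.assoc power2_eq_square)
  also have "(\<Sum>i\<in>UNIV. (plane_part p q (axis i 1))\<^sup>2) = (\<Sum>i\<in>{p, q}. (plane_part p q (axis i 1))\<^sup>2)"
    by (rule sum.mono_neutral_right) (auto simp: plane_part_def axis_def complex_eq_iff)
  also have "\<dots> = 0" using assms by (simp add: plane_part_def axis_def complex_eq_iff power2_eq_square)
  finally show ?thesis by simp
qed

lemma plane_part_self: "plane_part p q x = (slit_root p q x)\<^sup>2"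
  by (simp add: plane_part_def slit_root_square)

lemma powi_times_plane:
  assumes x: "x \<in> slit_dom p q"
  shows "slit_root p q x powi (m - 2) * plane_part p q x = slit_root p q x powi m"
  using power_int_add[of "slit_root p q x" "m - 2" 2] slit_dom_root_nonzero[OF x]
  by (simp add: plane_part_self)

lemma sphere_div_eq:
  assumes "(X has_derivative X') (at x)"
  shows "sphere_div X x = tr X' - X' x \<bullet> x"
  using frechet_derivative_at[OF assms] by (simp add: sphere_div_def tr_def)

lemma cnj_powi_quotient:
  assumes w: "w \<noteq> 0" and "j \<noteq> 0"
  shows "cnj (of_nat j / 2 * w powi (int j - 2)) / (2 * w) =
    of_real (real j / 4 * (inverse (cmod w))\<^sup>2) * cnj (w ^ (j - 1))"
proof -
  define V where "V = w ^ (j - 1)"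
  define a where "a = complex_of_nat j"
  have "int j - 2 = int (j - 1) + - 1" using assms by simp
  then have e: "w powi (int j - 2) = V * inverse w"
    using w unfolding V_def by (simp only: power_int_add power_int_of_nat power_int_minus power_int_1_right simp_thms)
  have n: "of_real ((cmod w)\<^sup>2) = w * cnj w" by (rule complex_norm_square)
  have n': "complex_of_real ((inverse (cmod w))\<^sup>2) = inverse w * inverse (cnj w)"
    unfolding power_inverse of_real_inverse n by (rule inverse_mult_distrib)
  have "cnj (a / 2 * (V * inverse w)) = a / 2 * (cnj V * inverse (cnj w))"
    by (simp add: a_def)
  then have "cnj (a / 2 * (V * inverse w)) / (2 * w) = a / 2 * (cnj V * inverse (cnj w)) * inverse (2 * w)"
    by (simp only: divide_inverse)
  also have "\<dots> = a / 4 * (inverse w * inverse (cnj w)) * cnj V"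
    by (simp add: inverse_mult_distrib)
  also have "a / 4 = of_real (real j / 4)" by (simp add: a_def)
  finally show ?thesis unfolding e V_def[symmetric] a_def[symmetric] of_real_mult n' .
qed

lemma abs_Im_of_real_mult_cnj: "0 \<le> r \<Longrightarrow> \<bar>Im (of_real r * cnj z)\<bar> = r * \<bar>Im z\<bar>"
  by (simp add: abs_mult)

lemma Im_power_le:
  fixes w :: complex
  assumes "cmod w \<le> 1"
  shows "\<bar>Im (w ^ m)\<bar> \<le> real m * \<bar>Im w\<bar>"
proof (induction m)
  case (Suc m)
  have "\<bar>Im (w ^ Suc m)\<bar> = \<bar>Re w * Im (w ^ m) + Im w * Re (w ^ m)\<bar>" by simp
  also have "\<dots> \<le> \<bar>Re w\<bar> * \<bar>Im (w ^ m)\<bar> + \<bar>Im w\<bar> * \<bar>Re (w ^ m)\<bar>"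
    unfolding abs_mult[symmetric] by (rule abs_triangle_ineq)
  also have "\<dots> \<le> 1 * (real m * \<bar>Im w\<bar>) + \<bar>Im w\<bar> * 1"
  proof (intro add_mono mult_mono Suc)
    show "\<bar>Re w\<bar> \<le> 1" using abs_Re_le_cmod[of w] assms by linarith
    have "cmod (w ^ m) \<le> 1" using assms by (simp add: norm_power power_le_one)
    then show "\<bar>Re (w ^ m)\<bar> \<le> 1" using abs_Re_le_cmod[of "w ^ m"] by linarith
  qed auto
  finally show ?case by (simp add: algebra_simps)
qed simp

text \<open>
  The degree of homogeneity of \<open>Re (w\<^sup>j) x\<^sup>\<alpha>\<close>: \<open>w\<close> is homogeneous of degree one half.
\<close>

definition slit_degree :: "nat \<Rightarrow> ('n::finite \<Rightarrow> nat) \<Rightarrow> real" where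
  "slit_degree j \<alpha> = real j / 2 + real (tdeg \<alpha>)"

lemma slit_degree_nonneg: "0 \<le> slit_degree j \<alpha>"
  unfolding slit_degree_def by (intro add_nonneg_nonneg divide_nonneg_nonneg of_nat_0_le_iff) simp

definition slit_grad :: "'n::finite \<Rightarrow> 'n \<Rightarrow> nat \<Rightarrow> ('n \<Rightarrow> nat) \<Rightarrow> real ^ 'n \<Rightarrow> real ^ 'n" where
  "slit_grad p q j \<alpha> x = monom_fun \<alpha> x *\<^sub>R conj_embed p q (of_nat j / 2 * slit_root p q x powi (int j - 2)) +
     Re (slit_root p q x powi int j) *\<^sub>R monom_grad \<alpha> x"

definition slit_hess :: "'n::finite \<Rightarrow> 'n \<Rightarrow> nat \<Rightarrow> ('n \<Rightarrow> nat) \<Rightarrow> real ^ 'n \<Rightarrow> real ^ 'n \<Rightarrow> real ^ 'n" where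
  "slit_hess p q j \<alpha> x v =
     monom_fun \<alpha> x *\<^sub>R conj_embed p q (of_nat j / 2 * (of_int (int j - 2) / 2 * slit_root p q x powi (int j - 2 - 2)) * plane_part p q v) +
     (monom_grad \<alpha> x \<bullet> v) *\<^sub>R conj_embed p q (of_nat j / 2 * slit_root p q x powi (int j - 2)) +
     (Re (slit_root p q x powi int j) *\<^sub>R
        (\<Sum>i\<in>UNIV. (real (\<alpha> i) * (monom_grad (lower \<alpha> i) x \<bullet> v)) *\<^sub>R axis i 1) +
      Re (of_nat j / 2 * slit_root p q x powi (int j - 2) * plane_part p q v) *\<^sub>R monom_grad \<alpha> x)"

text \<open>
  On the sphere this is the tangential gradient, because the radial derivative of a homogeneous
  function is its degree times the function.
\<close>

definition slit_tgrad :: "'n::finite \<Rightarrow> 'n \<Rightarrow> nat \<Rightarrow> ('n \<Rightarrow> nat) \<Rightarrow> real ^ 'n \<Rightarrow> real ^ 'n" where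
  "slit_tgrad p q j \<alpha> x = slit_grad p q j \<alpha> x - (slit_degree j \<alpha> * slit_poly p q j \<alpha> x) *\<^sub>R x"

text \<open>
  On the sphere this is minus the spherical Laplacian of the product: the Laplacian in \<open>\<real>\<^sup>N\<close> acts on the
  monomial only, as \<open>Re (w\<^sup>j)\<close> is harmonic.
\<close>

definition slit_lap :: "'n::finite \<Rightarrow> 'n \<Rightarrow> nat \<Rightarrow> ('n \<Rightarrow> nat) \<Rightarrow> real ^ 'n \<Rightarrow> real" where
  "slit_lap p q j \<alpha> x = slit_degree j \<alpha> * (slit_degree j \<alpha> + real CARD('n) - 2) * slit_poly p q j \<alpha> x
     - Re (slit_root p q x ^ j) * monom_lap \<alpha> x"

text \<open>
  The tangential gradient, set to zero on the slit half-hyperplane so that it is Borel measurable.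
\<close>

definition slit_tgrad0 :: "'n::finite \<Rightarrow> 'n \<Rightarrow> nat \<Rightarrow> ('n \<Rightarrow> nat) \<Rightarrow> real ^ 'n \<Rightarrow> real ^ 'n" where
  "slit_tgrad0 p q j \<alpha> x = indicator (slit_dom p q) x *\<^sub>R slit_tgrad p q j \<alpha> x"

context
  fixes p q :: "'n::finite" and j :: nat and \<alpha> :: "'n \<Rightarrow> nat"
  assumes pq: "p \<noteq> q" and \<alpha>: "\<alpha> \<in> exponents p q"
begin

lemma slit_poly_deriv:
  assumes x: "x \<in> slit_dom p q"
  shows "(slit_poly p q j \<alpha> has_derivative (\<lambda>v. slit_grad p q j \<alpha> x \<bullet> v)) (at x)"
proof -
  have "((\<lambda>x. Re (slit_root p q x powi int j)) has_derivative
     (\<lambda>v. Re (of_int (int j) / 2 * slit_root p q x powi (int j - 2) * plane_part p q v))) (at x)"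
    by (rule bounded_linear.has_derivative[OF bounded_linear_Re slit_root_powi_deriv[OF x]])
  from has_derivative_mult[OF this monom_fun_deriv]
  have "((\<lambda>x. Re (slit_root p q x powi int j) * monom_fun \<alpha> x) has_derivative
     (\<lambda>v. Re (slit_root p q x powi int j) * (monom_grad \<alpha> x \<bullet> v) +
        Re (of_int (int j) / 2 * slit_root p q x powi (int j - 2) * plane_part p q v) * monom_fun \<alpha> x)) (at x)" .
  moreover have "(\<lambda>v. Re (slit_root p q x powi int j) * (monom_grad \<alpha> x \<bullet> v) +
        Re (of_int (int j) / 2 * slit_root p q x powi (int j - 2) * plane_part p q v) * monom_fun \<alpha> x) = (\<lambda>v. slit_grad p q j \<alpha> x \<bullet> v)"
    by (rule ext, simp only: slit_grad_def inner_add_left inner_scaleR_left conj_embed_inner of_int_of_nat_eq)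
      (simp only: add.commute mult.commute)
  ultimately show ?thesis by (simp add: slit_poly_def[abs_def])
qed

lemma slit_grad_deriv:
  assumes x: "x \<in> slit_dom p q"
  shows "(slit_grad p q j \<alpha> has_derivative slit_hess p q j \<alpha> x) (at x)"
proof -
  have "((\<lambda>x. Re (slit_root p q x powi int j)) has_derivative
     (\<lambda>v. Re (of_int (int j) / 2 * slit_root p q x powi (int j - 2) * plane_part p q v))) (at x)"
    by (rule bounded_linear.has_derivative[OF bounded_linear_Re slit_root_powi_deriv[OF x]])
  from has_derivative_scaleR[OF this monom_grad_deriv[of \<alpha>]]
  have 1: "((\<lambda>x. Re (slit_root p q x powi int j) *\<^sub>R monom_grad \<alpha> x) has_derivative
     (\<lambda>v. Re (slit_root p q x powi int j) *\<^sub>R (\<Sum>i\<in>UNIV. (real (\<alpha> i) * (monom_grad (lower \<alpha> i) x \<bullet> v)) *\<^sub>R axis i 1) +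
        Re (of_nat j / 2 * slit_root p q x powi (int j - 2) * plane_part p q v) *\<^sub>R monom_grad \<alpha> x)) (at x)"
    by simp
  have "((\<lambda>x. conj_embed p q (of_nat j / 2 * slit_root p q x powi (int j - 2))) has_derivative
     (\<lambda>v. conj_embed p q (of_nat j / 2 * (of_int (int j - 2) / 2 * slit_root p q x powi (int j - 2 - 2) * plane_part p q v)))) (at x)"
    by (rule bounded_linear.has_derivative[OF bounded_linear_conj_embed has_derivative_mult_right[OF slit_root_powi_deriv[OF x]]])
  from has_derivative_add[OF has_derivative_scaleR[OF monom_fun_deriv[of \<alpha>] this] 1]
  show ?thesis unfolding slit_grad_def[abs_def] slit_hess_def[abs_def] by (simp only: mult.assoc)
qed

lemma monom_grad_plane: "monom_grad \<alpha> x $ p = 0" "monom_grad \<alpha> x $ q = 0"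
  using \<alpha> by (simp_all add: monom_grad_nth exponents_def)

lemma slit_grad_euler:
  assumes x: "x \<in> slit_dom p q"
  shows "slit_grad p q j \<alpha> x \<bullet> x = slit_degree j \<alpha> * slit_poly p q j \<alpha> x"
proof -
  have "of_nat j / 2 * slit_root p q x powi (int j - 2) * plane_part p q x = of_nat j / 2 * slit_root p q x powi int j"
    using powi_times_plane[OF x, of "int j"] by simp
  then show ?thesis
    by (simp only: slit_grad_def inner_add_left inner_scaleR_left conj_embed_inner monom_grad_euler)
      (simp add: slit_degree_def slit_poly_def algebra_simps)
qed

lemma slit_hess_euler:
  assumes x: "x \<in> slit_dom p q"
  shows "slit_hess p q j \<alpha> x x = (slit_degree j \<alpha> - 1) *\<^sub>R slit_grad p q j \<alpha> x"
proof -
  have 1: "of_nat j / 2 * (of_int (int j - 2) / 2 * slit_root p q x powi (int j - 2 - 2)) * plane_part p q x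
    = of_real (real_of_int (int j - 2) / 2) * (of_nat j / 2 * slit_root p q x powi (int j - 2))"
    using powi_times_plane[OF x, of "int j - 2"] by (simp add: mult_ac)
  have 2: "of_nat j / 2 * slit_root p q x powi (int j - 2) * plane_part p q x = of_real (real j / 2) * slit_root p q x powi int j"
    using powi_times_plane[OF x, of "int j"] by simp
  have 3: "conj_embed p q (of_real r * c) = r *\<^sub>R conj_embed p q c" for r c
    by (simp add: conj_embed_def algebra_simps)
  have 4: "Re (of_real r * c) = r * Re c" for r c by simp
  show ?thesis
    unfolding slit_hess_def 1 2 3 4 monom_hess_euler
    unfolding monom_grad_euler slit_grad_def slit_degree_def
    by (simp add: algebra_simps add_divide_distrib diff_divide_distrib)
qed

text \<open>
  The mixed terms vanish since the gradients of the two factors are orthogonal.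
\<close>

lemma tr_slit_hess: "tr (slit_hess p q j \<alpha> x) = Re (slit_root p q x ^ j) * monom_lap \<alpha> x"
proof -
  let ?c = "of_nat j / 2 * slit_root p q x powi (int j - 2)"
  have l1: "linear (\<lambda>v. monom_grad \<alpha> x \<bullet> v)"
    by (intro bounded_linear.linear bounded_linear_inner_right)
  have l2: "linear (\<lambda>v. Re (?c * plane_part p q v))"
    by (intro bounded_linear.linear bounded_linear_compose[OF bounded_linear_Re] bounded_linear_compose[OF bounded_linear_mult_right] bounded_linear_plane_part)
  have z: "plane_part p q (monom_grad \<alpha> x) = 0"
    by (simp add: plane_part_def monom_grad_plane complex_eq_iff)
  have "monom_grad \<alpha> x \<bullet> conj_embed p q ?c = 0"
    by (simp only: inner_commute[of "monom_grad \<alpha> x"] conj_embed_inner z) simp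
  then show ?thesis
    unfolding slit_hess_def[abs_def] tr_add tr_scale tr_conj_embed[OF pq] tr_rank_one[OF l1] tr_rank_one[OF l2] tr_monom_hess z
    by simp
qed

lemma Ck_on_slit_poly: "Ck_on k (slit_dom p q) (slit_poly p q j \<alpha>)"
proof -
  have "Ck_on k (slit_dom p q) (\<lambda>x. Re (slit_root p q x powi int j) * monom_fun \<alpha> x)"
    by (intro Ck_on_mult Ck_on_linear[OF bounded_linear_Re] Ck_on_slit_root_powi open_slit_dom
        Ck_on_subset[OF Ck_on_monom_fun]) auto
  then show ?thesis by (simp add: slit_poly_def[abs_def])
qed

lemma Ck_on_slit_grad: "Ck_on k (slit_dom p q) (slit_grad p q j \<alpha>)"
  unfolding slit_grad_def[abs_def]
  by (intro Ck_on_add Ck_on_scaleR Ck_on_mult Ck_on_const Ck_on_linear[OF bounded_linear_Re]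
      Ck_on_linear[OF bounded_linear_conj_embed] Ck_on_slit_root_powi open_slit_dom
      Ck_on_subset[OF Ck_on_monom_fun] Ck_on_subset[OF Ck_on_monom_grad] subset_UNIV)

lemma slit_tgrad_tangential:
  assumes "x \<in> slit_dom p q" "norm x = 1"
  shows "slit_tgrad p q j \<alpha> x \<bullet> x = 0"
  using assms by (simp add: slit_tgrad_def inner_diff_left slit_grad_euler dot_square_norm)

text \<open>
  Taking \<open>\<eta> = 1\<close> identifies \<open>slit_lap\<close>. The trace of the Hessian is the Laplacian in \<open>\<real>\<^sup>N\<close>, and
  Euler's identities for the function and for its gradient turn the radial terms into multiples of
  the function.
\<close>

lemma sphere_div_scaled_tgrad:
  assumes x: "x \<in> slit_dom p q" "norm x = 1" and e: "(\<eta> has_derivative \<eta>') (at x)"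
  shows "sphere_div (\<lambda>x. \<eta> x *\<^sub>R slit_tgrad p q j \<alpha> x) x = \<eta>' (slit_tgrad p q j \<alpha> x) - \<eta> x * slit_lap p q j \<alpha> x"
proof -
  let ?u = "slit_poly p q j \<alpha> x" and ?l = "slit_degree j \<alpha>"
  define T where "T v = slit_hess p q j \<alpha> x v - ((?l * ?u) *\<^sub>R v + (?l * (slit_grad p q j \<alpha> x \<bullet> v)) *\<^sub>R x)" for v
  have "(slit_tgrad p q j \<alpha> has_derivative T) (at x)"
    unfolding slit_tgrad_def[abs_def] T_def[abs_def]
    by (intro has_derivative_diff slit_grad_deriv has_derivative_scaleR has_derivative_mult_right slit_poly_deriv x has_derivative_ident)
  from has_derivative_scaleR[OF e this]
  have d: "((\<lambda>x. \<eta> x *\<^sub>R slit_tgrad p q j \<alpha> x) has_derivative (\<lambda>v. \<eta> x *\<^sub>R T v + \<eta>' v *\<^sub>R slit_tgrad p q j \<alpha> x)) (at x)" .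
  have l1: "linear (\<lambda>v. ?l * (slit_grad p q j \<alpha> x \<bullet> v))"
    by (intro bounded_linear.linear bounded_linear_compose[OF bounded_linear_mult_right] bounded_linear_inner_right)
  have xx: "x \<bullet> x = 1" using x by (simp add: dot_square_norm)
  have "tr T = tr (slit_hess p q j \<alpha> x) - (?l * ?u * real CARD('n) + ?l * (slit_grad p q j \<alpha> x \<bullet> x))"
    unfolding T_def[abs_def] tr_diff tr_add tr_scale tr_rank_one[OF l1] tr_id by simp
  moreover have "T x \<bullet> x = (?l - 1) * (slit_grad p q j \<alpha> x \<bullet> x) - (?l * ?u + ?l * (slit_grad p q j \<alpha> x \<bullet> x))"
    by (simp add: T_def slit_hess_euler[OF x(1)] inner_diff_left inner_add_left xx)
  ultimately have T: "tr T - T x \<bullet> x = - slit_lap p q j \<alpha> x"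
    unfolding tr_slit_hess slit_grad_euler[OF x(1)] slit_lap_def by (simp add: algebra_simps)
  have "sphere_div (\<lambda>x. \<eta> x *\<^sub>R slit_tgrad p q j \<alpha> x) x
     = (\<eta> x * tr T + \<eta>' (slit_tgrad p q j \<alpha> x)) - (\<eta> x * (T x \<bullet> x) + \<eta>' x * (slit_tgrad p q j \<alpha> x \<bullet> x))"
    unfolding sphere_div_eq[OF d] tr_add tr_scale tr_rank_one[OF has_derivative_linear[OF e]]
    by (simp add: inner_add_left)
  also have "\<dots> = \<eta>' (slit_tgrad p q j \<alpha> x) + \<eta> x * (tr T - T x \<bullet> x)"
    by (simp add: slit_tgrad_tangential[OF x] algebra_simps)
  finally show ?thesis by (simp add: T)
qed

lemma norm_slit_root_le_1_sphere: "norm x = 1 \<Longrightarrow> cmod (slit_root p q x) \<le> 1"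
  using norm_slit_root_le_1[of x p q] pq by simp

lemma inverse_root_ge_1:
  assumes "x \<in> slit_dom p q" "norm x = 1"
  shows "1 \<le> inverse (cmod (slit_root p q x))"
  using norm_slit_root_le_1_sphere[OF assms(2)] slit_dom_root_nonzero[OF assms(1)]
  by (simp add: field_simps)

lemma norm_monom_grad_le:
  assumes "norm x = 1"
  shows "norm (monom_grad \<alpha> x) \<le> real (tdeg \<alpha>)"
proof -
  have "norm (monom_grad \<alpha> x) \<le> (\<Sum>i\<in>UNIV. norm ((real (\<alpha> i) * monom_fun (lower \<alpha> i) x) *\<^sub>R axis i (1::real)))"
    unfolding monom_grad_def by (rule norm_sum)
  also have "\<dots> \<le> (\<Sum>i\<in>UNIV. real (\<alpha> i))"
  proof (rule sum_mono)
    fix i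
    have "real (\<alpha> i) * \<bar>monom_fun (lower \<alpha> i) x\<bar> \<le> real (\<alpha> i) * 1"
      using monom_fun_le_1[of x "lower \<alpha> i"] assms by (intro mult_left_mono) auto
    then show "norm ((real (\<alpha> i) * monom_fun (lower \<alpha> i) x) *\<^sub>R axis i (1::real)) \<le> real (\<alpha> i)"
      by (simp add: norm_axis_1 abs_mult)
  qed
  finally show ?thesis by simp
qed

text \<open>
  The gradient of \<open>Re (w\<^sup>j)\<close> has size \<open>j |w|\<^sup>j\<^sup>-\<^sup>2 / 2\<close>, which is singular at the edge for \<open>j = 1\<close>.
\<close>

lemma slit_tgrad_bound:
  assumes x: "x \<in> slit_dom p q" "norm x = 1"
  shows "norm (slit_tgrad p q j \<alpha> x) \<le> 2 * slit_degree j \<alpha> * inverse (cmod (slit_root p q x))"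
proof -
  let ?w = "slit_root p q x"
  have w: "?w \<noteq> 0" "cmod ?w \<le> 1" using slit_dom_root_nonzero[OF x(1)] norm_slit_root_le_1_sphere[OF x(2)] .
  have emb: "norm (conj_embed p q c) \<le> cmod c" for c
  proof -
    have "(norm (conj_embed p q c))\<^sup>2 = (cmod c)\<^sup>2"
      unfolding power2_norm_eq_inner[of "conj_embed p q c"] conj_embed_inner cmod_power2
      using pq by (simp add: conj_embed_def plane_part_def axis_def power2_eq_square)
    then show ?thesis by (simp add: power2_eq_iff_nonneg)
  qed
  have c: "cmod (of_nat j / 2 * ?w powi (int j - 2)) \<le> real j / 2 * inverse (cmod ?w)"
  proof (cases "j = 0")
    case False
    have "int j - 2 = int (j - 1) + - 1" using False by simp
    then have "?w powi (int j - 2) = ?w ^ (j - 1) * inverse ?w"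
      using w(1) by (simp only: power_int_add power_int_of_nat power_int_minus power_int_1_right simp_thms)
    then have "cmod (?w powi (int j - 2)) = cmod ?w ^ (j - 1) * inverse (cmod ?w)"
      by (simp add: norm_mult norm_power norm_inverse)
    also have "\<dots> \<le> 1 * inverse (cmod ?w)"
      using w by (intro mult_right_mono) (auto simp: power_le_one)
    finally have "real j / 2 * cmod (?w powi (int j - 2)) \<le> real j / 2 * (1 * inverse (cmod ?w))"
      by (intro mult_left_mono) auto
    then show ?thesis by (simp add: norm_mult norm_divide)
  qed simp
  have inv: "1 \<le> inverse (cmod ?w)" by (rule inverse_root_ge_1[OF x])
  have m1: "\<bar>monom_fun \<alpha> x\<bar> \<le> 1" using monom_fun_le_1[of x \<alpha>] x by simp
  have r1: "\<bar>Re (?w powi int j)\<bar> \<le> 1"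
    using order_trans[OF abs_Re_le_cmod[of "?w ^ j"]] w by (simp add: norm_power power_le_one)
  have t0: "0 \<le> real (tdeg \<alpha>)" by (rule of_nat_0_le_iff)
  have l0: "0 \<le> slit_degree j \<alpha>" by (rule slit_degree_nonneg)
  have "norm (slit_grad p q j \<alpha> x) \<le> norm (monom_fun \<alpha> x *\<^sub>R conj_embed p q (of_nat j / 2 * ?w powi (int j - 2))) +
      norm (Re (?w powi int j) *\<^sub>R monom_grad \<alpha> x)"
    unfolding slit_grad_def by (rule norm_triangle_ineq)
  also have "\<dots> \<le> 1 * (real j / 2 * inverse (cmod ?w)) + 1 * (real (tdeg \<alpha>) * 1)"
    unfolding norm_scaleR
    using m1 r1 order_trans[OF emb c] norm_monom_grad_le[OF x(2)]
    by (intro add_mono mult_mono) auto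
  also have "\<dots> \<le> real j / 2 * inverse (cmod ?w) + real (tdeg \<alpha>) * inverse (cmod ?w)"
    using mult_left_mono[OF inv t0] by simp
  also have "\<dots> = slit_degree j \<alpha> * inverse (cmod ?w)" by (simp add: slit_degree_def algebra_simps)
  finally have g: "norm (slit_grad p q j \<alpha> x) \<le> slit_degree j \<alpha> * inverse (cmod ?w)" .
  have "norm ((slit_degree j \<alpha> * slit_poly p q j \<alpha> x) *\<^sub>R x) \<le> slit_degree j \<alpha> * 1"
    using slit_poly_bounded[OF pq, of x j \<alpha>] x l0 by (simp add: abs_mult mult_left_le)
  also have "\<dots> \<le> slit_degree j \<alpha> * inverse (cmod ?w)" by (rule mult_left_mono[OF inv l0])
  finally have "norm ((slit_degree j \<alpha> * slit_poly p q j \<alpha> x) *\<^sub>R x) \<le> slit_degree j \<alpha> * inverse (cmod ?w)" .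
  with g show ?thesis
    unfolding slit_tgrad_def using norm_triangle_ineq4[of "slit_grad p q j \<alpha> x" "(slit_degree j \<alpha> * slit_poly p q j \<alpha> x) *\<^sub>R x"]
    by linarith
qed

text \<open>
  The derivative of \<open>Im w\<close> along the full gradient of the product is \<open>1 / (4 |w|\<^sup>2)\<close> times the
  derivative of the product in the coordinate \<open>Im w\<close>, as the root is conformal. The latter vanishes on
  the slit; this is the Neumann condition, and it yields the factor \<open>slit_height\<close>. Subtracting the
  radial part of the gradient adds a multiple of \<open>slit_height\<close>.
\<close>

lemma height_derivative_tgrad_bound:
  assumes x: "x \<in> slit_dom p q" "norm x = 1"
  shows "\<bar>Im (plane_part p q (slit_tgrad p q j \<alpha> x) / (2 * slit_root p q x))\<bar>
     \<le> ((real j)\<^sup>2 + slit_degree j \<alpha>) * slit_height p q x * (inverse (cmod (slit_root p q x)))\<^sup>2"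
proof -
  let ?w = "slit_root p q x"
  have w: "?w \<noteq> 0" "cmod ?w \<le> 1" using slit_dom_root_nonzero[OF x(1)] norm_slit_root_le_1_sphere[OF x(2)] .
  have inv: "1 \<le> (inverse (cmod ?w))\<^sup>2" using inverse_root_ge_1[OF x] by (simp add: one_le_power)
  have b: "0 \<le> slit_height p q x" by (rule slit_height_nonneg)
  have l0: "0 \<le> slit_degree j \<alpha>" by (rule slit_degree_nonneg)
  let ?c = "of_nat j / 2 * ?w powi (int j - 2)"
  have lin: "linear (plane_part p q)" by (rule bounded_linear.linear[OF bounded_linear_plane_part])
  have pe: "plane_part p q (conj_embed p q c) = cnj c" for c
    using pq by (simp add: plane_part_def conj_embed_def axis_def complex_eq_iff)
  have pm: "plane_part p q (monom_grad \<alpha> x) = 0"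
    by (simp add: plane_part_def monom_grad_plane complex_eq_iff)
  have "plane_part p q (slit_tgrad p q j \<alpha> x) = monom_fun \<alpha> x *\<^sub>R cnj ?c - (slit_degree j \<alpha> * slit_poly p q j \<alpha> x) *\<^sub>R ?w\<^sup>2"
    unfolding slit_tgrad_def slit_grad_def linear_diff[OF lin] linear_add[OF lin] linear_scale[OF lin] pe pm plane_part_self[of p q x]
    by simp
  then have "plane_part p q (slit_tgrad p q j \<alpha> x) / (2 * ?w) = monom_fun \<alpha> x *\<^sub>R (cnj ?c / (2 * ?w)) - (slit_degree j \<alpha> * slit_poly p q j \<alpha> x) *\<^sub>R (?w / 2)"
    using w by (simp add: scaleR_conv_of_real diff_divide_distrib power2_eq_square)
  then have eq: "Im (plane_part p q (slit_tgrad p q j \<alpha> x) / (2 * ?w)) =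
      monom_fun \<alpha> x * Im (cnj ?c / (2 * ?w)) - (slit_degree j \<alpha> * slit_poly p q j \<alpha> x) * (slit_height p q x / 2)"
    by (simp add: slit_height_def)
  have 1: "\<bar>Im (cnj ?c / (2 * ?w))\<bar> \<le> (real j)\<^sup>2 * slit_height p q x * (inverse (cmod ?w))\<^sup>2"
  proof (cases "j = 0")
    case False
    then have "cnj ?c / (2 * ?w) = of_real (real j / 4 * (inverse (cmod ?w))\<^sup>2) * cnj (?w ^ (j - 1))"
      by (rule cnj_powi_quotient[OF w(1)])
    moreover have coef_nonneg: "0 \<le> real j / 4 * (inverse (cmod ?w))\<^sup>2" by simp
    ultimately have "\<bar>Im (cnj ?c / (2 * ?w))\<bar> = real j / 4 * (inverse (cmod ?w))\<^sup>2 * \<bar>Im (?w ^ (j - 1))\<bar>"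
      by (simp only: abs_Im_of_real_mult_cnj[OF coef_nonneg])
    also have "\<dots> \<le> real j / 4 * (inverse (cmod ?w))\<^sup>2 * (real (j - 1) * slit_height p q x)"
      using Im_power_le[OF w(2), of "j - 1"] b by (intro mult_left_mono) (auto simp: slit_height_def)
    also have "\<dots> = (real j / 4 * real (j - 1)) * (slit_height p q x * (inverse (cmod ?w))\<^sup>2)"
      by (simp only: mult_ac)
    also have "\<dots> \<le> (real j)\<^sup>2 * (slit_height p q x * (inverse (cmod ?w))\<^sup>2)"
    proof (rule mult_right_mono)
      have "real j / 4 * real (j - 1) \<le> real j * real j" by (intro mult_mono) auto
      then show "real j / 4 * real (j - 1) \<le> (real j)\<^sup>2" by (simp add: power2_eq_square)
    qed (use b in simp)
    finally show ?thesis by (simp add: mult.assoc)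
  qed simp
  have m1: "\<bar>monom_fun \<alpha> x\<bar> \<le> 1" using monom_fun_le_1[of x \<alpha>] x by simp
  have u1: "\<bar>slit_poly p q j \<alpha> x\<bar> \<le> 1" using slit_poly_bounded[OF pq, of x j \<alpha>] x by simp
  have "\<bar>Im (plane_part p q (slit_tgrad p q j \<alpha> x) / (2 * ?w))\<bar>
     \<le> \<bar>monom_fun \<alpha> x\<bar> * \<bar>Im (cnj ?c / (2 * ?w))\<bar> + slit_degree j \<alpha> * \<bar>slit_poly p q j \<alpha> x\<bar> * (slit_height p q x / 2)"
  proof -
    have a: "\<bar>m * A - (l * u) * h\<bar> \<le> \<bar>m\<bar> * \<bar>A\<bar> + l * \<bar>u\<bar> * h" if "0 \<le> l" "0 \<le> h" for m A l u h :: real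
      using abs_triangle_ineq4[of "m * A" "(l * u) * h"] that by (simp add: abs_mult)
    show ?thesis unfolding eq by (rule a[OF l0]) (use b in simp)
  qed
  also have "\<dots> \<le> 1 * ((real j)\<^sup>2 * slit_height p q x * (inverse (cmod ?w))\<^sup>2) + slit_degree j \<alpha> * 1 * (slit_height p q x * (inverse (cmod ?w))\<^sup>2)"
  proof (intro add_mono mult_mono m1 1 u1)
    have "slit_height p q x / 2 \<le> slit_height p q x * 1" using b by simp
    also have "\<dots> \<le> slit_height p q x * (inverse (cmod ?w))\<^sup>2" by (rule mult_left_mono[OF inv b])
    finally show "slit_height p q x / 2 \<le> slit_height p q x * (inverse (cmod ?w))\<^sup>2" .
  qed (use b l0 in auto)
  finally show ?thesis by (simp add: algebra_simps)
qed

end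

section \<open>Integral bounds near the edge of the slit\<close>

text \<open>
  Estimates near the edge of the slit are obtained by covering with countably many boxes.
\<close>

lemma nn_integral_le_boxes:
  fixes p q :: "'n::finite" and f :: "real ^ 'n \<Rightarrow> ennreal" and a b c :: "nat \<Rightarrow> real"
  assumes pq: "p \<noteq> q" and nonneg: "\<And>i. 0 \<le> a i" "\<And>i. 0 \<le> b i" "\<And>i. 0 \<le> c i"
    and cover: "\<And>x. norm x = 1 \<Longrightarrow> f x \<noteq> 0 \<Longrightarrow> \<exists>i. f x \<le> ennreal (c i) \<and> \<bar>x $ p\<bar> \<le> a i \<and> \<bar>x $ q\<bar> \<le> b i"
    and s: "(\<lambda>i. c i * (real CARD('n) * 2 ^ CARD('n) * (a i * b i))) sums s"
  shows "(\<integral>\<^sup>+x. f x \<partial>sphere_measure) \<le> ennreal s"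
proof -
  define A where "A i = {x :: real ^ 'n. \<bar>x $ p\<bar> \<le> a i \<and> \<bar>x $ q\<bar> \<le> b i} \<inter> sphere 0 1" for i
  have "closed {x :: real ^ 'n. \<bar>x $ p\<bar> \<le> a i \<and> \<bar>x $ q\<bar> \<le> b i}" for i
    by (intro closed_Collect_conj closed_Collect_le continuous_intros)
  then have A: "A i \<in> sets sphere_measure" for i
    unfolding A_def by (intro borel_in_sphere_sets borel_closed)
  have "(\<integral>\<^sup>+x. f x \<partial>sphere_measure) \<le> (\<integral>\<^sup>+x. (\<Sum>i. ennreal (c i) * indicator (A i) x) \<partial>sphere_measure)"
  proof (rule nn_integral_mono)
    fix x :: "real ^ 'n" assume "x \<in> space sphere_measure"
    then have x: "norm x = 1" by simp
    show "f x \<le> (\<Sum>i. ennreal (c i) * indicator (A i) x)"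
    proof (cases "f x = 0")
      case False
      then obtain i where i: "f x \<le> ennreal (c i)" "\<bar>x $ p\<bar> \<le> a i" "\<bar>x $ q\<bar> \<le> b i" using cover[OF x] by blast
      then have "f x \<le> (\<Sum>i\<in>{i}. ennreal (c i) * indicator (A i) x)" using x by (simp add: A_def)
      also have "\<dots> \<le> (\<Sum>i. ennreal (c i) * indicator (A i) x)"
        by (rule sum_le_suminf) auto
      finally show ?thesis .
    qed simp
  qed
  also have "\<dots> = (\<Sum>i. \<integral>\<^sup>+x. ennreal (c i) * indicator (A i) x \<partial>sphere_measure)"
    using A by (intro nn_integral_suminf) auto
  also have "\<dots> = (\<Sum>i. ennreal (c i) * emeasure sphere_measure (A i))"
    using A by (simp add: nn_integral_cmult_indicator)
  also have "\<dots> \<le> (\<Sum>i. ennreal (c i * (real CARD('n) * 2 ^ CARD('n) * (a i * b i))))"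
  proof (rule suminf_le)
    fix i
    have "emeasure sphere_measure (A i) \<le> ennreal (real CARD('n) * 2 ^ CARD('n) * (a i * b i))"
      using nonneg by (intro emeasure_sphere_box_le[OF pq _ _ A]) (auto simp: A_def)
    then show "ennreal (c i) * emeasure sphere_measure (A i) \<le> ennreal (c i * (real CARD('n) * 2 ^ CARD('n) * (a i * b i)))"
      using nonneg by (simp add: ennreal_mult' mult_left_mono)
  qed auto
  also have "\<dots> = ennreal s"
    using nonneg s by (intro suminf_ennreal_eq) auto
  finally show ?thesis .
qed

lemma ex_power4_between:
  fixes y :: real assumes "y \<ge> 1" shows "\<exists>i. 4 ^ i \<le> y \<and> y < 4 ^ Suc i"
proof -
  have ex: "\<exists>n. y < 4 ^ n" by (rule real_arch_pow) simp
  define n where "n = (LEAST n. y < 4 ^ n)"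
  have n: "y < 4 ^ n" unfolding n_def by (rule LeastI_ex[OF ex])
  then obtain i where i: "n = Suc i" using assms by (cases n) auto
  have "\<not> y < 4 ^ i" using not_less_Least[of i "\<lambda>n. y < 4 ^ n"] i n_def by auto
  then show ?thesis using n i by (intro exI[of _ i]) auto
qed

lemma abs_plane_le_root:
  "\<bar>x $ p\<bar> \<le> (cmod (slit_root p q x))\<^sup>2" "\<bar>x $ q\<bar> \<le> (cmod (slit_root p q x))\<^sup>2"
  "\<bar>x $ q\<bar> \<le> 2 * cmod (slit_root p q x) * slit_height p q x"
proof -
  let ?w = "slit_root p q x"
  have "?w\<^sup>2 = Complex (x $ p) (x $ q)" by (rule slit_root_square)
  then have e: "x $ p = Re (?w\<^sup>2)" "x $ q = Im (?w\<^sup>2)" by simp_all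
  show "\<bar>x $ p\<bar> \<le> (cmod ?w)\<^sup>2" unfolding e norm_power[symmetric] by (rule abs_Re_le_cmod)
  show "\<bar>x $ q\<bar> \<le> (cmod ?w)\<^sup>2" unfolding e norm_power[symmetric] by (rule abs_Im_le_cmod)
  have "\<bar>x $ q\<bar> = 2 * \<bar>Re ?w\<bar> * slit_height p q x"
    using slit_height_nonneg[of p q x] by (simp add: e slit_height_def power2_eq_square abs_mult)
  also have "\<dots> \<le> 2 * cmod ?w * slit_height p q x"
    using abs_Re_le_cmod[of ?w] slit_height_nonneg[of p q x] by (intro mult_right_mono) auto
  finally show "\<bar>x $ q\<bar> \<le> 2 * cmod ?w * slit_height p q x" .
qed

text \<open>
  The part of the strip with \<open>|w|\<^sup>2\<close> of size \<open>4\<^sup>i e\<^sup>2\<close> lies in a box of sides \<open>4\<^sup>i e\<^sup>2\<close> and \<open>2\<^sup>i e\<^sup>2\<close>,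
  up to constants, because \<open>x\<^sub>q = 2 Re w Im w\<close>. There the integrand is at most \<open>16\<^sup>-\<^sup>i e\<^sup>-\<^sup>4\<close>. The powers of
  \<open>e\<close> cancel and a geometric series with ratio one half remains, so the bound does not depend on \<open>e\<close>.
\<close>

lemma nn_integral_strip_bound:
  fixes p q :: "'n::finite"
  assumes pq: "p \<noteq> q" and e: "e > 0"
  shows "(\<integral>\<^sup>+x. ennreal (indicator {x. e \<le> slit_height p q x \<and> slit_height p q x \<le> 2 * e} x *
      (inverse (cmod (slit_root p q x))) ^ 4) \<partial>sphere_measure) \<le> ennreal (64 * (real CARD('n) * 2 ^ CARD('n)))"
proof (rule nn_integral_le_boxes[OF pq, where a = "\<lambda>i. 4 * 4 ^ i * e\<^sup>2" and b = "\<lambda>i. 8 * 2 ^ i * e\<^sup>2"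
      and c = "\<lambda>i. inverse (16 ^ i * e ^ 4)"])
  fix x :: "real ^ 'n"
  let ?w = "slit_root p q x" and ?h = "slit_height p q x"
  assume "norm x = 1" and nz: "ennreal (indicator {x. e \<le> slit_height p q x \<and> slit_height p q x \<le> 2 * e} x * (inverse (cmod ?w)) ^ 4) \<noteq> 0"
  then have h: "e \<le> ?h" "?h \<le> 2 * e" by (auto simp: indicator_def split: if_splits)
  have "?h \<le> cmod ?w" unfolding slit_height_def using abs_Im_le_cmod[of ?w] by linarith
  then have we: "e \<le> cmod ?w" using h by linarith
  then have "1 \<le> (cmod ?w)\<^sup>2 / e\<^sup>2" using e by (simp add: power_mono)
  then obtain i where "4 ^ i \<le> (cmod ?w)\<^sup>2 / e\<^sup>2" "(cmod ?w)\<^sup>2 / e\<^sup>2 < 4 ^ Suc i" using ex_power4_between by blast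
  then have i: "4 ^ i * e\<^sup>2 \<le> (cmod ?w)\<^sup>2" "(cmod ?w)\<^sup>2 < 4 ^ Suc i * e\<^sup>2"
    using e by (simp_all add: field_simps)
  have four: "(4::real) ^ i = (2 ^ i)\<^sup>2" by (simp add: power2_eq_square flip: power_mult_distrib)
  have sixteen: "(16::real) ^ i = (4 ^ i)\<^sup>2" by (simp add: power2_eq_square flip: power_mult_distrib)
  have "(cmod ?w)\<^sup>2 < (2 ^ Suc i * e)\<^sup>2"
    using i(2) by (simp add: power_mult_distrib four mult_ac)
  then have w: "cmod ?w < 2 ^ Suc i * e" by (rule power2_less_imp_less) (use e in simp)
  have 1: "\<bar>x $ p\<bar> \<le> 4 * 4 ^ i * e\<^sup>2" using abs_plane_le_root(1)[of x p q] i(2) by simp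
  have "\<bar>x $ q\<bar> \<le> 2 * cmod ?w * ?h" by (rule abs_plane_le_root(3))
  also have "\<dots> \<le> 2 * (2 ^ Suc i * e) * (2 * e)"
    using w h e by (intro mult_mono) auto
  finally have 2: "\<bar>x $ q\<bar> \<le> 8 * 2 ^ i * e\<^sup>2" by (simp add: power2_eq_square)
  have "16 ^ i * e ^ 4 = (4 ^ i * e\<^sup>2)\<^sup>2"
    by (simp add: power_mult_distrib sixteen)
  also have "\<dots> \<le> ((cmod ?w)\<^sup>2)\<^sup>2" using i(1) e by (intro power_mono) auto
  finally have "16 ^ i * e ^ 4 \<le> cmod ?w ^ 4" by simp
  then have "inverse (cmod ?w ^ 4) \<le> inverse (16 ^ i * e ^ 4)" using e by (intro le_imp_inverse_le) auto
  then have 3: "indicator {x. e \<le> slit_height p q x \<and> slit_height p q x \<le> 2 * e} x * (inverse (cmod ?w)) ^ 4 \<le> inverse (16 ^ i * e ^ 4)"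
    using h by (simp add: power_inverse)
  show "\<exists>i. ennreal (indicator {x. e \<le> slit_height p q x \<and> slit_height p q x \<le> 2 * e} x * (inverse (cmod ?w)) ^ 4) \<le> ennreal (inverse (16 ^ i * e ^ 4))
     \<and> \<bar>x $ p\<bar> \<le> 4 * 4 ^ i * e\<^sup>2 \<and> \<bar>x $ q\<bar> \<le> 8 * 2 ^ i * e\<^sup>2"
    using 1 2 3 by (intro exI[of _ i]) (auto intro: ennreal_leI)
next
  have g: "(\<lambda>i. 32 * (real CARD('n) * 2 ^ CARD('n)) * (1/2) ^ i) sums (64 * (real CARD('n) * 2 ^ CARD('n)))"
    using sums_mult[OF geometric_sums[of "1/2::real"], of "32 * (real CARD('n) * 2 ^ CARD('n))"] by simp
  have "inverse (16 ^ i * e ^ 4) * (real CARD('n) * 2 ^ CARD('n) * (4 * 4 ^ i * e\<^sup>2 * (8 * 2 ^ i * e\<^sup>2)))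
     = 32 * (real CARD('n) * 2 ^ CARD('n)) * (1/2) ^ i" for i
  proof -
    have "(16::real) ^ i = 4 ^ i * (2 ^ i * 2 ^ i)" by (simp flip: power_mult_distrib)
    then show ?thesis using e by (simp add: field_simps power2_eq_square power4_eq_xxxx power_one_over)
  qed
  then show "(\<lambda>i. inverse (16 ^ i * e ^ 4) * (real CARD('n) * 2 ^ CARD('n) * (4 * 4 ^ i * e\<^sup>2 * (8 * 2 ^ i * e\<^sup>2)))) sums
      (64 * (real CARD('n) * 2 ^ CARD('n)))"
    using g by (simp only:)
qed (use e in auto)

text \<open>
  The square of \<open>|w|\<close> is the distance to the edge, which has codimension two. The dyadic shells of
  that distance are contained in squares.
\<close>

lemma nn_integral_inverse_root_finite:
  fixes p q :: "'n::finite"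
  assumes pq: "p \<noteq> q"
  shows "(\<integral>\<^sup>+x. ennreal ((inverse (cmod (slit_root p q x)))\<^sup>2) \<partial>sphere_measure) < \<infinity>"
proof -
  have "(\<integral>\<^sup>+x. ennreal ((inverse (cmod (slit_root p q x)))\<^sup>2) \<partial>sphere_measure) \<le> ennreal (4 * (real CARD('n) * 2 ^ CARD('n)) * (1 / (1 - 1/4)))"
  proof (rule nn_integral_le_boxes[OF pq, where a = "\<lambda>i. (1/4) ^ i" and b = "\<lambda>i. (1/4) ^ i" and c = "\<lambda>i. 4 * 4 ^ i"])
    fix x :: "real ^ 'n"
    let ?w = "slit_root p q x"
    assume x: "norm x = 1" and nz: "ennreal ((inverse (cmod ?w))\<^sup>2) \<noteq> 0"
    then have w: "?w \<noteq> 0" by auto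
    have "(cmod ?w)\<^sup>2 \<le> 1" using norm_slit_root_le_1[of x p q] x pq by (simp add: power_le_one)
    then have "1 \<le> inverse ((cmod ?w)\<^sup>2)" using w by (simp add: one_le_inverse)
    then obtain i where i: "4 ^ i \<le> inverse ((cmod ?w)\<^sup>2)" "inverse ((cmod ?w)\<^sup>2) < 4 ^ Suc i"
      using ex_power4_between by blast
    have "(cmod ?w)\<^sup>2 \<le> inverse (4 ^ i)" using le_imp_inverse_le[OF i(1)] by simp
    then have "(cmod ?w)\<^sup>2 \<le> (1/4) ^ i" by (simp add: power_one_over inverse_eq_divide)
    then have "\<bar>x $ p\<bar> \<le> (1/4) ^ i \<and> \<bar>x $ q\<bar> \<le> (1/4) ^ i"
      using abs_plane_le_root(1,2)[of x p q] by (meson abs_plane_le_root(1,2) order_trans)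
    moreover have "ennreal ((inverse (cmod ?w))\<^sup>2) \<le> ennreal (4 * 4 ^ i)"
      using i(2) by (intro ennreal_leI) (simp add: power_inverse)
    ultimately show "\<exists>i. ennreal ((inverse (cmod ?w))\<^sup>2) \<le> ennreal (4 * 4 ^ i) \<and> \<bar>x $ p\<bar> \<le> (1/4) ^ i \<and> \<bar>x $ q\<bar> \<le> (1/4) ^ i"
      by blast
  next
    have g: "(\<lambda>i. 4 * (real CARD('n) * 2 ^ CARD('n)) * (1/4) ^ i) sums (4 * (real CARD('n) * 2 ^ CARD('n)) * (1 / (1 - 1/4)))"
      by (intro sums_mult geometric_sums) simp
    have "4 * 4 ^ i * (real CARD('n) * 2 ^ CARD('n) * ((1/4) ^ i * (1/4) ^ i)) = 4 * (real CARD('n) * 2 ^ CARD('n)) * (1/4) ^ i" for i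
      by (simp add: power_one_over)
    then show "(\<lambda>i. 4 * 4 ^ i * (real CARD('n) * 2 ^ CARD('n) * ((1/4) ^ i * (1/4) ^ i))) sums (4 * (real CARD('n) * 2 ^ CARD('n)) * (1 / (1 - 1/4)))"
      using g by (simp only:)
  qed auto
  also have "\<dots> < \<infinity>" by simp
  finally show ?thesis .
qed

section \<open>Square integrable vector fields\<close>

lemma L2_norm: "f \<in> L2 M \<Longrightarrow> (\<lambda>x. norm (f x)) \<in> L2 M"
proof -
  assume f: "f \<in> L2 M"
  then have [measurable]: "f \<in> borel_measurable M" by (rule L2_measurable)
  have "(\<lambda>x. norm (f x)) \<in> borel_measurable M" by measurable
  then show ?thesis using f by (simp add: L2_def)
qed

lemma L2_inner_integrable:
  fixes f g :: "'a \<Rightarrow> 'b::euclidean_space"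
  assumes "f \<in> L2 M" "g \<in> L2 M"
  shows "integrable M (\<lambda>x. f x \<bullet> g x)"
proof (rule Bochner_Integration.integrable_bound[OF L2_mult_integrable[OF L2_norm[OF assms(1)] L2_norm[OF assms(2)]]])
  show "(\<lambda>x. f x \<bullet> g x) \<in> borel_measurable M"
    using assms by (intro borel_measurable_inner L2_measurable)
  show "AE x in M. norm (f x \<bullet> g x) \<le> norm (norm (f x) * norm (g x))"
    using Cauchy_Schwarz_ineq2 by (auto simp: abs_mult)
qed

lemma L2_dominated:
  fixes f :: "'a \<Rightarrow> 'b::euclidean_space" and g :: "'a \<Rightarrow> 'c::euclidean_space"
  assumes "f \<in> borel_measurable M" "g \<in> L2 M" "AE x in M. norm (f x) \<le> norm (g x)"
  shows "f \<in> L2 M"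
proof -
  have "integrable M (\<lambda>x. (norm (f x))\<^sup>2)"
  proof (rule Bochner_Integration.integrable_bound)
    show "integrable M (\<lambda>x. (norm (g x))\<^sup>2)" using assms by (simp add: L2_def)
    show "AE x in M. norm ((norm (f x))\<^sup>2) \<le> norm ((norm (g x))\<^sup>2)"
      using assms(3) by eventually_elim (simp add: power_mono)
  qed (use assms(1) in simp)
  then show ?thesis using assms(1) by (simp add: L2_def)
qed

lemma L2_vec_add:
  fixes f g :: "'a \<Rightarrow> 'b::euclidean_space"
  assumes "f \<in> L2 M" "g \<in> L2 M"
  shows "(\<lambda>x. f x + g x) \<in> L2 M"
proof (rule L2_dominated[OF _ L2_add[OF L2_norm[OF assms(1)] L2_norm[OF assms(2)]]])
  show "(\<lambda>x. f x + g x) \<in> borel_measurable M" using assms by (intro borel_measurable_add L2_measurable)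
  show "AE x in M. norm (f x + g x) \<le> norm (norm (f x) + norm (g x))"
    by (rule AE_I2) (use norm_triangle_ineq in auto)
qed

lemma L2_vec_scaleR:
  fixes f :: "'a \<Rightarrow> 'b::euclidean_space"
  assumes "f \<in> L2 M"
  shows "(\<lambda>x. c *\<^sub>R f x) \<in> L2 M"
  using assms by (simp add: L2_def power_mult_distrib borel_measurable_scaleR)

lemma continuous_on_sphere_L2:
  fixes f :: "real ^ 'n \<Rightarrow> 'b::euclidean_space"
  assumes f: "continuous_on (sphere 0 1) f"
  shows "f \<in> L2 sphere_measure"
proof -
  interpret finite_measure "sphere_measure :: (real ^ 'n) measure" by (rule finite_measure_sphere)
  have "bounded (f ` sphere 0 1)"
    by (intro compact_imp_bounded compact_continuous_image f) auto
  then obtain B where B: "\<And>x. x \<in> sphere 0 1 \<Longrightarrow> norm (f x) \<le> B" unfolding bounded_iff by blast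
  have "(\<lambda>_. B) \<in> L2 (sphere_measure :: (real ^ 'n) measure)" by (rule L2_bounded[where B="\<bar>B\<bar>"]) auto
  then show ?thesis
    by (rule L2_dominated[OF borel_measurable_sphere_continuous[OF f]])
      (use B in \<open>auto intro!: AE_I2 intro: order_trans[OF _ abs_ge_self]\<close>)
qed

text \<open>
  If \<open>f\<close> is orthogonal to \<open>g\<close>, then \<open>g\<close> is not longer than \<open>g - f\<close>, which can be made small.
\<close>

lemma orthogonal_to_dense_imp_zero:
  fixes g :: "'a \<Rightarrow> real"
  assumes A: "A \<subseteq> L2 M" and g: "g \<in> L2_closure M A" and orth: "\<And>f. f \<in> A \<Longrightarrow> (LINT x|M. g x * f x) = 0"
  shows "AE x in M. g x = 0"
proof -
  have gL: "g \<in> L2 M" by (rule L2_closure_L2[OF g])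
  have le: "(LINT x|M. (g x)\<^sup>2) \<le> e" if e: "e > 0" for e
  proof -
    obtain f where f: "f \<in> A" "(LINT x|M. (g x - f x)\<^sup>2) < e" using g e unfolding L2_closure_def by blast
    then have fL: "f \<in> L2 M" using A by blast
    have "(LINT x|M. (g x)\<^sup>2) \<le> (LINT x|M. (g x - f x)\<^sup>2 + 2 * (g x * f x))"
    proof (rule integral_mono)
      show "(g x)\<^sup>2 \<le> (g x - f x)\<^sup>2 + 2 * (g x * f x)" for x by (simp add: power2_diff mult.assoc)
    qed (intro L2_square_integrable gL Bochner_Integration.integrable_add L2_diff fL integrable_mult_right L2_mult_integrable)+
    also have "\<dots> = (LINT x|M. (g x - f x)\<^sup>2) + 2 * (LINT x|M. g x * f x)"
      by (subst Bochner_Integration.integral_add)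
        (intro L2_square_integrable gL L2_diff fL integrable_mult_right L2_mult_integrable | simp)+
    finally show ?thesis using f(2) orth[OF f(1)] by simp
  qed
  have "(LINT x|M. (g x)\<^sup>2) \<le> 0" by (rule field_le_epsilon) (use le in simp)
  moreover have "0 \<le> (LINT x|M. (g x)\<^sup>2)" by simp
  ultimately have "(LINT x|M. (g x)\<^sup>2) = 0" by linarith
  then have "AE x in M. (g x)\<^sup>2 = 0"
    using integral_nonneg_eq_0_iff_AE[OF L2_square_integrable[OF gL]] by simp
  then show ?thesis by simp
qed

text \<open>
  A sequence that is bounded in \<open>L\<^sup>2\<close> and lives on sets shrinking to nothing converges weakly to zero:
  by Young's inequality the pairing is at most \<open>d / 2\<close> times the bound plus \<open>1 / (2 d)\<close> times the mass of
  \<open>\<phi>\<^sup>2\<close> on \<open>B n\<close>, for every \<open>d > 0\<close>.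
\<close>

lemma tendsto_zero_if_concentrating:
  fixes \<phi> :: "'a \<Rightarrow> real" and K :: "nat \<Rightarrow> 'a \<Rightarrow> real"
  assumes \<phi>: "\<phi> \<in> L2 M" and K: "\<And>n. K n \<in> L2 M" "\<And>n. (LINT x|M. (K n x)\<^sup>2) \<le> C"
    and B: "\<And>n. B n \<in> sets M" "\<And>n x. x \<in> space M \<Longrightarrow> x \<notin> B n \<Longrightarrow> K n x = 0"
    and lim: "\<And>x. x \<in> space M \<Longrightarrow> \<forall>\<^sub>F n in sequentially. x \<notin> B n"
  shows "(\<lambda>n. LINT x|M. \<phi> x * K n x) \<longlonglongrightarrow> 0"
proof (rule LIMSEQ_I)
  fix e :: real assume e: "e > 0"
  have p2: "integrable M (\<lambda>x. (\<phi> x)\<^sup>2)" by (rule L2_square_integrable[OF \<phi>])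
  have m: "\<phi> \<in> borel_measurable M" by (rule L2_measurable[OF \<phi>])
  have "0 \<le> (LINT x|M. (K 0 x)\<^sup>2)" by simp
  then have C0: "0 \<le> C" using K(2)[of 0] by linarith
  \<comment> \<open>with this \<open>d\<close> each of the two halves of the estimate is at most \<open>e / 2\<close>\<close>
  define d where "d = e / (C + 1)"
  have d: "d > 0" using e C0 by (simp add: d_def)
  have "(\<lambda>n. LINT x|M. indicator (B n) x * (\<phi> x)\<^sup>2) \<longlonglongrightarrow> (LINT x|M. 0)"
  proof (rule integral_dominated_convergence[OF _ _ p2])
    show "AE x in M. (\<lambda>n. indicator (B n) x * (\<phi> x)\<^sup>2) \<longlonglongrightarrow> 0"
    proof (rule AE_I2)
      fix x assume "x \<in> space M"
      from lim[OF this] show "(\<lambda>n. indicator (B n) x * (\<phi> x)\<^sup>2) \<longlonglongrightarrow> 0"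
        by (intro tendsto_eventually) (auto elim: eventually_mono)
    qed
    show "AE x in M. norm (indicator (B n) x * (\<phi> x)\<^sup>2) \<le> (\<phi> x)\<^sup>2" for n
      by (rule AE_I2) (simp add: indicator_def)
  qed (use m B in auto)
  then have "(\<lambda>n. LINT x|M. indicator (B n) x * (\<phi> x)\<^sup>2) \<longlonglongrightarrow> 0" by simp
  then have "\<forall>\<^sub>F n in sequentially. (LINT x|M. indicator (B n) x * (\<phi> x)\<^sup>2) < d * e"
    by (rule order_tendstoD) (use d e in simp)
  then obtain N where N: "\<And>n. n \<ge> N \<Longrightarrow> (LINT x|M. indicator (B n) x * (\<phi> x)\<^sup>2) < d * e"
    by (auto simp: eventually_sequentially)
  show "\<exists>no. \<forall>n\<ge>no. norm ((LINT x|M. \<phi> x * K n x) - 0) < e"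
  proof (intro exI allI impI)
    fix n assume "n \<ge> N"
    have i1: "integrable M (\<lambda>x. indicator (B n) x * (\<phi> x)\<^sup>2)"
      by (rule Bochner_Integration.integrable_bound[OF p2]) (use m B in \<open>auto simp: indicator_def\<close>)
    have i2: "integrable M (\<lambda>x. (K n x)\<^sup>2)" by (rule L2_square_integrable[OF K(1)])
    have "\<bar>LINT x|M. \<phi> x * K n x\<bar> \<le> (LINT x|M. \<bar>\<phi> x * K n x\<bar>)" by (rule integral_abs_bound)
    also have "\<dots> \<le> (LINT x|M. (1 / (2 * d)) * (indicator (B n) x * (\<phi> x)\<^sup>2) + (d / 2) * (K n x)\<^sup>2)"
    proof (rule integral_mono)
      show "integrable M (\<lambda>x. \<bar>\<phi> x * K n x\<bar>)" by (intro integrable_abs L2_mult_integrable \<phi> K)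
      show "integrable M (\<lambda>x. (1 / (2 * d)) * (indicator (B n) x * (\<phi> x)\<^sup>2) + (d / 2) * (K n x)\<^sup>2)"
        using i1 i2 by (intro Bochner_Integration.integrable_add integrable_mult_right)
      fix x assume x: "x \<in> space M"
      show "\<bar>\<phi> x * K n x\<bar> \<le> (1 / (2 * d)) * (indicator (B n) x * (\<phi> x)\<^sup>2) + (d / 2) * (K n x)\<^sup>2"
      proof (cases "x \<in> B n")
        case False
        then show ?thesis using B(2)[OF x] by simp
      next
        case True
        \<comment> \<open>Young's inequality\<close>
        have "0 \<le> (\<bar>\<phi> x\<bar> - d * \<bar>K n x\<bar>)\<^sup>2" by simp
        then have "2 * d * (\<bar>\<phi> x\<bar> * \<bar>K n x\<bar>) \<le> (\<phi> x)\<^sup>2 + d\<^sup>2 * (K n x)\<^sup>2"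
          by (simp add: power2_diff power_mult_distrib mult_ac)
        then have "\<bar>\<phi> x\<bar> * \<bar>K n x\<bar> \<le> ((\<phi> x)\<^sup>2 + d\<^sup>2 * (K n x)\<^sup>2) / (2 * d)"
          using d by (simp add: pos_le_divide_eq mult_ac)
        also have "\<dots> = (1 / (2 * d)) * (\<phi> x)\<^sup>2 + (d / 2) * (K n x)\<^sup>2"
          using d by (simp add: field_simps power2_eq_square)
        finally show ?thesis using True by (simp add: abs_mult)
      qed
    qed
    also have "\<dots> = (1 / (2 * d)) * (LINT x|M. indicator (B n) x * (\<phi> x)\<^sup>2) + (d / 2) * (LINT x|M. (K n x)\<^sup>2)"
      using i1 i2 by simp
    also have "\<dots> < (1 / (2 * d)) * (d * e) + (d / 2) * (C + 1)"
    proof (rule add_strict_mono)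
      show "(1 / (2 * d)) * (LINT x|M. indicator (B n) x * (\<phi> x)\<^sup>2) < (1 / (2 * d)) * (d * e)"
        using N[OF \<open>n \<ge> N\<close>] d by (intro mult_strict_left_mono) auto
      show "(d / 2) * (LINT x|M. (K n x)\<^sup>2) < (d / 2) * (C + 1)"
        using K(2)[of n] d by (intro mult_strict_left_mono) auto
    qed
    also have "\<dots> = e"
    proof -
      have "(C + 1) * d = e" using C0 by (simp add: d_def)
      then show ?thesis using d by (simp add: field_simps)
    qed
    finally show "norm ((LINT x|M. \<phi> x * K n x) - 0) < e" by simp
  qed
qed

section \<open>Cutoffs near the slit and weak gradients\<close>

definition slit_cutoff :: "'n::finite \<Rightarrow> 'n \<Rightarrow> real \<Rightarrow> real ^ 'n \<Rightarrow> real" where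
  "slit_cutoff p q e x = step (slit_height p q x / e)"

lemma slit_cutoff_bounds: "0 \<le> slit_cutoff p q e x" "slit_cutoff p q e x \<le> 1"
  by (simp_all add: slit_cutoff_def step_nonneg step_le_1)

lemma slit_cutoff_eq_0: "e > 0 \<Longrightarrow> slit_height p q x \<le> e \<Longrightarrow> slit_cutoff p q e x = 0"
  by (simp add: slit_cutoff_def step_eq_0)

lemma slit_cutoff_tendsto_1:
  assumes "x \<in> slit_dom p q"
  shows "(\<lambda>n. slit_cutoff p q (inverse (real (Suc n))) x) \<longlonglongrightarrow> 1"
proof (rule tendsto_eventually)
  have h: "slit_height p q x > 0" using assms by simp
  obtain N :: nat where N: "2 / slit_height p q x < real N" using reals_Archimedean2 by blast
  have "slit_cutoff p q (inverse (real (Suc n))) x = 1" if "n \<ge> N" for n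
  proof -
    have "2 / slit_height p q x \<le> real (Suc n)" using N that by linarith
    then have "2 \<le> slit_height p q x * real (Suc n)" using h by (simp add: pos_divide_le_eq mult.commute)
    then show ?thesis by (simp add: slit_cutoff_def step_eq_1 divide_inverse)
  qed
  then show "\<forall>\<^sub>F n in sequentially. slit_cutoff p q (inverse (real (Suc n))) x = 1"
    by (auto simp: eventually_sequentially)
qed

lemma slit_cutoff_measurable [measurable]:
  assumes "e > 0" shows "slit_cutoff p q e \<in> borel_measurable borel"
  unfolding slit_cutoff_def[abs_def]
  by (intro borel_measurable_continuous_onI continuous_on_compose2[OF Ck_on_imp_continuous_on[OF Ck_on_step[of 0]]]
      continuous_on_divide continuous_on_slit_height continuous_on_const) (use assms in auto)

lemma slit_cutoff_deriv:
  assumes "x \<in> slit_dom p q"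
  shows "(slit_cutoff p q e has_derivative
     (\<lambda>v. Im (plane_part p q v / (2 * slit_root p q x)) / e * step' (slit_height p q x / e))) (at x)"
proof -
  have "((\<lambda>x. slit_height p q x / e) has_derivative (\<lambda>v. Im (plane_part p q v / (2 * slit_root p q x)) / e)) (at x)"
    using bounded_linear.has_derivative[OF bounded_linear_divide slit_height_deriv[OF assms]] .
  from has_derivative_compose[OF this step_deriv[unfolded has_field_derivative_def]]
  show ?thesis unfolding slit_cutoff_def[abs_def] by (simp only: mult.commute)
qed

lemma Ck_on_slit_cutoff: "Ck_on k (slit_dom p q) (slit_cutoff p q e)"
proof -
  have "Ck_on k (slit_dom p q) (\<lambda>x. step (slit_height p q x * inverse e))"
    by (rule Ck_on_compose_real[OF open_slit_dom open_UNIV _ Ck_on_step])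
      (auto intro!: Ck_on_mult Ck_on_slit_height Ck_on_const open_slit_dom simp del: mem_Collect_eq)
  then show ?thesis by (simp add: slit_cutoff_def[abs_def] divide_inverse)
qed

text \<open>
  The height is smooth only off the slit, but where it is below \<open>e\<close> the product is zero.
\<close>

lemma Ck_cutoff_field:
  fixes F :: "real ^ 'n::finite \<Rightarrow> 'b::real_normed_vector"
  assumes e: "e > 0" and F: "Ck_on k (slit_dom p q) F"
  shows "Ck k (\<lambda>x. slit_cutoff p q e x *\<^sub>R F x)"
proof -
  have o: "open {x. slit_height p q x < e}"
    by (intro open_Collect_less continuous_on_slit_height continuous_on_const)
  have 1: "Ck_on k (slit_dom p q) (\<lambda>x. slit_cutoff p q e x *\<^sub>R F x)"
    by (intro Ck_on_scaleR open_slit_dom Ck_on_slit_cutoff F)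
  have 2: "Ck_on k {x. slit_height p q x < e} (\<lambda>x. slit_cutoff p q e x *\<^sub>R F x)"
    by (rule Ck_on_cong[OF o _ Ck_on_const[OF o, of _ 0]]) (simp add: slit_cutoff_eq_0[OF e less_imp_le])
  have "slit_dom p q \<union> {x. slit_height p q x < e} = UNIV" using e by auto
  then show ?thesis using Ck_on_Un[OF open_slit_dom o 1 2] by (simp add: Ck_iff_Ck_on)
qed

text \<open>
  A field that is smooth and tangential off the slit becomes a test field, however singular it is at
  the slit: the cutoff vanishes on a neighbourhood of the half-equator.
\<close>

lemma cutoff_field_in_test_fields:
  fixes F :: "real ^ 'n::finite \<Rightarrow> real ^ 'n"
  assumes e: "e > 0" and F: "\<And>k. Ck_on k (slit_dom p q) F"
    and tang: "\<And>x. x \<in> slit_dom p q \<Longrightarrow> norm x = 1 \<Longrightarrow> F x \<bullet> x = 0"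
  shows "(\<lambda>x. slit_cutoff p q e x *\<^sub>R F x) \<in> test_fields p q"
proof -
  have supp: "closure {x. slit_cutoff p q e x *\<^sub>R F x \<noteq> 0} \<subseteq> {x. e \<le> slit_height p q x}"
  proof (rule closure_minimal)
    show "{x. slit_cutoff p q e x *\<^sub>R F x \<noteq> 0} \<subseteq> {x. e \<le> slit_height p q x}"
    proof
      fix x assume "x \<in> {x. slit_cutoff p q e x *\<^sub>R F x \<noteq> 0}"
      then show "x \<in> {x. e \<le> slit_height p q x}" using slit_cutoff_eq_0[OF e, of p q x] by force
    qed
    show "closed {x. e \<le> slit_height p q x}"
      by (intro closed_Collect_le continuous_on_slit_height continuous_on_const)
  qed
  then have "closure {x. slit_cutoff p q e x *\<^sub>R F x \<noteq> 0} \<inter> half_equator p q = {}"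
    using slit_height_half_equator[of _ p q] e by force
  moreover have "(slit_cutoff p q e x *\<^sub>R F x) \<bullet> x = 0" if "x \<in> sphere 0 1" for x
  proof (cases "x \<in> slit_dom p q")
    case True
    then show ?thesis using tang that by simp
  next
    case False
    then show ?thesis using slit_cutoff_eq_0[OF e, of p q x] e by simp
  qed
  ultimately show ?thesis
    unfolding test_fields_def using Ck_cutoff_field[OF e F] by blast
qed

lemma AE_sphere_slit_dom:
  fixes p q :: "'n::finite"
  assumes "p \<noteq> q"
  shows "AE x in sphere_measure. x \<in> slit_dom p q \<and> norm x = 1"
proof -
  have "AE x in sphere_measure. x \<notin> half_equator p q"
    using half_equator_null[OF assms] by (rule AE_not_in)
  then show ?thesis
  proof (rule AE_mp, intro AE_I2 impI)
    fix x :: "real ^ 'n" assume "x \<in> space sphere_measure" "x \<notin> half_equator p q"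
    then have "x \<in> slit_sphere p q" by simp
    then show "x \<in> slit_dom p q \<and> norm x = 1" using slit_sphere_subset_slit_dom[of p q] by auto
  qed
qed

lemma test_field_Ck_on: "X \<in> test_fields p q \<Longrightarrow> Ck_on k UNIV X"
  by (simp add: test_fields_def Ck_iff_Ck_on)

lemma test_field_measurable: "X \<in> test_fields p q \<Longrightarrow> X \<in> borel_measurable sphere_measure"
  by (intro borel_measurable_sphere borel_measurable_continuous_onI Ck_on_imp_continuous_on[OF test_field_Ck_on])

lemma test_field_div_continuous:
  fixes p q :: "'n::finite"
  assumes "X \<in> test_fields p q" shows "continuous_on S (sphere_div X)"
  using continuous_on_sphere_div[OF test_field_Ck_on[OF assms, of "Suc 0"]] continuous_on_subset by blast

lemma test_field_L2: "X \<in> test_fields p q \<Longrightarrow> X \<in> L2 sphere_measure"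
  by (intro continuous_on_sphere_L2 continuous_on_subset[OF Ck_on_imp_continuous_on[OF test_field_Ck_on[of _ _ _ 0]] subset_UNIV])

lemma sphere_div_test_L2: "X \<in> test_fields p q \<Longrightarrow> sphere_div X \<in> L2 sphere_measure"
  by (intro continuous_on_sphere_L2 test_field_div_continuous)

text \<open>
  The half-equator is a null set, so the integrals may be taken over the whole sphere.
\<close>

lemma has_weak_gradient_iff:
  fixes p q :: "'n::finite"
  assumes pq: "p \<noteq> q" and \<psi>: "\<psi> \<in> L2 sphere_measure"
  shows "has_weak_gradient p q \<psi> G \<longleftrightarrow>
     G \<in> L2 sphere_measure \<and> (AE x in sphere_measure. G x \<bullet> x = 0) \<and>
     (\<forall>X \<in> test_fields p q. (LINT x|sphere_measure. \<psi> x * sphere_div X x) = - (LINT x|sphere_measure. G x \<bullet> X x))"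
proof -
  have "(LINT x:slit_sphere p q|sphere_measure. \<psi> x * sphere_div X x) = (LINT x|sphere_measure. \<psi> x * sphere_div X x)"
    if "X \<in> test_fields p q" for X
    by (intro integral_slit_sphere pq borel_measurable_times L2_measurable \<psi>
        borel_measurable_sphere_continuous test_field_div_continuous[OF that])
  moreover have "(LINT x:slit_sphere p q|sphere_measure. G x \<bullet> X x) = (LINT x|sphere_measure. G x \<bullet> X x)"
    if "X \<in> test_fields p q" "G \<in> L2 sphere_measure" for X
    by (intro integral_slit_sphere pq borel_measurable_inner L2_measurable that test_field_measurable[OF that(1)])
  ultimately show ?thesis unfolding has_weak_gradient_def by auto
qed

lemma slit_poly_in_span: "\<alpha> \<in> exponents p q \<Longrightarrow> slit_poly p q j \<alpha> \<in> slit_span p q"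
  unfolding slit_span_def by (rule lin_span_base) auto

lemma Ck_on_id: "open S \<Longrightarrow> Ck_on k S (\<lambda>x. x)"
  by (rule Ck_on_bounded_linear[OF bounded_linear_ident])

text \<open>
  The difference of two weak gradients is orthogonal to the tangential parts of the constant vectors,
  multiplied by cutoffs and by products. Removing the cutoffs, each of its components is orthogonal to
  the dense set of products.
\<close>

theorem weak_gradient_unique:
  fixes p q :: "'n::finite"
  assumes pq: "p \<noteq> q" and \<psi>: "\<psi> \<in> L2 sphere_measure"
    and G: "has_weak_gradient p q \<psi> G" and H: "has_weak_gradient p q \<psi> H"
  shows "AE x in sphere_measure. G x = H x"
proof -
  let ?M = "sphere_measure :: (real ^ 'n) measure"
  interpret finite_measure ?M by (rule finite_measure_sphere)
  note G' = G[unfolded has_weak_gradient_iff[OF pq \<psi>]] and H' = H[unfolded has_weak_gradient_iff[OF pq \<psi>]]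
  define D where "D x = G x + (-1) *\<^sub>R H x" for x
  have DL: "D \<in> L2 ?M" unfolding D_def using G' H' by (intro L2_vec_add L2_vec_scaleR) auto
  have Dt: "AE x in ?M. D x \<bullet> x = 0"
    using G'[THEN conjunct2, THEN conjunct1] H'[THEN conjunct2, THEN conjunct1]
    by eventually_elim (simp add: D_def inner_diff_left)
  have DX: "(LINT x|?M. D x \<bullet> X x) = 0" if X: "X \<in> test_fields p q" for X
  proof -
    have "(LINT x|?M. D x \<bullet> X x) = (LINT x|?M. G x \<bullet> X x - H x \<bullet> X x)"
      by (simp add: D_def inner_diff_left)
    also have "\<dots> = (LINT x|?M. G x \<bullet> X x) - (LINT x|?M. H x \<bullet> X x)"
      using G' H' test_field_L2[OF X] by (intro Bochner_Integration.integral_diff L2_inner_integrable) auto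
    also have "\<dots> = 0" using G' H' X by force
    finally show ?thesis .
  qed
  have comp: "AE x in ?M. D x \<bullet> c = 0" for c
  proof -
    have cL: "(\<lambda>_. c) \<in> L2 ?M" by (auto simp: L2_def)
    have gm: "(\<lambda>x. D x \<bullet> c) \<in> borel_measurable ?M" by (intro borel_measurable_inner L2_measurable[OF DL]) auto
    have gL: "(\<lambda>x. D x \<bullet> c) \<in> L2 ?M"
    proof (rule L2_dominated[OF gm L2_vec_scaleR[OF L2_norm[OF DL], of "norm c"]])
      have "norm (D x \<bullet> c) \<le> norm (norm c *\<^sub>R norm (D x))" for x
        using Cauchy_Schwarz_ineq2[of "D x" c] by (simp add: mult.commute)
      then show "AE x in ?M. norm (D x \<bullet> c) \<le> norm (norm c *\<^sub>R norm (D x))" by simp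
    qed
    have gi: "integrable ?M (\<lambda>x. D x \<bullet> c)" by (rule L2_inner_integrable[OF DL cL])
    have sp: "(LINT x|?M. (D x \<bullet> c) * slit_poly p q j \<alpha> x) = 0" if \<alpha>: "\<alpha> \<in> exponents p q" for j \<alpha>
    proof -
      define F where "F x = slit_poly p q j \<alpha> x *\<^sub>R (c + (- 1) *\<^sub>R ((c \<bullet> x) *\<^sub>R x))" for x
      define e where "e n = inverse (real (Suc n))" for n
      have e: "e n > 0" for n by (simp add: e_def)
      have FC: "Ck_on k (slit_dom p q) F" for k
        unfolding F_def[abs_def]
        by (intro Ck_on_scaleR Ck_on_add Ck_on_const Ck_on_slit_poly[OF pq \<alpha>] open_slit_dom Ck_on_id
            Ck_on_bounded_linear[OF bounded_linear_inner_right])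
      have test: "(\<lambda>x. slit_cutoff p q (e n) x *\<^sub>R F x) \<in> test_fields p q" for n
      proof (rule cutoff_field_in_test_fields[OF e FC])
        show "F x \<bullet> x = 0" if "norm x = 1" for x
          using that by (simp add: F_def inner_diff_left dot_square_norm)
      qed
      have sm: "slit_poly p q j \<alpha> \<in> borel_measurable ?M" by (rule borel_measurable_sphere) simp
      have cm: "slit_cutoff p q (e n) \<in> borel_measurable ?M" for n
        by (rule borel_measurable_sphere[OF slit_cutoff_measurable[OF e]])
      have "(LINT x|?M. slit_cutoff p q (e n) x * ((D x \<bullet> c) * slit_poly p q j \<alpha> x)) = (LINT x|?M. D x \<bullet> (slit_cutoff p q (e n) x *\<^sub>R F x))" for n
      proof (rule integral_cong_AE)
        show "(\<lambda>x. slit_cutoff p q (e n) x * ((D x \<bullet> c) * slit_poly p q j \<alpha> x)) \<in> borel_measurable ?M"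
          by (intro borel_measurable_times cm gm sm)
        show "(\<lambda>x. D x \<bullet> (slit_cutoff p q (e n) x *\<^sub>R F x)) \<in> borel_measurable ?M"
          by (intro borel_measurable_inner L2_measurable[OF DL] test_field_measurable[OF test])
        show "AE x in ?M. slit_cutoff p q (e n) x * ((D x \<bullet> c) * slit_poly p q j \<alpha> x) = D x \<bullet> (slit_cutoff p q (e n) x *\<^sub>R F x)"
          using Dt by eventually_elim (simp add: F_def inner_diff_right)
      qed
      then have z: "(LINT x|?M. slit_cutoff p q (e n) x * ((D x \<bullet> c) * slit_poly p q j \<alpha> x)) = 0" for n
        using DX[OF test] by simp
      have "(\<lambda>n. LINT x|?M. slit_cutoff p q (e n) x * ((D x \<bullet> c) * slit_poly p q j \<alpha> x)) \<longlonglongrightarrow> (LINT x|?M. (D x \<bullet> c) * slit_poly p q j \<alpha> x)"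
      proof (rule integral_dominated_convergence[where w="\<lambda>x. \<bar>D x \<bullet> c\<bar>"])
        show "integrable ?M (\<lambda>x. \<bar>D x \<bullet> c\<bar>)" by (intro integrable_abs gi)
        show "AE x in ?M. (\<lambda>n. slit_cutoff p q (e n) x * ((D x \<bullet> c) * slit_poly p q j \<alpha> x)) \<longlonglongrightarrow> (D x \<bullet> c) * slit_poly p q j \<alpha> x"
          using AE_sphere_slit_dom[OF pq]
        proof eventually_elim
          case (elim x)
          then have "(\<lambda>n. slit_cutoff p q (e n) x) \<longlonglongrightarrow> 1" unfolding e_def by (intro slit_cutoff_tendsto_1) simp
          from tendsto_mult[OF this tendsto_const[of "(D x \<bullet> c) * slit_poly p q j \<alpha> x"]] show ?case by simp
        qed
        show "AE x in ?M. norm (slit_cutoff p q (e n) x * ((D x \<bullet> c) * slit_poly p q j \<alpha> x)) \<le> \<bar>D x \<bullet> c\<bar>" for n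
        proof (rule AE_I2)
          fix x :: "real ^ 'n" assume "x \<in> space ?M"
          then have s: "\<bar>slit_poly p q j \<alpha> x\<bar> \<le> 1" by (intro slit_poly_bounded pq) simp
          have "\<bar>slit_cutoff p q (e n) x\<bar> * (\<bar>D x \<bullet> c\<bar> * \<bar>slit_poly p q j \<alpha> x\<bar>) \<le> 1 * (\<bar>D x \<bullet> c\<bar> * 1)"
            using slit_cutoff_bounds[of p q "e n" x] s by (intro mult_mono) auto
          then show "norm (slit_cutoff p q (e n) x * ((D x \<bullet> c) * slit_poly p q j \<alpha> x)) \<le> \<bar>D x \<bullet> c\<bar>"
            by (simp add: abs_mult)
        qed
      qed (intro borel_measurable_times cm gm sm)+
      then show ?thesis using z by (simp add: LIMSEQ_const_iff)
    qed
    show ?thesis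
    proof (rule orthogonal_to_dense_imp_zero[OF slit_span_L2[OF pq] subsetD[OF slit_span_dense[OF pq] gL]])
      fix f assume "f \<in> slit_span p q"
      then show "(LINT x|?M. (D x \<bullet> c) * f x) = 0"
        unfolding slit_span_def by (rule L2_orthogonal_lin_span[OF gL, rotated 2]) (auto simp: sp intro: slit_poly_L2[OF pq])
    qed
  qed
  have "AE x in ?M. \<forall>c\<in>Basis. D x \<bullet> c = 0"
    by (rule AE_finite_allI) (auto intro: comp)
  then show ?thesis
  proof eventually_elim
    case (elim x)
    then have "D x = 0" by (simp add: euclidean_all_zero_iff)
    then show ?case by (simp add: D_def)
  qed
qed

section \<open>Green's identity for the products\<close>

lemma inverse_root_L2:
  fixes p q :: "'n::finite"
  assumes "p \<noteq> q"
  shows "(\<lambda>x. inverse (cmod (slit_root p q x))) \<in> L2 sphere_measure"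
proof (rule L2_I)
  show m: "(\<lambda>x. inverse (cmod (slit_root p q x))) \<in> borel_measurable sphere_measure"
    by (rule borel_measurable_sphere) measurable
  show "integrable sphere_measure (\<lambda>x. (inverse (cmod (slit_root p q x)))\<^sup>2)"
    by (rule integrableI_bounded) (use m nn_integral_inverse_root_finite[OF assms] in auto)
qed

context
  fixes p q :: "'n::finite" and j :: nat and \<alpha> :: "'n \<Rightarrow> nat"
  assumes pq: "p \<noteq> q" and \<alpha>: "\<alpha> \<in> exponents p q"
begin

lemma Ck_on_slit_tgrad: "Ck_on k (slit_dom p q) (slit_tgrad p q j \<alpha>)"
proof -
  have "Ck_on k (slit_dom p q) (\<lambda>x. slit_grad p q j \<alpha> x + (- slit_degree j \<alpha> * slit_poly p q j \<alpha> x) *\<^sub>R x)"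
    by (intro Ck_on_add Ck_on_scaleR Ck_on_mult Ck_on_const Ck_on_slit_grad Ck_on_slit_poly Ck_on_id pq \<alpha> open_slit_dom)
  then show ?thesis by (simp add: slit_tgrad_def[abs_def])
qed

lemma slit_tgrad0_measurable: "slit_tgrad0 p q j \<alpha> \<in> borel_measurable sphere_measure"
  unfolding slit_tgrad0_def[abs_def]
  by (intro borel_measurable_sphere borel_measurable_continuous_on_indicator Ck_on_imp_continuous_on[OF Ck_on_slit_tgrad[of 0]]
      borel_open open_slit_dom)

lemma slit_tgrad0_L2: "slit_tgrad0 p q j \<alpha> \<in> L2 sphere_measure"
proof (rule L2_dominated[OF slit_tgrad0_measurable L2_vec_scaleR[OF inverse_root_L2[OF pq], of "2 * slit_degree j \<alpha>"]], rule AE_I2)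
  fix x :: "real ^ 'n" assume x: "x \<in> space sphere_measure"
  have d: "0 \<le> slit_degree j \<alpha>" by (rule slit_degree_nonneg)
  show "norm (slit_tgrad0 p q j \<alpha> x) \<le> norm ((2 * slit_degree j \<alpha>) *\<^sub>R inverse (cmod (slit_root p q x)))"
  proof (cases "x \<in> slit_dom p q")
    case True
    then show ?thesis using slit_tgrad_bound[OF pq \<alpha> True, of j] x d by (simp add: slit_tgrad0_def)
  next
    case False
    then show ?thesis by (simp add: slit_tgrad0_def)
  qed
qed

text \<open>
  The divergence theorem for the product of the function with a test field. The function is not
  smooth on the slit, but the test field vanishes near the half-equator.
\<close>

lemma slit_poly_weak_gradient: "has_weak_gradient p q (slit_poly p q j \<alpha>) (slit_tgrad0 p q j \<alpha>)"
  unfolding has_weak_gradient_iff[OF pq slit_poly_L2[OF pq]]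
proof (intro conjI ballI slit_tgrad0_L2)
  let ?M = "sphere_measure :: (real ^ 'n) measure" and ?u = "slit_poly p q j \<alpha>"
  show "AE x in ?M. slit_tgrad0 p q j \<alpha> x \<bullet> x = 0"
    using AE_sphere_slit_dom[OF pq]
    by eventually_elim (use slit_tgrad_tangential[OF pq \<alpha>] in \<open>simp add: slit_tgrad0_def\<close>)
  fix X assume X: "X \<in> test_fields p q"
  \<comment> \<open>together with the region off the slit, \<open>W\<close> covers the sphere\<close>
  define W where "W = - closure {x. X x \<noteq> 0}"
  define Z where "Z x = ?u x *\<^sub>R X x" for x
  have W: "open W" by (simp add: W_def open_Compl)
  have XW: "X x = 0" if "x \<in> W" for x
    using that closure_subset[of "{x. X x \<noteq> 0}"] by (auto simp: W_def)
  have cover: "sphere 0 1 \<subseteq> slit_dom p q \<union> W"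
  proof
    fix x :: "real ^ 'n" assume x: "x \<in> sphere 0 1"
    show "x \<in> slit_dom p q \<union> W"
    proof (cases "x \<in> half_equator p q")
      case True
      then show ?thesis using X by (auto simp: test_fields_def W_def)
    next
      case False
      then show ?thesis using slit_sphere_subset_slit_dom[of p q] x by blast
    qed
  qed
  have Z1: "Ck_on (Suc 0) (slit_dom p q) Z" unfolding Z_def[abs_def]
    by (intro Ck_on_scaleR open_slit_dom Ck_on_slit_poly[OF pq \<alpha>] Ck_on_subset[OF test_field_Ck_on[OF X] subset_UNIV])
  have Z2: "Ck_on (Suc 0) W Z"
    by (rule Ck_on_cong[OF W _ Ck_on_const[OF W, of _ 0]]) (simp add: Z_def XW)
  have tX: "X x \<bullet> x = 0" if "norm x = 1" for x using X that by (simp add: test_fields_def)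
  have "(LINT x|?M. sphere_div Z x) = 0"
    by (rule sphere_divergence_theorem[OF cover Ck_on_Un[OF open_slit_dom W Z1 Z2]]) (simp add: Z_def tX)
  also have "(LINT x|?M. sphere_div Z x) = (LINT x|?M. ?u x * sphere_div X x + slit_tgrad0 p q j \<alpha> x \<bullet> X x)"
  proof (rule integral_cong_AE)
    show "sphere_div Z \<in> borel_measurable ?M"
      by (intro borel_measurable_sphere_continuous continuous_on_subset[OF continuous_on_sphere_div[OF Ck_on_Un[OF open_slit_dom W Z1 Z2]] cover])
    show "(\<lambda>x. ?u x * sphere_div X x + slit_tgrad0 p q j \<alpha> x \<bullet> X x) \<in> borel_measurable ?M"
      by (intro borel_measurable_add borel_measurable_times borel_measurable_inner L2_measurable slit_poly_L2[OF pq]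
          borel_measurable_sphere_continuous test_field_div_continuous[OF X] slit_tgrad0_measurable test_field_measurable[OF X])
    show "AE x in ?M. sphere_div Z x = ?u x * sphere_div X x + slit_tgrad0 p q j \<alpha> x \<bullet> X x"
      using AE_sphere_slit_dom[OF pq]
    proof eventually_elim
      case (elim x)
      then have x: "x \<in> slit_dom p q" "norm x = 1" by auto
      let ?g = "slit_grad p q j \<alpha> x" and ?X' = "frechet_derivative X (at x)"
      have dX: "(X has_derivative ?X') (at x)" by (rule Ck_on_SucD[OF test_field_Ck_on[OF X, of "Suc 0"] UNIV_I])
      have dZ: "(Z has_derivative (\<lambda>v. ?u x *\<^sub>R ?X' v + (?g \<bullet> v) *\<^sub>R X x)) (at x)"
        unfolding Z_def[abs_def] by (rule has_derivative_scaleR[OF slit_poly_deriv[OF pq \<alpha> x(1)] dX])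
      have l: "linear (\<lambda>v. ?g \<bullet> v)" by (intro bounded_linear.linear bounded_linear_inner_right)
      have "sphere_div Z x = ?u x * (tr ?X' - ?X' x \<bullet> x) + ?g \<bullet> X x"
        unfolding sphere_div_eq[OF dZ] tr_add tr_scale tr_rank_one[OF l]
        using tX[OF x(2)] by (simp add: inner_add_left algebra_simps)
      moreover have "?g \<bullet> X x = slit_tgrad0 p q j \<alpha> x \<bullet> X x"
        using x(1) tX[OF x(2)] by (simp add: slit_tgrad0_def slit_tgrad_def inner_diff_left inner_commute[of x])
      ultimately show ?case unfolding sphere_div_eq[OF dX] by simp
    qed
  qed
  also have "\<dots> = (LINT x|?M. ?u x * sphere_div X x) + (LINT x|?M. slit_tgrad0 p q j \<alpha> x \<bullet> X x)"
  proof (rule Bochner_Integration.integral_add)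
    show "integrable ?M (\<lambda>x. ?u x * sphere_div X x)"
      by (intro L2_mult_integrable slit_poly_L2[OF pq] sphere_div_test_L2[OF X])
    show "integrable ?M (\<lambda>x. slit_tgrad0 p q j \<alpha> x \<bullet> X x)"
      by (intro L2_inner_integrable slit_tgrad0_L2 test_field_L2[OF X])
  qed
  finally show "(LINT x|?M. ?u x * sphere_div X x) = - (LINT x|?M. slit_tgrad0 p q j \<alpha> x \<bullet> X x)" by simp
qed

lemma slit_lap_expand:
  "slit_lap p q j \<alpha> x = slit_degree j \<alpha> * (slit_degree j \<alpha> + real CARD('n) - 2) * slit_poly p q j \<alpha> x
     - (\<Sum>i\<in>UNIV. real (\<alpha> i) * real (\<alpha> i - 1) * slit_poly p q j (lower (lower \<alpha> i) i) x)"
  by (simp add: slit_lap_def monom_lap_def slit_poly_def sum_distrib_left mult_ac)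

lemma slit_lap_L2: "slit_lap p q j \<alpha> \<in> L2 sphere_measure"
proof -
  have "(\<lambda>x. slit_degree j \<alpha> * (slit_degree j \<alpha> + real CARD('n) - 2) * slit_poly p q j \<alpha> x
     - (\<Sum>i\<in>UNIV. real (\<alpha> i) * real (\<alpha> i - 1) * slit_poly p q j (lower (lower \<alpha> i) i) x)) \<in> L2 sphere_measure"
    by (intro L2_diff L2_scale L2_sum slit_poly_L2[OF pq])
  then show ?thesis unfolding slit_lap_expand[symmetric] .
qed

text \<open>
  The field to be tested with is the tangential gradient of the product, which does not vanish near the
  slit, so it is multiplied by the cutoff \<open>step (Im w / e)\<close>. Two limits are routine. The error
  term \<open>K\<close> contains the gradient of the cutoff. By the Neumann condition it is bounded by a multiple of
  \<open>|w|\<^sup>-\<^sup>2\<close> on the strip \<open>e \<le> Im w \<le> 2 e\<close>, hence bounded in \<open>L\<^sup>2\<close> uniformly in \<open>e\<close>; since the strips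
  shrink to nothing, it converges weakly to zero.
\<close>

theorem slit_poly_green:
  assumes \<phi>: "\<phi> \<in> L2 sphere_measure" and G: "has_weak_gradient p q \<phi> G"
  shows "(LINT x|sphere_measure. G x \<bullet> slit_tgrad0 p q j \<alpha> x) = (LINT x|sphere_measure. \<phi> x * slit_lap p q j \<alpha> x)"
proof -
  let ?M = "sphere_measure :: (real ^ 'n) measure" and ?T = "slit_tgrad p q j \<alpha>" and ?lap = "slit_lap p q j \<alpha>"
  interpret finite_measure ?M by (rule finite_measure_sphere)
  note G' = G[unfolded has_weak_gradient_iff[OF pq \<phi>]]
  \<comment> \<open>the widths of the strips\<close>
  define e where "e n = inverse (real (Suc n))" for n
  have e: "e n > 0" for n by (simp add: e_def)
  have elim: "e \<longlonglongrightarrow> 0" unfolding e_def by (rule LIMSEQ_inverse_real_of_nat)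
  define X where "X n x = slit_cutoff p q (e n) x *\<^sub>R ?T x" for n x
  have test: "X n \<in> test_fields p q" for n
    unfolding X_def by (rule cutoff_field_in_test_fields[OF e Ck_on_slit_tgrad slit_tgrad_tangential[OF pq \<alpha>]])
  define S where "S n = {x. e n \<le> slit_height p q x \<and> slit_height p q x \<le> 2 * e n}" for n
  \<comment> \<open>the derivative of the cutoff along the tangential gradient\<close>
  define K where "K n x = indicator (slit_dom p q) x * (Im (plane_part p q (?T x) / (2 * slit_root p q x)) / e n * step' (slit_height p q x / e n))" for n x
  have cm: "slit_cutoff p q (e n) \<in> borel_measurable ?M" for n
    by (rule borel_measurable_sphere[OF slit_cutoff_measurable[OF e]])
  have lapm: "?lap \<in> borel_measurable ?M" by (rule L2_measurable[OF slit_lap_L2])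
  have \<phi>m: "\<phi> \<in> borel_measurable ?M" by (rule L2_measurable[OF \<phi>])
  have div: "AE x in ?M. sphere_div (X n) x = K n x - slit_cutoff p q (e n) x * ?lap x" for n
    using AE_sphere_slit_dom[OF pq]
  proof eventually_elim
    case (elim x)
    then have x: "x \<in> slit_dom p q" "norm x = 1" by auto
    show ?case unfolding X_def[abs_def] sphere_div_scaled_tgrad[OF pq \<alpha> x slit_cutoff_deriv[OF x(1)]]
      using x(1) by (simp add: K_def)
  qed
  have Km: "K n \<in> borel_measurable ?M" for n
  proof -
    have c: "continuous_on (slit_dom p q) (\<lambda>x. Im (plane_part p q (?T x) / (2 * slit_root p q x)) / e n * step' (slit_height p q x / e n))"
    proof (intro continuous_intros)
      show "continuous_on (slit_dom p q) (\<lambda>x. plane_part p q (?T x))"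
        by (rule bounded_linear.continuous_on[OF bounded_linear_plane_part Ck_on_imp_continuous_on[OF Ck_on_slit_tgrad[of 0]]])
      show "continuous_on (slit_dom p q) (slit_root p q)"
        by (intro continuous_at_imp_continuous_on ballI has_derivative_continuous[OF slit_root_deriv])
      show "continuous_on (slit_dom p q) (\<lambda>x. step' (slit_height p q x / e n))"
        by (intro continuous_on_compose2[OF continuous_on_step'[of UNIV]] continuous_on_divide continuous_on_slit_height continuous_on_const)
          (use e[of n] in auto)
      show "\<forall>x\<in>slit_dom p q. 2 * slit_root p q x \<noteq> 0" by (auto simp: slit_height_def)
    qed (use e[of n] in auto)
    have "(\<lambda>x. indicator (slit_dom p q) x *\<^sub>R (Im (plane_part p q (?T x) / (2 * slit_root p q x)) / e n * step' (slit_height p q x / e n))) \<in> borel_measurable borel"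
      by (rule borel_measurable_continuous_on_indicator[OF borel_open[OF open_slit_dom] c])
    then show ?thesis unfolding K_def[abs_def] by (intro borel_measurable_sphere) simp
  qed
  obtain C where C: "C > 0" "\<And>t. \<bar>step' t\<bar> \<le> C" using step'_bounded by blast
  define B where "B = 2 * C * ((real j)\<^sup>2 + slit_degree j \<alpha>)"
  have B0: "0 \<le> B" using C slit_degree_nonneg[of j \<alpha>] by (simp add: B_def)
  have Kb: "\<bar>K n x\<bar> \<le> B * (indicator (S n) x * (inverse (cmod (slit_root p q x)))\<^sup>2)" if n1: "norm x = 1" for n x
  proof (cases "x \<in> slit_dom p q \<and> x \<in> S n")
    case True
    let ?D = "Im (plane_part p q (?T x) / (2 * slit_root p q x))" and ?r = "(inverse (cmod (slit_root p q x)))\<^sup>2"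
    have x: "x \<in> slit_dom p q" and h: "slit_height p q x \<le> 2 * e n" using True by (auto simp: S_def)
    have d0: "0 \<le> (real j)\<^sup>2 + slit_degree j \<alpha>" using slit_degree_nonneg[of j \<alpha>] by simp
    have "\<bar>?D\<bar> \<le> ((real j)\<^sup>2 + slit_degree j \<alpha>) * slit_height p q x * ?r"
      by (rule height_derivative_tgrad_bound[OF pq \<alpha> x n1])
    also have "\<dots> \<le> ((real j)\<^sup>2 + slit_degree j \<alpha>) * (2 * e n) * ?r"
      using h d0 by (intro mult_right_mono mult_left_mono) auto
    finally have D: "\<bar>?D\<bar> / e n \<le> ((real j)\<^sup>2 + slit_degree j \<alpha>) * 2 * ?r"
      using e[of n] by (simp add: pos_divide_le_eq mult_ac)
    have "\<bar>K n x\<bar> = (\<bar>?D\<bar> / e n) * \<bar>step' (slit_height p q x / e n)\<bar>"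
      using x e[of n] by (simp add: K_def abs_mult)
    also have "\<dots> \<le> (((real j)\<^sup>2 + slit_degree j \<alpha>) * 2 * ?r) * C"
      using D C d0 by (intro mult_mono) auto
    finally show ?thesis using True by (simp add: B_def mult_ac)
  next
    case False
    have "K n x = 0"
    proof (cases "x \<in> slit_dom p q")
      case True
      then have "x \<notin> S n" using False by simp
      then have "slit_height p q x / e n \<notin> {1..2}" using e[of n] by (auto simp: S_def field_simps)
      then show ?thesis by (simp add: K_def step'_eq_0)
    qed (simp add: K_def)
    then show ?thesis using B0 by simp
  qed
  have rm: "(\<lambda>x. (inverse (cmod (slit_root p q x)))\<^sup>2) \<in> borel_measurable borel" by measurable
  have Sb: "S n \<in> sets borel" for n
  proof -
    have "closed (S n)" unfolding S_def
      by (intro closed_Collect_conj closed_Collect_le continuous_on_slit_height continuous_on_const)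
    then show ?thesis by (rule borel_closed)
  qed
  have bound_L2: "(\<lambda>x. indicator (S n) x * (inverse (cmod (slit_root p q x)))\<^sup>2) \<in> L2 ?M"
    and bound_int: "(LINT x|?M. (indicator (S n) x * (inverse (cmod (slit_root p q x)))\<^sup>2)\<^sup>2) \<le> 64 * (real CARD('n) * 2 ^ CARD('n))" for n
  proof -
    let ?f = "\<lambda>x. indicator (S n) x * (inverse (cmod (slit_root p q x)))\<^sup>2 :: real"
    have m: "?f \<in> borel_measurable ?M" using rm Sb by (intro borel_measurable_sphere) auto
    have eq: "(?f x)\<^sup>2 = indicator (S n) x * (inverse (cmod (slit_root p q x))) ^ 4" for x
      by (simp add: indicator_def)
    have le: "(\<integral>\<^sup>+x. ennreal ((?f x)\<^sup>2) \<partial>?M) \<le> ennreal (64 * (real CARD('n) * 2 ^ CARD('n)))"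
      unfolding eq unfolding S_def by (rule nn_integral_strip_bound[OF pq e])
    have "integrable ?M (\<lambda>x. (?f x)\<^sup>2)"
    proof (rule integrableI_bounded)
      show "(\<integral>\<^sup>+x. ennreal (norm ((?f x)\<^sup>2)) \<partial>?M) < \<infinity>" using le by (simp add: le_less_trans)
    qed (use m in auto)
    then show "?f \<in> L2 ?M" by (rule L2_I[OF m])
    show "(LINT x|?M. (?f x)\<^sup>2) \<le> 64 * (real CARD('n) * 2 ^ CARD('n))"
      by (rule integral_real_bounded[OF _ le]) simp
  qed
  have KL: "K n \<in> L2 ?M" for n
    by (rule L2_dominated[OF Km L2_scale[OF bound_L2[of n], of B]])
      (use Kb[of _ n] B0 in \<open>auto intro!: AE_I2 simp: abs_mult\<close>)
  have KC: "(LINT x|?M. (K n x)\<^sup>2) \<le> B\<^sup>2 * (64 * (real CARD('n) * 2 ^ CARD('n)))" for n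
  proof -
    have "(LINT x|?M. (K n x)\<^sup>2) \<le> (LINT x|?M. B\<^sup>2 * (indicator (S n) x * (inverse (cmod (slit_root p q x)))\<^sup>2)\<^sup>2)"
    proof (rule integral_mono)
      fix x :: "real ^ 'n" assume "x \<in> space ?M"
      then have "\<bar>K n x\<bar>\<^sup>2 \<le> (B * (indicator (S n) x * (inverse (cmod (slit_root p q x)))\<^sup>2))\<^sup>2"
        by (intro power_mono Kb) auto
      then show "(K n x)\<^sup>2 \<le> B\<^sup>2 * (indicator (S n) x * (inverse (cmod (slit_root p q x)))\<^sup>2)\<^sup>2"
        by (simp only: power2_abs power_mult_distrib)
    qed (intro L2_square_integrable KL integrable_mult_right bound_L2)+
    also have "\<dots> \<le> B\<^sup>2 * (64 * (real CARD('n) * 2 ^ CARD('n)))"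
      by (subst integral_mult_right_zero) (intro mult_left_mono bound_int zero_le_power2)
    finally show ?thesis .
  qed
  have K0: "(\<lambda>n. LINT x|?M. \<phi> x * K n x) \<longlonglongrightarrow> 0"
  proof (rule tendsto_zero_if_concentrating[OF \<phi> KL KC, where B="\<lambda>n. S n \<inter> sphere 0 1"])
    show "S n \<inter> sphere 0 1 \<in> sets ?M" for n by (rule borel_in_sphere_sets[OF Sb])
    show "K n x = 0" if "x \<in> space ?M" "x \<notin> S n \<inter> sphere 0 1" for n x
      using Kb[of x n] that by auto
    show "\<forall>\<^sub>F n in sequentially. x \<notin> S n \<inter> sphere 0 1" for x
    proof (cases "slit_height p q x = 0")
      case True
      then have "x \<notin> S n" for n using e[of n] by (simp add: S_def)
      then show ?thesis by simp
    next
      case False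
      then have "slit_height p q x / 2 > 0" using slit_height_nonneg[of p q x] by simp
      from order_tendstoD(2)[OF elim this] show ?thesis
        by eventually_elim (simp add: S_def)
    qed
  qed
  have lap_i: "integrable ?M (\<lambda>x. \<phi> x * ?lap x)" by (rule L2_mult_integrable[OF \<phi> slit_lap_L2])
  have cut_conv: "AE x in ?M. (\<lambda>n. slit_cutoff p q (e n) x) \<longlonglongrightarrow> 1"
    using AE_sphere_slit_dom[OF pq]
    by eventually_elim (use slit_cutoff_tendsto_1[of _ p q] in \<open>auto simp: e_def\<close>)
  have cut_int: "integrable ?M (\<lambda>x. slit_cutoff p q (e n) x * f x)" "(\<lambda>n. LINT x|?M. slit_cutoff p q (e n) x * f x) \<longlonglongrightarrow> (LINT x|?M. f x)"
    if f: "integrable ?M f" for f n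
  proof -
    have fm: "f \<in> borel_measurable ?M" using f by auto
    have le: "norm (slit_cutoff p q (e n) x * f x) \<le> \<bar>f x\<bar>" for n x
      using slit_cutoff_bounds[of p q "e n" x] by (simp add: abs_mult mult_left_le_one_le)
    show "integrable ?M (\<lambda>x. slit_cutoff p q (e n) x * f x)"
      by (rule Bochner_Integration.integrable_bound[OF f]) (use fm cm le in auto)
    show "(\<lambda>n. LINT x|?M. slit_cutoff p q (e n) x * f x) \<longlonglongrightarrow> (LINT x|?M. f x)"
    proof (rule integral_dominated_convergence[where w="\<lambda>x. \<bar>f x\<bar>"])
      show "AE x in ?M. (\<lambda>n. slit_cutoff p q (e n) x * f x) \<longlonglongrightarrow> f x"
        using cut_conv
      proof eventually_elim
        case (elim x)
        from tendsto_mult[OF this tendsto_const[of "f x"]] show ?case by simp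
      qed
    qed (use fm cm le f in auto)
  qed
  have lhs: "(LINT x|?M. \<phi> x * sphere_div (X n) x) = (LINT x|?M. \<phi> x * K n x) - (LINT x|?M. slit_cutoff p q (e n) x * (\<phi> x * ?lap x))" for n
  proof -
    have "(LINT x|?M. \<phi> x * sphere_div (X n) x) = (LINT x|?M. \<phi> x * K n x - slit_cutoff p q (e n) x * (\<phi> x * ?lap x))"
    proof (rule integral_cong_AE)
      show "(\<lambda>x. \<phi> x * sphere_div (X n) x) \<in> borel_measurable ?M"
        by (intro borel_measurable_times \<phi>m borel_measurable_sphere_continuous test_field_div_continuous[OF test])
      show "(\<lambda>x. \<phi> x * K n x - slit_cutoff p q (e n) x * (\<phi> x * ?lap x)) \<in> borel_measurable ?M"
        by (intro borel_measurable_diff borel_measurable_times \<phi>m Km cm lapm)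
      show "AE x in ?M. \<phi> x * sphere_div (X n) x = \<phi> x * K n x - slit_cutoff p q (e n) x * (\<phi> x * ?lap x)"
        using div[of n]
      proof eventually_elim
        case (elim x)
        show ?case unfolding elim by (simp add: algebra_simps)
      qed
    qed
    also have "\<dots> = (LINT x|?M. \<phi> x * K n x) - (LINT x|?M. slit_cutoff p q (e n) x * (\<phi> x * ?lap x))"
      by (intro Bochner_Integration.integral_diff L2_mult_integrable \<phi> KL cut_int(1) lap_i)
    finally show ?thesis .
  qed
  have rhs: "(LINT x|?M. G x \<bullet> X n x) = (LINT x|?M. slit_cutoff p q (e n) x * (G x \<bullet> slit_tgrad0 p q j \<alpha> x))" for n
  proof (rule integral_cong_AE)
    show "(\<lambda>x. G x \<bullet> X n x) \<in> borel_measurable ?M"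
      using G' by (intro borel_measurable_inner L2_measurable test_field_measurable[OF test]) auto
    show "(\<lambda>x. slit_cutoff p q (e n) x * (G x \<bullet> slit_tgrad0 p q j \<alpha> x)) \<in> borel_measurable ?M"
      using G' by (intro borel_measurable_times cm borel_measurable_inner L2_measurable slit_tgrad0_L2) auto
    show "AE x in ?M. G x \<bullet> X n x = slit_cutoff p q (e n) x * (G x \<bullet> slit_tgrad0 p q j \<alpha> x)"
      using AE_sphere_slit_dom[OF pq] by eventually_elim (simp add: X_def slit_tgrad0_def)
  qed
  have gi: "integrable ?M (\<lambda>x. G x \<bullet> slit_tgrad0 p q j \<alpha> x)"
    using G' by (intro L2_inner_integrable slit_tgrad0_L2) auto
  have "(\<lambda>n. LINT x|?M. \<phi> x * sphere_div (X n) x) \<longlonglongrightarrow> 0 - (LINT x|?M. \<phi> x * ?lap x)"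
    unfolding lhs by (intro tendsto_diff K0 cut_int(2) lap_i)
  moreover have "(\<lambda>n. LINT x|?M. \<phi> x * sphere_div (X n) x) \<longlonglongrightarrow> - (LINT x|?M. G x \<bullet> slit_tgrad0 p q j \<alpha> x)"
  proof -
    have "(LINT x|?M. \<phi> x * sphere_div (X n) x) = - (LINT x|?M. slit_cutoff p q (e n) x * (G x \<bullet> slit_tgrad0 p q j \<alpha> x))" for n
      using G' test[of n] unfolding rhs[symmetric] by blast
    then show ?thesis using tendsto_minus[OF cut_int(2)[OF gi]] by simp
  qed
  ultimately show ?thesis using LIMSEQ_unique by fastforce
qed

end

section \<open>The weak Laplacian\<close>

text \<open>
  \<open>t\<close> is minus the weak Neumann Laplacian of \<open>u\<close>. Test functions range over the whole Sobolev space, so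
  the boundary condition is part of the definition.
\<close>

definition weak_lap :: "'n::finite \<Rightarrow> 'n \<Rightarrow> (real ^ 'n \<Rightarrow> real) \<Rightarrow> (real ^ 'n \<Rightarrow> real) \<Rightarrow> bool" where
  "weak_lap p q u t \<longleftrightarrow> u \<in> L2 sphere_measure \<and> t \<in> L2 sphere_measure \<and>
     (\<exists>U. has_weak_gradient p q u U \<and>
       (\<forall>\<phi> \<in> L2 sphere_measure. \<forall>G. has_weak_gradient p q \<phi> G \<longrightarrow>
          (LINT x|sphere_measure. G x \<bullet> U x) = (LINT x|sphere_measure. \<phi> x * t x)))"

lemma weak_lap_L2:
  assumes "weak_lap p q u t" shows "u \<in> L2 sphere_measure" "t \<in> L2 sphere_measure"
  using assms by (auto simp: weak_lap_def)

lemma has_weak_gradient_L2: "has_weak_gradient p q u U \<Longrightarrow> U \<in> L2 sphere_measure"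
  by (simp add: has_weak_gradient_def)

lemma has_weak_gradient_add_scale:
  fixes p q :: "'n::finite"
  assumes pq: "p \<noteq> q" and u: "u \<in> L2 sphere_measure" "has_weak_gradient p q u U"
    and v: "v \<in> L2 sphere_measure" "has_weak_gradient p q v V"
  shows "has_weak_gradient p q (\<lambda>x. c * u x + v x) (\<lambda>x. c *\<^sub>R U x + V x)"
proof -
  let ?M = "sphere_measure :: (real ^ 'n) measure"
  note U = u(2)[unfolded has_weak_gradient_iff[OF pq u(1)]] and V = v(2)[unfolded has_weak_gradient_iff[OF pq v(1)]]
  have UL: "U \<in> L2 ?M" "V \<in> L2 ?M" using U V by auto
  have L: "(\<lambda>x. c * u x + v x) \<in> L2 ?M" by (intro L2_add L2_scale u v)
  have "(LINT x|?M. (c * u x + v x) * sphere_div X x) = - (LINT x|?M. (c *\<^sub>R U x + V x) \<bullet> X x)"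
    if X: "X \<in> test_fields p q" for X
  proof -
    have "(LINT x|?M. (c * u x + v x) * sphere_div X x) = (LINT x|?M. c * (u x * sphere_div X x) + v x * sphere_div X x)"
      by (simp add: algebra_simps)
    also have "\<dots> = c * (LINT x|?M. u x * sphere_div X x) + (LINT x|?M. v x * sphere_div X x)"
      using u v sphere_div_test_L2[OF X]
      by (subst Bochner_Integration.integral_add) (auto intro: integrable_mult_right L2_mult_integrable)
    also have "\<dots> = - (c * (LINT x|?M. U x \<bullet> X x) + (LINT x|?M. V x \<bullet> X x))"
      using U V X by simp
    also have "c * (LINT x|?M. U x \<bullet> X x) + (LINT x|?M. V x \<bullet> X x) = (LINT x|?M. c * (U x \<bullet> X x) + V x \<bullet> X x)"
      using UL test_field_L2[OF X]
      by (subst Bochner_Integration.integral_add) (auto intro: integrable_mult_right L2_inner_integrable)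
    finally show ?thesis by (simp add: inner_add_left)
  qed
  moreover have "AE x in ?M. (c *\<^sub>R U x + V x) \<bullet> x = 0"
    using U[THEN conjunct2, THEN conjunct1] V[THEN conjunct2, THEN conjunct1]
    by eventually_elim (simp add: inner_add_left)
  ultimately show ?thesis
    unfolding has_weak_gradient_iff[OF pq L] using L2_vec_add[OF L2_vec_scaleR UL(2)] UL(1) by blast
qed

lemma has_weak_gradient_zero: "p \<noteq> q \<Longrightarrow> has_weak_gradient p q (\<lambda>x. 0) (\<lambda>x. 0)"
  by (simp add: has_weak_gradient_def L2_def set_lebesgue_integral_def)

lemma weak_lap_zero: "p \<noteq> q \<Longrightarrow> weak_lap p q (\<lambda>x. 0) (\<lambda>x. 0)"
  unfolding weak_lap_def
  by (auto simp: L2_zero intro!: exI[of _ "\<lambda>x. 0"] has_weak_gradient_zero)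

lemma weak_lap_add_scale:
  fixes p q :: "'n::finite"
  assumes pq: "p \<noteq> q" and u: "weak_lap p q u t" and v: "weak_lap p q v s"
  shows "weak_lap p q (\<lambda>x. c * u x + v x) (\<lambda>x. c * t x + s x)"
proof -
  let ?M = "sphere_measure :: (real ^ 'n) measure"
  obtain U where U: "has_weak_gradient p q u U"
    "\<And>\<phi> G. \<phi> \<in> L2 ?M \<Longrightarrow> has_weak_gradient p q \<phi> G \<Longrightarrow> (LINT x|?M. G x \<bullet> U x) = (LINT x|?M. \<phi> x * t x)"
    using u by (auto simp: weak_lap_def)
  obtain V where V: "has_weak_gradient p q v V"
    "\<And>\<phi> G. \<phi> \<in> L2 ?M \<Longrightarrow> has_weak_gradient p q \<phi> G \<Longrightarrow> (LINT x|?M. G x \<bullet> V x) = (LINT x|?M. \<phi> x * s x)"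
    using v by (auto simp: weak_lap_def)
  note L = weak_lap_L2[OF u] weak_lap_L2[OF v] has_weak_gradient_L2[OF U(1)] has_weak_gradient_L2[OF V(1)]
  have "(LINT x|?M. G x \<bullet> (c *\<^sub>R U x + V x)) = (LINT x|?M. \<phi> x * (c * t x + s x))"
    if \<phi>: "\<phi> \<in> L2 ?M" "has_weak_gradient p q \<phi> G" for \<phi> G
  proof -
    have GL: "G \<in> L2 ?M" by (rule has_weak_gradient_L2[OF \<phi>(2)])
    have "(LINT x|?M. G x \<bullet> (c *\<^sub>R U x + V x)) = (LINT x|?M. c * (G x \<bullet> U x) + G x \<bullet> V x)"
      by (simp add: inner_add_right)
    also have "\<dots> = c * (LINT x|?M. G x \<bullet> U x) + (LINT x|?M. G x \<bullet> V x)"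
      using GL L by (subst Bochner_Integration.integral_add) (auto intro: integrable_mult_right L2_inner_integrable)
    also have "\<dots> = c * (LINT x|?M. \<phi> x * t x) + (LINT x|?M. \<phi> x * s x)"
      using U(2)[OF \<phi>] V(2)[OF \<phi>] by simp
    also have "\<dots> = (LINT x|?M. c * (\<phi> x * t x) + \<phi> x * s x)"
      using \<phi> L by (subst Bochner_Integration.integral_add) (auto intro: integrable_mult_right L2_mult_integrable)
    finally show ?thesis by (simp add: algebra_simps)
  qed
  then show ?thesis
    unfolding weak_lap_def
    using has_weak_gradient_add_scale[OF pq L(1) U(1) L(3) V(1)] L2_add[OF L2_scale[OF L(1)] L(3)] L2_add[OF L2_scale[OF L(2)] L(4)]
    by blast
qed

lemma weak_lap_symmetric:
  fixes p q :: "'n::finite"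
  assumes u: "weak_lap p q u t" and v: "weak_lap p q v s" and pq: "p \<noteq> q"
  shows "(LINT x|sphere_measure. v x * t x) = (LINT x|sphere_measure. u x * s x)"
proof -
  let ?M = "sphere_measure :: (real ^ 'n) measure"
  obtain U where U: "has_weak_gradient p q u U"
    "\<And>\<phi> G. \<phi> \<in> L2 ?M \<Longrightarrow> has_weak_gradient p q \<phi> G \<Longrightarrow> (LINT x|?M. G x \<bullet> U x) = (LINT x|?M. \<phi> x * t x)"
    using u by (auto simp: weak_lap_def)
  obtain V where V: "has_weak_gradient p q v V"
    "\<And>\<phi> G. \<phi> \<in> L2 ?M \<Longrightarrow> has_weak_gradient p q \<phi> G \<Longrightarrow> (LINT x|?M. G x \<bullet> V x) = (LINT x|?M. \<phi> x * s x)"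
    using v by (auto simp: weak_lap_def)
  show ?thesis
    using U(2)[OF weak_lap_L2(1)[OF v] V(1)] V(2)[OF weak_lap_L2(1)[OF u] U(1)]
    by (simp add: inner_commute)
qed

lemma weak_lap_slit_poly:
  assumes "p \<noteq> q" "\<alpha> \<in> exponents p q"
  shows "weak_lap p q (slit_poly p q j \<alpha>) (slit_lap p q j \<alpha>)"
  unfolding weak_lap_def
  using slit_poly_L2[OF assms(1)] slit_lap_L2[OF assms] slit_poly_weak_gradient[OF assms] slit_poly_green[OF assms]
  by blast

section \<open>Eigenspaces\<close>

lemma H1_iff: "\<phi> \<in> H1 p q \<longleftrightarrow> \<phi> \<in> L2 sphere_measure \<and> has_weak_gradient p q \<phi> (sphere_grad p q \<phi>)"
proof -
  have "has_weak_gradient p q \<phi> (sphere_grad p q \<phi>)" if "has_weak_gradient p q \<phi> G" for G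
    unfolding sphere_grad_def by (rule someI[of "has_weak_gradient p q \<phi>", OF that])
  then show ?thesis by (auto simp: H1_def)
qed

lemma weak_lap_H1: "weak_lap p q u t \<Longrightarrow> u \<in> H1 p q"
  by (auto simp: weak_lap_def H1_def)

text \<open>
  By uniqueness of weak gradients, the chosen gradients in the eigenvalue problem may be replaced by
  the one that witnesses the weak Laplacian.
\<close>

lemma weak_lap_sphere_grad:
  fixes p q :: "'n::finite"
  assumes pq: "p \<noteq> q" and u: "weak_lap p q u t" and \<phi>: "\<phi> \<in> H1 p q"
  shows "(LINT x:slit_sphere p q|sphere_measure. sphere_grad p q u x \<bullet> sphere_grad p q \<phi> x) = (LINT x|sphere_measure. \<phi> x * t x)"
proof -
  let ?M = "sphere_measure :: (real ^ 'n) measure"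
  obtain U where U: "has_weak_gradient p q u U"
    "\<And>\<phi> G. \<phi> \<in> L2 ?M \<Longrightarrow> has_weak_gradient p q \<phi> G \<Longrightarrow> (LINT x|?M. G x \<bullet> U x) = (LINT x|?M. \<phi> x * t x)"
    using u by (auto simp: weak_lap_def)
  have u': "u \<in> L2 ?M" "has_weak_gradient p q u (sphere_grad p q u)"
    using weak_lap_H1[OF u] by (simp_all add: H1_iff)
  have \<phi>': "\<phi> \<in> L2 ?M" "has_weak_gradient p q \<phi> (sphere_grad p q \<phi>)"
    using \<phi> by (simp_all add: H1_iff)
  note m = L2_measurable[OF has_weak_gradient_L2[OF u'(2)]] L2_measurable[OF has_weak_gradient_L2[OF \<phi>'(2)]]
    L2_measurable[OF has_weak_gradient_L2[OF U(1)]]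
  have "(LINT x:slit_sphere p q|sphere_measure. sphere_grad p q u x \<bullet> sphere_grad p q \<phi> x) =
      (LINT x|?M. sphere_grad p q u x \<bullet> sphere_grad p q \<phi> x)"
    by (intro integral_slit_sphere pq borel_measurable_inner m)
  also have "\<dots> = (LINT x|?M. sphere_grad p q \<phi> x \<bullet> U x)"
  proof (rule integral_cong_AE)
    show "AE x in ?M. sphere_grad p q u x \<bullet> sphere_grad p q \<phi> x = sphere_grad p q \<phi> x \<bullet> U x"
      using weak_gradient_unique[OF pq u'(1) u'(2) U(1)] by eventually_elim (simp add: inner_commute)
  qed (intro borel_measurable_inner m)+
  also have "\<dots> = (LINT x|?M. \<phi> x * t x)" by (rule U(2)[OF \<phi>'])
  finally show ?thesis .
qed

lemma eigenspace_L2: "\<psi> \<in> eigenspace p q l \<Longrightarrow> \<psi> \<in> L2 sphere_measure"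
  by (simp add: eigenspace_def H1_def)

lemma weak_lap_eigenspace:
  fixes p q :: "'n::finite"
  assumes pq: "p \<noteq> q" and u: "weak_lap p q u (\<lambda>x. l * u x)"
  shows "u \<in> eigenspace p q l"
  unfolding eigenspace_def
proof (intro CollectI conjI ballI)
  show "u \<in> H1 p q" by (rule weak_lap_H1[OF u])
  fix \<phi> assume \<phi>: "\<phi> \<in> H1 p q"
  then have \<phi>L: "\<phi> \<in> L2 sphere_measure" by (simp add: H1_iff)
  have "(LINT x:slit_sphere p q|sphere_measure. u x * \<phi> x) = (LINT x|sphere_measure. u x * \<phi> x)"
    by (intro integral_slit_sphere pq borel_measurable_times L2_measurable \<phi>L weak_lap_L2(1)[OF u])
  moreover have "(LINT x|sphere_measure. \<phi> x * (l * u x)) = l * (LINT x|sphere_measure. u x * \<phi> x)"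
    by (simp add: mult.left_commute[of _ l] mult.commute[of "\<phi> _"])
  ultimately show "(LINT x:slit_sphere p q|sphere_measure. sphere_grad p q u x \<bullet> sphere_grad p q \<phi> x) =
      l * (LINT x:slit_sphere p q|sphere_measure. u x * \<phi> x)"
    using weak_lap_sphere_grad[OF pq u \<phi>] by simp
qed

text \<open>
  The bilinear form of the problem is evaluated in two ways: by the eigenvalue equation for \<open>\<psi>\<close>, and by
  the weak Laplacian of \<open>u\<close> tested with \<open>\<psi>\<close>.
\<close>

lemma eigenspace_weak_lap_pairing:
  fixes p q :: "'n::finite"
  assumes pq: "p \<noteq> q" and \<psi>: "\<psi> \<in> eigenspace p q l" and u: "weak_lap p q u t"
  shows "(LINT x|sphere_measure. \<psi> x * t x) = l * (LINT x|sphere_measure. \<psi> x * u x)"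
proof -
  have \<psi>H: "\<psi> \<in> H1 p q" and e: "\<And>\<phi>. \<phi> \<in> H1 p q \<Longrightarrow>
     (LINT x:slit_sphere p q|sphere_measure. sphere_grad p q \<psi> x \<bullet> sphere_grad p q \<phi> x) =
        l * (LINT x:slit_sphere p q|sphere_measure. \<psi> x * \<phi> x)"
    using \<psi> by (auto simp: eigenspace_def)
  have "(LINT x|sphere_measure. \<psi> x * t x) = (LINT x:slit_sphere p q|sphere_measure. sphere_grad p q u x \<bullet> sphere_grad p q \<psi> x)"
    by (rule weak_lap_sphere_grad[OF pq u \<psi>H, symmetric])
  also have "\<dots> = l * (LINT x:slit_sphere p q|sphere_measure. \<psi> x * u x)"
    using e[OF weak_lap_H1[OF u]] by (simp add: inner_commute)
  also have "(LINT x:slit_sphere p q|sphere_measure. \<psi> x * u x) = (LINT x|sphere_measure. \<psi> x * u x)"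
    by (intro integral_slit_sphere pq borel_measurable_times L2_measurable eigenspace_L2[OF \<psi>] weak_lap_L2(1)[OF u])
  finally show ?thesis .
qed

section \<open>Gram--Schmidt orthonormalization\<close>

text \<open>
  Vectors whose component orthogonal to the earlier ones is null are skipped, so no linear independence
  is assumed; the bound on \<open>n\<close> is needed for the simplicity of the first eigenvalue.
\<close>

lemma gram_schmidt_L2:
  fixes F V :: "('a \<Rightarrow> real) set"
  assumes V: "V \<subseteq> L2 M" "(\<lambda>x. 0) \<in> V" "\<And>f g c. f \<in> V \<Longrightarrow> g \<in> V \<Longrightarrow> (\<lambda>x. c * f x + g x) \<in> V"
    and F: "finite F" "F \<subseteq> V"
  shows "\<exists>n Y. n \<le> card F \<and> (\<forall>i\<in>{1..n}. Y i \<in> V) \<and>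
    (\<forall>i\<in>{1..n}. \<forall>k\<in>{1..n}. (LINT x|M. Y i x * Y k x) = (if i = k then 1 else 0)) \<and>
    (\<forall>f\<in>F. \<exists>c. AE x in M. f x = (\<Sum>i=1..n. c i * Y i x))"
  using F
proof (induction F rule: finite_induct)
  case empty
  then show ?case by (intro exI[of _ 0]) auto
next
  case (insert f F)
  then have "F \<subseteq> V" by simp
  from insert.IH[OF this] obtain n Y where nY: "n \<le> card F \<and> (\<forall>i\<in>{1..n}. Y i \<in> V) \<and>
    (\<forall>i\<in>{1..n}. \<forall>k\<in>{1..n}. (LINT x|M. Y i x * Y k x) = (if i = k then 1 else 0)) \<and>
    (\<forall>f\<in>F. \<exists>c. AE x in M. f x = (\<Sum>i=1..n. c i * Y i x))" by (elim exE)
  have n: "n \<le> card F" using nY by (rule conjunct1)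
  have YV: "Y i \<in> V" if "i \<in> {1..n}" for i using nY that by blast
  have on: "(LINT x|M. Y i x * Y k x) = (if i = k then 1 else 0)" if "i \<in> {1..n}" "k \<in> {1..n}" for i k
    using nY that by blast
  have sp: "\<exists>c. AE x in M. g x = (\<Sum>i=1..n. c i * Y i x)" if "g \<in> F" for g
    using nY that by blast
  have fV: "f \<in> V" using insert by simp
  define a where "a i = (LINT x|M. f x * Y i x)" for i
  define r where "r x = f x - (\<Sum>i=1..n. a i * Y i x)" for x
  have "m \<le> n \<Longrightarrow> (\<lambda>x. f x - (\<Sum>i=1..m. a i * Y i x)) \<in> V" for m
  proof (induction m)
    case 0
    then show ?case using fV by simp
  next
    case (Suc m)
    then have "(\<lambda>x. (- a (Suc m)) * Y (Suc m) x + (f x - (\<Sum>i=1..m. a i * Y i x))) \<in> V"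
      by (intro V(3) YV) auto
    then show ?case by (simp add: algebra_simps)
  qed
  then have rV: "r \<in> V" unfolding r_def[abs_def] by simp
  have YL: "Y i \<in> L2 M" if "i \<in> {1..n}" for i using YV[OF that] V(1) by blast
  have fL: "f \<in> L2 M" and rL: "r \<in> L2 M" using fV rV V(1) by auto
  have ro: "(LINT x|M. r x * Y k x) = 0" if k: "k \<in> {1..n}" for k
  proof -
    have "(LINT x|M. r x * Y k x) = (LINT x|M. f x * Y k x - (\<Sum>i=1..n. a i * (Y i x * Y k x)))"
      by (simp add: r_def left_diff_distrib sum_distrib_right mult.assoc)
    also have "\<dots> = a k - (LINT x|M. (\<Sum>i=1..n. a i * (Y i x * Y k x)))"
      unfolding a_def[of k] using k
      by (intro Bochner_Integration.integral_diff L2_mult_integrable Bochner_Integration.integrable_sum integrable_mult_right fL YL) auto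
    also have "(LINT x|M. (\<Sum>i=1..n. a i * (Y i x * Y k x))) = (\<Sum>i=1..n. LINT x|M. a i * (Y i x * Y k x))"
      using k by (intro Bochner_Integration.integral_sum integrable_mult_right L2_mult_integrable YL) auto
    also have "\<dots> = (\<Sum>i=1..n. if i = k then a i else 0)"
      using on[OF _ k] by (intro sum.cong) auto
    also have "\<dots> = a k" using k by simp
    finally show ?thesis by simp
  qed
  define s where "s = (LINT x|M. (r x)\<^sup>2)"
  have s0: "0 \<le> s" by (simp add: s_def)
  show ?case
  proof (cases "s = 0")
    case True
    then have "AE x in M. (r x)\<^sup>2 = 0"
      unfolding s_def using integral_nonneg_eq_0_iff_AE[OF L2_square_integrable[OF rL]] by simp
    then have "AE x in M. f x = (\<Sum>i=1..n. a i * Y i x)"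
      by eventually_elim (simp add: r_def)
    then have "\<forall>g\<in>insert f F. \<exists>c. AE x in M. g x = (\<Sum>i=1..n. c i * Y i x)" using sp by blast
    moreover have "n \<le> card (insert f F)" using n insert by simp
    ultimately show ?thesis using YV on by (intro exI[of _ n] exI[of _ Y]) auto
  next
    case False
    then have s: "s > 0" using s0 by simp
    define Y' where "Y' i = (if i = Suc n then (\<lambda>x. (1 / sqrt s) * r x) else Y i)" for i
    have Y'old: "Y' i = Y i" if "i \<in> {1..n}" for i using that by (simp add: Y'_def)
    have Y'V: "Y' i \<in> V" if "i \<in> {1..Suc n}" for i
      using that YV[of i] V(3)[OF rV V(2), of "1 / sqrt s"] by (auto simp: Y'_def le_Suc_eq)
    have nn: "(LINT x|M. ((1 / sqrt s) * r x) * ((1 / sqrt s) * r x)) = 1"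
    proof -
      have "((1 / sqrt s) * r x) * ((1 / sqrt s) * r x) = (1 / s) * (r x)\<^sup>2" for x
        using s by (simp add: power2_eq_square field_simps)
      then have "(LINT x|M. ((1 / sqrt s) * r x) * ((1 / sqrt s) * r x)) = (LINT x|M. (1 / s) * (r x)\<^sup>2)" by simp
      also have "\<dots> = (1 / s) * s" unfolding s_def by (rule integral_mult_right_zero)
      finally show ?thesis using s by simp
    qed
    have no: "(LINT x|M. ((1 / sqrt s) * r x) * Y k x) = 0" if "k \<in> {1..n}" for k
    proof -
      have "(LINT x|M. ((1 / sqrt s) * r x) * Y k x) = (LINT x|M. (1 / sqrt s) * (r x * Y k x))" by (simp add: mult.assoc)
      also have "\<dots> = (1 / sqrt s) * (LINT x|M. r x * Y k x)" by (rule integral_mult_right_zero)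
      finally show ?thesis using ro[OF that] by simp
    qed
    have on': "(LINT x|M. Y' i x * Y' k x) = (if i = k then 1 else 0)" if i: "i \<in> {1..Suc n}" and k: "k \<in> {1..Suc n}" for i k
    proof -
      consider "i \<in> {1..n}" "k \<in> {1..n}" | "i = Suc n" "k = Suc n" | "i = Suc n" "k \<in> {1..n}" | "i \<in> {1..n}" "k = Suc n"
        using i k by (auto simp: le_Suc_eq)
      then show ?thesis
      proof cases
        case 1
        then show ?thesis using on by (simp add: Y'old)
      next
        case 2
        then have "Y' i = (\<lambda>x. (1 / sqrt s) * r x)" "Y' k = (\<lambda>x. (1 / sqrt s) * r x)" "i = k" by (simp_all add: Y'_def)
        then show ?thesis by (simp only: nn if_True simp_thms)
      next
        case 3
        then have "Y' i = (\<lambda>x. (1 / sqrt s) * r x)" "Y' k = Y k" "(i = k) = False" by (auto simp: Y'_def)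
        then show ?thesis by (simp only: no[OF 3(2)] if_False)
      next
        case 4
        then have "Y' k = (\<lambda>x. (1 / sqrt s) * r x)" "Y' i = Y i" "(i = k) = False" by (auto simp: Y'_def)
        then show ?thesis by (simp only: mult.commute[of "Y i _"] no[OF 4(1)] if_False)
      qed
    qed
    have ext: "(\<Sum>i=1..n. c i * Y i x) = (\<Sum>i=1..Suc n. (c(Suc n := 0)) i * Y' i x)" for c x
    proof -
      have "(\<Sum>i=1..n. (c(Suc n := 0)) i * Y' i x) = (\<Sum>i=1..n. c i * Y i x)"
        by (intro sum.cong) (auto simp: Y'_def)
      then show ?thesis by simp
    qed
    have old: "\<exists>c. AE x in M. g x = (\<Sum>i=1..Suc n. c i * Y' i x)" if "g \<in> F" for g
      using sp[OF that] unfolding ext by blast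
    have new: "\<exists>c. AE x in M. f x = (\<Sum>i=1..Suc n. c i * Y' i x)"
    proof (intro exI[of _ "a(Suc n := sqrt s)"] AE_I2)
      fix x
      have "(\<Sum>i=1..n. (a(Suc n := sqrt s)) i * Y' i x) = (\<Sum>i=1..n. a i * Y i x)"
        by (intro sum.cong) (auto simp: Y'_def)
      then show "f x = (\<Sum>i=1..Suc n. (a(Suc n := sqrt s)) i * Y' i x)"
        using s by (simp add: Y'_def r_def)
    qed
    have "Suc n \<le> card (insert f F)" using n insert by simp
    then show ?thesis using Y'V on' old new by (intro exI[of _ "Suc n"] exI[of _ Y']) blast
  qed
qed

section \<open>The eigenvalues\<close>

definition slit_eigenvalue :: "nat \<Rightarrow> nat \<Rightarrow> real" where
  "slit_eigenvalue N k = real k * (real k + 2 * real N - 4) / 4"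

lemma slit_eigenvalue_strict_mono:
  assumes "N \<ge> 2" shows "strict_mono (slit_eigenvalue N)"
proof (rule strict_monoI_Suc)
  fix k
  have "slit_eigenvalue N (Suc k) - slit_eigenvalue N k = (2 * real k + 2 * real N - 3) / 4"
    by (simp add: slit_eigenvalue_def field_simps)
  moreover have "0 < (2 * real k + 2 * real N - 3) / 4" using assms by simp
  ultimately show "slit_eigenvalue N k < slit_eigenvalue N (Suc k)"
    unfolding less_iff_diff_less_0[of "slit_eigenvalue N k"] by simp
qed

lemma slit_eigenvalue_zero [simp]: "slit_eigenvalue N 0 = 0"
  by (simp add: slit_eigenvalue_def)

lemma slit_eigenvalue_nonneg: "N \<ge> 2 \<Longrightarrow> 0 \<le> slit_eigenvalue N k"
  using strict_mono_less_eq[OF slit_eigenvalue_strict_mono, of N 0 k] by simp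

lemma slit_eigenvalue_at_top:
  assumes "N \<ge> 2" shows "filterlim (slit_eigenvalue N) at_top sequentially"
proof (rule filterlim_at_top_mono)
  show "filterlim (\<lambda>k. real k / 4) at_top sequentially"
    using filterlim_tendsto_pos_mult_at_top[OF tendsto_const[of "1/4"] _ filterlim_real_sequentially] by simp
  have "real k / 4 \<le> slit_eigenvalue N k" for k
  proof (cases "k = 0")
    case False
    then have "real k * 1 \<le> real k * (real k + 2 * real N - 4)" using assms by (intro mult_left_mono) auto
    then show ?thesis by (simp add: slit_eigenvalue_def)
  qed simp
  then show "\<forall>\<^sub>F k in sequentially. real k / 4 \<le> slit_eigenvalue N k" by simp
qed

lemma sphere_measure_nontrivial: "\<not> (AE x in sphere_measure. False)"
proof
  let ?M = "sphere_measure :: (real ^ 'a) measure"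
  assume "AE x in ?M. False"
  then have "(\<integral>\<^sup>+x. 1 \<partial>?M) = (\<integral>\<^sup>+x. 0 \<partial>?M)" by (intro nn_integral_cong_AE) simp
  then have "ennreal (real CARD('a)) * (\<integral>\<^sup>+x. 1 * indicator (cball 0 1 - {0}) x \<partial>(lborel :: (real ^ 'a) measure)) = 0"
    using nn_integral_sphere[of "\<lambda>x::real ^ 'a. 1"] by simp
  then have "emeasure lborel (cball 0 1 - {0 :: real ^ 'a}) = 0" by simp
  moreover have "emeasure lborel (cball 0 1 - {0 :: real ^ 'a}) = emeasure lborel (cball (0 :: real ^ 'a) 1)"
    by (rule emeasure_Diff_null_set) auto
  moreover have "emeasure lborel (cball (0 :: real ^ 'a) 1) > 0"
    by (simp add: emeasure_cball)
  ultimately show False by simp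
qed

lemma has_weak_gradient_AE_zero:
  fixes p q :: "'n::finite"
  assumes pq: "p \<noteq> q" and u: "u \<in> L2 sphere_measure" "AE x in sphere_measure. u x = 0"
  shows "has_weak_gradient p q u (\<lambda>x. 0)"
proof -
  have "(LINT x|sphere_measure. u x * sphere_div X x) = 0" for X
    by (rule integral_eq_zero_AE) (use u(2) in \<open>eventually_elim, simp\<close>)
  then show ?thesis unfolding has_weak_gradient_iff[OF pq u(1)] by (simp add: L2_def)
qed

lemma conj_embed_eq_0:
  assumes "p \<noteq> q" "conj_embed p q c = 0" shows "c = 0"
proof -
  have "conj_embed p q c $ p = Re c" "conj_embed p q c $ q = - Im c"
    using assms(1) by (simp_all add: conj_embed_def axis_def)
  then show ?thesis using assms(2) by (simp add: complex_eq_iff)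
qed

text \<open>
  A function that vanishes almost everywhere has weak gradient zero, whereas the gradient of
  \<open>Re (w\<^sup>k)\<close> has no zero off the slit for \<open>k > 0\<close>.
\<close>

lemma slit_poly_not_AE_zero:
  fixes p q :: "'n::finite"
  assumes pq: "p \<noteq> q"
  shows "\<not> (AE x in sphere_measure. slit_poly p q k (\<lambda>_. 0) x = 0)"
proof
  let ?M = "sphere_measure :: (real ^ 'n) measure" and ?u = "slit_poly p q k (\<lambda>_. 0)"
  note z = exponents_zero[of p q]
  assume u0: "AE x in ?M. ?u x = 0"
  have "AE x in ?M. slit_tgrad0 p q k (\<lambda>_. 0) x = 0"
    by (rule weak_gradient_unique[OF pq slit_poly_L2[OF pq] slit_poly_weak_gradient[OF pq z]
          has_weak_gradient_AE_zero[OF pq slit_poly_L2[OF pq] u0]])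
  then have "AE x in ?M. False"
    using u0 AE_sphere_slit_dom[OF pq]
  proof eventually_elim
    case (elim x)
    then have x: "x \<in> slit_dom p q" by simp
    have w: "slit_root p q x \<noteq> 0" by (rule slit_dom_root_nonzero[OF x])
    show False
    proof (cases "k = 0")
      case True
      then show False using elim(2) by (simp add: slit_poly_def)
    next
      case False
      have "slit_grad p q k (\<lambda>_. 0) x = 0"
        using elim x by (simp add: slit_tgrad0_def slit_tgrad_def)
      then have "conj_embed p q (of_nat k / 2 * slit_root p q x powi (int k - 2)) = 0"
        by (simp add: slit_grad_def monom_grad_def)
      then have "of_nat k / 2 * slit_root p q x powi (int k - 2) = 0"
        by (rule conj_embed_eq_0[OF pq])
      then show False using w False by (simp add: power_int_eq_0_iff)
    qed
  qed
  then show False using sphere_measure_nontrivial by blast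
qed

section \<open>Triangular diagonalization\<close>

definition slit_eigenfuns :: "'n::finite \<Rightarrow> 'n \<Rightarrow> nat \<Rightarrow> nat \<Rightarrow> (real ^ 'n \<Rightarrow> real) set" where
  "slit_eigenfuns p q N k = {f \<in> slit_span p q. weak_lap p q f (\<lambda>x. slit_eigenvalue N k * f x)}"

text \<open>
  The level \<open>k\<close> is twice the degree of homogeneity.
\<close>

definition level :: "'n::finite \<Rightarrow> 'n \<Rightarrow> nat \<Rightarrow> (nat \<times> ('n \<Rightarrow> nat)) set" where
  "level p q k = {(j, \<alpha>). \<alpha> \<in> exponents p q \<and> j + 2 * tdeg \<alpha> = k}"

context
  fixes p q :: "'n::finite" and N :: nat
  assumes pq: "p \<noteq> q" and N: "N = CARD('n)" "N \<ge> 2"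
begin

lemma slit_eigenvalue_eq_iff: "slit_eigenvalue N k = slit_eigenvalue N l \<longleftrightarrow> k = l"
  using strict_mono_eq[OF slit_eigenvalue_strict_mono[OF N(2)]] .

lemma slit_eigenfuns_lin: "f \<in> slit_eigenfuns p q N k \<Longrightarrow> g \<in> slit_eigenfuns p q N k \<Longrightarrow> (\<lambda>x. c * f x + g x) \<in> slit_eigenfuns p q N k"
proof -
  assume f: "f \<in> slit_eigenfuns p q N k" and g: "g \<in> slit_eigenfuns p q N k"
  have "(\<lambda>x. c * f x + g x) \<in> slit_span p q"
    using f g unfolding slit_eigenfuns_def slit_span_def by (auto intro: lin_span_add lin_span_scale)
  moreover have "weak_lap p q (\<lambda>x. c * f x + g x) (\<lambda>x. c * (slit_eigenvalue N k * f x) + slit_eigenvalue N k * g x)"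
    using f g by (intro weak_lap_add_scale pq) (auto simp: slit_eigenfuns_def)
  moreover have "(\<lambda>x. c * (slit_eigenvalue N k * f x) + slit_eigenvalue N k * g x) = (\<lambda>x. slit_eigenvalue N k * (c * f x + g x))"
    by (simp add: algebra_simps)
  ultimately show ?thesis by (simp add: slit_eigenfuns_def)
qed

lemma slit_eigenfuns_zero: "(\<lambda>x. 0) \<in> slit_eigenfuns p q N k"
  using weak_lap_zero[OF pq] by (simp add: slit_eigenfuns_def slit_span_def lin_span.zero)

lemma slit_eigenfuns_L2: "slit_eigenfuns p q N k \<subseteq> L2 sphere_measure"
  using slit_span_L2[OF pq] by (auto simp: slit_eigenfuns_def)

lemma finite_level: "finite (level p q k)"
proof (rule finite_subset)
  show "level p q k \<subseteq> {..k} \<times> PiE UNIV (\<lambda>_. {..k})"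
  proof
    fix i assume "i \<in> level p q k"
    then obtain j \<alpha> where i: "i = (j, \<alpha>)" "j + 2 * tdeg \<alpha> = k" by (auto simp: level_def)
    have "\<alpha> n \<le> k" for n
    proof -
      have "\<alpha> n \<le> tdeg \<alpha>" by (rule member_le_sum) auto
      then show ?thesis using i(2) by linarith
    qed
    then show "i \<in> {..k} \<times> PiE UNIV (\<lambda>_. {..k})" using i by (auto simp: PiE_UNIV_domain)
  qed
  show "finite ({..k} \<times> PiE (UNIV :: 'n set) (\<lambda>_. {..k}))"
    by (intro finite_cartesian_product finite_PiE) auto
qed

lemma slit_degree_eigenvalue:
  assumes "\<alpha> \<in> exponents p q"
  shows "slit_degree j \<alpha> * (slit_degree j \<alpha> + real CARD('n) - 2) = slit_eigenvalue N (j + 2 * tdeg \<alpha>)"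
proof -
  define w where "w = j + 2 * tdeg \<alpha>"
  have d: "slit_degree j \<alpha> = real w / 2"
    by (simp only: w_def slit_degree_def of_nat_add of_nat_mult of_nat_numeral) simp
  show ?thesis unfolding d w_def[symmetric] slit_eigenvalue_def N(1)[symmetric] by (simp add: field_simps)
qed

text \<open>
  On a sum of eigenspaces of levels below \<open>k\<close> the operator minus the eigenvalue of level \<open>k\<close> is
  invertible, because the eigenvalues are distinct.
\<close>

lemma resolvent_solution:
  assumes V: "\<And>l. l < k \<Longrightarrow> V l \<subseteq> slit_eigenfuns p q N l" and g: "g \<in> lin_span (\<Union>l\<in>{..<k}. V l)"
  shows "\<exists>v\<in>lin_span (\<Union>l\<in>{..<k}. V l). weak_lap p q v (\<lambda>x. slit_eigenvalue N k * v x - g x)"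
  using g
proof (induction rule: lin_span.induct)
  case zero
  show ?case using weak_lap_zero[OF pq] by (intro bexI[OF _ lin_span.zero]) simp
next
  case (step b g c)
  then obtain v where v: "v \<in> lin_span (\<Union>l\<in>{..<k}. V l)" "weak_lap p q v (\<lambda>x. slit_eigenvalue N k * v x - g x)" by blast
  obtain l where l: "l < k" "b \<in> V l" using step(1) by blast
  then have b: "weak_lap p q b (\<lambda>x. slit_eigenvalue N l * b x)" using V by (auto simp: slit_eigenfuns_def)
  have d: "slit_eigenvalue N k - slit_eigenvalue N l \<noteq> 0" using l slit_eigenvalue_eq_iff[of k l] by simp
  define a where "a = c / (slit_eigenvalue N k - slit_eigenvalue N l)"
  have a: "a * (slit_eigenvalue N k - slit_eigenvalue N l) = c" using d by (simp add: a_def)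
  have "weak_lap p q (\<lambda>x. a * b x + v x) (\<lambda>x. a * (slit_eigenvalue N l * b x) + (slit_eigenvalue N k * v x - g x))"
    by (rule weak_lap_add_scale[OF pq b v(2)])
  also have "(\<lambda>x. a * (slit_eigenvalue N l * b x) + (slit_eigenvalue N k * v x - g x)) = (\<lambda>x. slit_eigenvalue N k * (a * b x + v x) - (c * b x + g x))"
    by (simp add: a[symmetric] algebra_simps)
  finally show ?case using lin_span.step[OF step(1) v(1), of a] by (intro bexI)
qed

lemma lower_lower:
  assumes "\<alpha> \<in> exponents p q" "2 \<le> \<alpha> i"
  shows "lower (lower \<alpha> i) i \<in> exponents p q" "tdeg (lower (lower \<alpha> i) i) + 2 = tdeg \<alpha>"
proof -
  show "lower (lower \<alpha> i) i \<in> exponents p q" using assms by (auto simp: exponents_def lower_def)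
  have "Suc (tdeg (lower (lower \<alpha> i) i)) = tdeg (lower \<alpha> i)"
    by (rule tdeg_lower) (use assms in \<open>simp add: lower_def\<close>)
  moreover have "Suc (tdeg (lower \<alpha> i)) = tdeg \<alpha>"
    by (rule tdeg_lower) (use assms in simp)
  ultimately show "tdeg (lower (lower \<alpha> i) i) + 2 = tdeg \<alpha>" by linarith
qed

text \<open>
  The operator maps a product of level \<open>k\<close> to the eigenvalue of level \<open>k\<close> times the product, minus a
  combination \<open>g\<close> of products of level \<open>k - 4\<close>. Inductively, \<open>g\<close> is a combination of the eigenfunctions \<open>F\<close>
  constructed at lower levels; solving for the correction \<open>v\<close> turns the product into an eigenfunction.
  The family \<open>F\<close> is obtained by dependent choice along the levels, so that the span of the lower
  eigenfunctions is generated by finitely many of them at each level.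
\<close>

lemma triangular_diagonalization:
  "\<exists>F. \<forall>k. \<forall>i\<in>level p q k. F k i \<in> slit_eigenfuns p q N k \<and>
     (\<lambda>x. slit_poly p q (fst i) (snd i) x - F k i x) \<in> lin_span (\<Union>l\<in>{..<k}. F l ` level p q l)"
proof -
  define P where "P F k r = (\<forall>i\<in>level p q k. r i \<in> slit_eigenfuns p q N k \<and>
     (\<lambda>x. slit_poly p q (fst i) (snd i) x - r i x) \<in> lin_span (\<Union>l\<in>{..<k}. F l ` level p q l))"
    for F :: "nat \<Rightarrow> nat \<times> ('n \<Rightarrow> nat) \<Rightarrow> real ^ 'n \<Rightarrow> real" and k r
  have "\<exists>F. \<forall>k. P F k (F k)"
  proof (rule dependent_wf_choice[OF wf_less_than])
    fix F G :: "nat \<Rightarrow> nat \<times> ('n \<Rightarrow> nat) \<Rightarrow> real ^ 'n \<Rightarrow> real" and k r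
    assume "\<And>l. (l, k) \<in> less_than \<Longrightarrow> F l = G l"
    then have "(\<Union>l\<in>{..<k}. F l ` level p q l) = (\<Union>l\<in>{..<k}. G l ` level p q l)" by (intro SUP_cong) auto
    then show "P F k r = P G k r" by (simp only: P_def)
  next
    fix k and F :: "nat \<Rightarrow> nat \<times> ('n \<Rightarrow> nat) \<Rightarrow> real ^ 'n \<Rightarrow> real"
    assume "\<And>l. (l, k) \<in> less_than \<Longrightarrow> P F l (F l)"
    then have PF: "P F l (F l)" if "l < k" for l using that by simp
    let ?D = "\<lambda>k. lin_span (\<Union>l\<in>{..<k}. F l ` level p q l)"
    have V: "F l ` level p q l \<subseteq> slit_eigenfuns p q N l" if "l < k" for l using PF[OF that] by (auto simp: P_def)
    have below: "slit_poly p q j \<alpha> \<in> ?D k" if "(j, \<alpha>) \<in> level p q l" "l < k" for j \<alpha> l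
    proof -
      have "(\<lambda>x. slit_poly p q j \<alpha> x - F l (j, \<alpha>) x) \<in> ?D l" using PF[OF that(2)] that(1) by (force simp: P_def)
      then have "(\<lambda>x. slit_poly p q j \<alpha> x - F l (j, \<alpha>) x) \<in> ?D k"
        using lin_span_mono[of "\<Union>l\<in>{..<l}. F l ` level p q l" "\<Union>l\<in>{..<k}. F l ` level p q l"] that(2) by fastforce
      moreover have "F l (j, \<alpha>) \<in> ?D k" by (rule lin_span_base) (use that in blast)
      ultimately have "(\<lambda>x. (slit_poly p q j \<alpha> x - F l (j, \<alpha>) x) + F l (j, \<alpha>) x) \<in> ?D k" by (rule lin_span_add)
      then show ?thesis by simp
    qed
    have "\<exists>f. f \<in> slit_eigenfuns p q N k \<and> (\<lambda>x. slit_poly p q (fst i) (snd i) x - f x) \<in> ?D k" if "i \<in> level p q k" for i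
    proof -
      obtain j \<alpha> where i: "i = (j, \<alpha>)" by (cases i)
      have \<alpha>: "\<alpha> \<in> exponents p q" and k: "j + 2 * tdeg \<alpha> = k" using that by (auto simp: i level_def)
      \<comment> \<open>\<open>Re (w\<^sup>j)\<close> times the Laplacian of the monomial\<close>
      define g where "g x = (\<Sum>i\<in>UNIV. real (\<alpha> i) * real (\<alpha> i - 1) * slit_poly p q j (lower (lower \<alpha> i) i) x)" for x
      have "g \<in> ?D k" unfolding g_def[abs_def]
      proof (rule lin_span_sum)
        fix i
        show "(\<lambda>x. real (\<alpha> i) * real (\<alpha> i - 1) * slit_poly p q j (lower (lower \<alpha> i) i) x) \<in> ?D k"
        proof (cases "2 \<le> \<alpha> i")
          case True
          note ll = lower_lower[OF \<alpha> True]
          then have "(j, lower (lower \<alpha> i) i) \<in> level p q (j + 2 * tdeg (lower (lower \<alpha> i) i))" by (simp add: level_def)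
          then have "slit_poly p q j (lower (lower \<alpha> i) i) \<in> ?D k" by (rule below) (use ll(2) k in linarith)
          then show ?thesis by (rule lin_span_scale)
        next
          case False
          then have "real (\<alpha> i) * real (\<alpha> i - 1) = 0" by (cases "\<alpha> i") auto
          then show ?thesis by (simp only: mult_zero_left lin_span.zero)
        qed
      qed
      from resolvent_solution[OF V this] obtain v where v: "v \<in> ?D k" "weak_lap p q v (\<lambda>x. slit_eigenvalue N k * v x - g x)" by blast
      define f where "f x = - 1 * v x + slit_poly p q j \<alpha> x" for x
      have lap: "slit_lap p q j \<alpha> = (\<lambda>x. slit_eigenvalue N k * slit_poly p q j \<alpha> x - g x)"
        by (rule ext) (simp only: slit_lap_expand[OF pq \<alpha>] slit_degree_eigenvalue[OF \<alpha>] k g_def)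
      have "weak_lap p q f (\<lambda>x. - 1 * (slit_eigenvalue N k * v x - g x) + slit_lap p q j \<alpha> x)"
        unfolding f_def[abs_def] by (rule weak_lap_add_scale[OF pq v(2) weak_lap_slit_poly[OF pq \<alpha>]])
      also have "(\<lambda>x. - 1 * (slit_eigenvalue N k * v x - g x) + slit_lap p q j \<alpha> x) = (\<lambda>x. slit_eigenvalue N k * f x)"
        unfolding lap f_def by (simp add: algebra_simps)
      finally have fl: "weak_lap p q f (\<lambda>x. slit_eigenvalue N k * f x)" .
      have "(\<Union>l\<in>{..<k}. F l ` level p q l) \<subseteq> slit_span p q" using V by (auto simp: slit_eigenfuns_def)
      then have "v \<in> slit_span p q" using v(1) lin_span_subset unfolding slit_span_def by blast
      then have "f \<in> slit_span p q" unfolding f_def[abs_def]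
        using slit_poly_in_span[OF \<alpha>, of j] unfolding slit_span_def by (intro lin_span_add lin_span_scale)
      then have "f \<in> slit_eigenfuns p q N k" using fl by (simp add: slit_eigenfuns_def)
      moreover have "(\<lambda>x. slit_poly p q j \<alpha> x - f x) = v" by (simp add: f_def)
      ultimately show ?thesis using v(1) by (intro exI[of _ f]) (simp add: i)
    qed
    then have "\<exists>r. \<forall>i\<in>level p q k. r i \<in> slit_eigenfuns p q N k \<and> (\<lambda>x. slit_poly p q (fst i) (snd i) x - r i x) \<in> ?D k"
      by (intro bchoice ballI)
    then show "\<exists>r. P F k r" by (simp only: P_def)
  qed
  then show ?thesis by (simp only: P_def)
qed

lemma slit_eigenfuns_orthogonal:
  assumes f: "f \<in> slit_eigenfuns p q N k" and g: "g \<in> slit_eigenfuns p q N l" and "k \<noteq> l"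
  shows "(LINT x|sphere_measure. f x * g x) = 0"
proof -
  let ?M = "sphere_measure :: (real ^ 'n) measure"
  have "(LINT x|?M. g x * (slit_eigenvalue N k * f x)) = (LINT x|?M. f x * (slit_eigenvalue N l * g x))"
    using f g by (intro weak_lap_symmetric[OF _ _ pq]) (auto simp: slit_eigenfuns_def)
  then have "slit_eigenvalue N k * (LINT x|?M. f x * g x) = slit_eigenvalue N l * (LINT x|?M. f x * g x)"
    by (simp add: mult.left_commute[of _ "slit_eigenvalue N _"] mult.commute[of "g _"])
  then show ?thesis using slit_eigenvalue_eq_iff[of k l] \<open>k \<noteq> l\<close> by simp
qed

lemma eigenspace_slit_eigenfuns_orthogonal:
  assumes \<psi>: "\<psi> \<in> eigenspace p q l" and f: "f \<in> slit_eigenfuns p q N k" and "l \<noteq> slit_eigenvalue N k"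
  shows "(LINT x|sphere_measure. \<psi> x * f x) = 0"
proof -
  let ?M = "sphere_measure :: (real ^ 'n) measure"
  have "(LINT x|?M. \<psi> x * (slit_eigenvalue N k * f x)) = l * (LINT x|?M. \<psi> x * f x)"
    using f by (intro eigenspace_weak_lap_pairing[OF pq \<psi>]) (simp add: slit_eigenfuns_def)
  then have "slit_eigenvalue N k * (LINT x|?M. \<psi> x * f x) = l * (LINT x|?M. \<psi> x * f x)"
    by (simp add: mult.left_commute[of _ "slit_eigenvalue N _"])
  then show ?thesis using \<open>l \<noteq> slit_eigenvalue N k\<close> by simp
qed

lemma slit_eigenfuns_eigenspace: "f \<in> slit_eigenfuns p q N k \<Longrightarrow> f \<in> eigenspace p q (slit_eigenvalue N k)"
  by (intro weak_lap_eigenspace[OF pq]) (simp add: slit_eigenfuns_def)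

text \<open>
  Together with the expansion of eigenfunctions in finitely many elements of the span, this gives their
  boundedness.
\<close>

lemma slit_span_bounded:
  assumes "f \<in> slit_span p q" shows "\<exists>B. \<forall>x. norm x = 1 \<longrightarrow> \<bar>f x\<bar> \<le> B"
proof -
  have "f \<in> {f. \<exists>B. \<forall>x. norm x = 1 \<longrightarrow> \<bar>f x\<bar> \<le> B}"
    using assms unfolding slit_span_def
  proof (rule lin_span_in)
    fix b assume "b \<in> {slit_poly p q j \<alpha> |j \<alpha>. \<alpha> \<in> exponents p q}"
    then show "b \<in> {f. \<exists>B. \<forall>x. norm x = 1 \<longrightarrow> \<bar>f x\<bar> \<le> B}"
      by (auto intro!: exI[of _ 1] slit_poly_bounded[OF pq])
  next
    fix f g :: "real ^ 'n \<Rightarrow> real"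
    assume "f \<in> {f. \<exists>B. \<forall>x. norm x = 1 \<longrightarrow> \<bar>f x\<bar> \<le> B}" "g \<in> {f. \<exists>B. \<forall>x. norm x = 1 \<longrightarrow> \<bar>f x\<bar> \<le> B}"
    then obtain B C where "\<And>x. norm x = 1 \<Longrightarrow> \<bar>f x\<bar> \<le> B" "\<And>x. norm x = 1 \<Longrightarrow> \<bar>g x\<bar> \<le> C" by auto
    then have "\<bar>f x + g x\<bar> \<le> B + C" if "norm x = 1" for x
      using that abs_triangle_ineq[of "f x" "g x"] by (meson add_mono order_trans)
    then show "(\<lambda>x. f x + g x) \<in> {f. \<exists>B. \<forall>x. norm x = 1 \<longrightarrow> \<bar>f x\<bar> \<le> B}" by blast
  next
    fix c and f :: "real ^ 'n \<Rightarrow> real"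
    assume "f \<in> {f. \<exists>B. \<forall>x. norm x = 1 \<longrightarrow> \<bar>f x\<bar> \<le> B}"
    then obtain B where "\<And>x. norm x = 1 \<Longrightarrow> \<bar>f x\<bar> \<le> B" by auto
    then have "\<bar>c * f x\<bar> \<le> \<bar>c\<bar> * B" if "norm x = 1" for x
      using that by (simp add: abs_mult mult_left_mono)
    then show "(\<lambda>x. c * f x) \<in> {f. \<exists>B. \<forall>x. norm x = 1 \<longrightarrow> \<bar>f x\<bar> \<le> B}" by blast
  qed auto
  then show ?thesis by simp
qed

text \<open>
  The functions \<open>Re (w\<^sup>k)\<close> need no correction. They show that every level contributes an eigenvalue.
\<close>

lemma slit_poly_zero_eigenfun: "slit_poly p q k (\<lambda>_. 0) \<in> slit_eigenfuns p q N k"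
proof -
  have "slit_lap p q k (\<lambda>_. 0) = (\<lambda>x. slit_eigenvalue N k * slit_poly p q k (\<lambda>_. 0) x)"
    by (rule ext) (simp only: slit_lap_expand[OF pq exponents_zero] slit_degree_eigenvalue[OF exponents_zero], simp)
  then show ?thesis
    using weak_lap_slit_poly[OF pq exponents_zero, of k] slit_poly_in_span[OF exponents_zero, of p q k]
    by (simp add: slit_eigenfuns_def)
qed

end

section \<open>The spectrum of the slit sphere\<close>

text \<open>
  Each level is orthonormalized separately; different levels are orthogonal by symmetry. The resulting
  family \<open>e\<close> spans the same space as the products up to null functions, so it is complete. An eigenfunction
  for \<open>l\<close> is orthogonal to all members of \<open>e\<close> whose eigenvalue differs from \<open>l\<close>. Hence \<open>l\<close> is the
  eigenvalue of some level, and subtracting the Fourier sum over that level leaves a null function.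
\<close>

theorem proposition6p2:
  fixes p q :: "'n::finite" and N :: nat
  assumes "N = CARD('n)" and "N \<ge> 2" and "p \<noteq> q"
  shows "\<exists>(\<mu> :: nat \<Rightarrow> real) (m :: nat \<Rightarrow> nat) (Y :: nat \<Rightarrow> nat \<Rightarrow> real ^ 'n \<Rightarrow> real).
    (point_spectrum p q = range \<mu> \<and> strict_mono \<mu> \<and> filterlim \<mu> at_top sequentially \<and>
     (\<forall>k. \<mu> k \<ge> 0) \<and> (\<forall>k. has_multiplicity p q (\<mu> k) (m k)) \<and>
     \<mu> 0 = 0 \<and> m 0 = 1 \<and>
     L2_orthonormal_basis sphere_measure {(k, i). i \<in> {1..m k}} (\<lambda>(k, i). Y k i) \<and>
     (\<forall>k. \<forall>i\<in>{1..m k}. eigenfunction p q (\<mu> k) (Y k i)) \<and>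
     (\<forall>k. AE_basis sphere_measure (eigenspace p q (\<mu> k)) (m k) (Y k))) \<and>
    ((\<forall>k. \<mu> k = real k * (real k + 2 * real N - 4) / 4) \<and>
     (\<forall>l \<psi>. eigenfunction p q l \<psi> \<longrightarrow> \<psi> \<in> L_infinity sphere_measure))"
proof -
  note N = assms(1,2) and pq = assms(3)
  let ?M = "sphere_measure :: (real ^ 'n) measure"
  let ?\<mu> = "slit_eigenvalue N" and ?E = "slit_eigenfuns p q N"
  obtain F where F: "\<And>k i. i \<in> level p q k \<Longrightarrow> F k i \<in> ?E k"
    "\<And>k i. i \<in> level p q k \<Longrightarrow> (\<lambda>x. slit_poly p q (fst i) (snd i) x - F k i x) \<in> lin_span (\<Union>l\<in>{..<k}. F l ` level p q l)"
    using triangular_diagonalization[OF pq N] by blast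
  define Q where "Q k n Y \<longleftrightarrow> n \<le> card (F k ` level p q k) \<and> (\<forall>i\<in>{1..n}. Y i \<in> ?E k) \<and>
    (\<forall>i\<in>{1..n}. \<forall>j\<in>{1..n}. (LINT x|?M. Y i x * Y j x) = (if i = j then 1 else 0)) \<and>
    (\<forall>f\<in>F k ` level p q k. \<exists>c. AE x in ?M. f x = (\<Sum>i=1..n. c i * Y i x))" for k n Y
  have "\<exists>n Y. Q k n Y" for k
    unfolding Q_def
    by (rule gram_schmidt_L2[OF slit_eigenfuns_L2[OF pq N] slit_eigenfuns_zero[OF pq N] slit_eigenfuns_lin[OF pq N]])
      (use F(1) in \<open>auto intro: finite_imageI finite_level[OF pq N]\<close>)
  then obtain m Y where mY: "\<And>k. Q k (m k) (Y k)" by metis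
  have m_le: "m k \<le> card (F k ` level p q k)" for k using mY[of k] by (simp add: Q_def)
  have YE: "Y k i \<in> ?E k" if "i \<in> {1..m k}" for k i using mY[of k] that by (simp add: Q_def)
  have on: "(LINT x|?M. Y k i x * Y k j x) = (if i = j then 1 else 0)" if "i \<in> {1..m k}" "j \<in> {1..m k}" for k i j
    using mY[of k] that unfolding Q_def by blast
  have sp: "\<exists>c. AE x in ?M. F k i x = (\<Sum>i=1..m k. c i * Y k i x)" if "i \<in> level p q k" for k i
    using mY[of k] that unfolding Q_def by blast
  have YL: "Y k i \<in> L2 ?M" if "i \<in> {1..m k}" for k i using YE[OF that] slit_eigenfuns_L2[OF pq N] by blast
  define I where "I = {(k, i). i \<in> {1..m k}}"
  define e where "e = (\<lambda>(k, i). Y k i)"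
  have e_E: "e ki \<in> ?E (fst ki)" if "ki \<in> I" for ki using that YE by (auto simp: I_def e_def)
  have e_L2: "e ki \<in> L2 ?M" if "ki \<in> I" for ki using that YL by (auto simp: I_def e_def)
  have e_on: "(LINT x|?M. e a x * e b x) = (if a = b then 1 else 0)" if "a \<in> I" "b \<in> I" for a b
  proof (cases "fst a = fst b")
    case True
    then obtain k i j where "a = (k, i)" "b = (k, j)" "i \<in> {1..m k}" "j \<in> {1..m k}"
      using \<open>a \<in> I\<close> \<open>b \<in> I\<close> by (auto simp: I_def)
    then show ?thesis using on[of i k j] by (simp add: e_def)
  next
    case False
    then show ?thesis using slit_eigenfuns_orthogonal[OF pq N e_E[OF that(1)] e_E[OF that(2)] False] by auto
  qed
  let ?S = "lin_span (e ` I)"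
  have S_L2: "?S \<subseteq> L2 ?M" by (rule lin_span_L2) (auto intro: e_L2)
  \<comment> \<open>up to null functions, \<open>e\<close> spans all products\<close>
  have slit_span_e: "\<exists>h\<in>?S. AE x in ?M. g x = h x" if g: "g \<in> slit_span p q" for g
  proof -
    let ?F = "\<Union>l. F l ` level p q l"
    have "slit_span p q \<subseteq> lin_span ?F"
      unfolding slit_span_def
    proof (rule lin_span_subset, safe)
      fix j \<alpha> assume "\<alpha> \<in> exponents p q"
      then have i: "(j, \<alpha>) \<in> level p q (j + 2 * tdeg \<alpha>)" by (simp add: level_def)
      have "(\<lambda>x. slit_poly p q j \<alpha> x - F (j + 2 * tdeg \<alpha>) (j, \<alpha>) x) \<in> lin_span ?F"
        using F(2)[OF i] lin_span_mono[of "\<Union>l\<in>{..<j + 2 * tdeg \<alpha>}. F l ` level p q l" ?F] by force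
      moreover have "F (j + 2 * tdeg \<alpha>) (j, \<alpha>) \<in> lin_span ?F" by (rule lin_span_base) (use i in blast)
      ultimately have "(\<lambda>x. (slit_poly p q j \<alpha> x - F (j + 2 * tdeg \<alpha>) (j, \<alpha>) x) + F (j + 2 * tdeg \<alpha>) (j, \<alpha>) x) \<in> lin_span ?F"
        by (rule lin_span_add)
      then show "slit_poly p q j \<alpha> \<in> lin_span ?F" by simp
    qed
    then have "g \<in> lin_span ?F" using g by blast
    then have "g \<in> {g. \<exists>h\<in>?S. AE x in ?M. g x = h x}"
    proof (rule lin_span_in)
      fix b assume "b \<in> ?F"
      then obtain k i where b: "b = F k i" "i \<in> level p q k" by blast
      obtain c where c: "AE x in ?M. F k i x = (\<Sum>i=1..m k. c i * Y k i x)" using sp[OF b(2)] by blast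
      have "(\<lambda>x. \<Sum>i=1..m k. c i * Y k i x) \<in> ?S"
      proof (intro lin_span_sum lin_span_scale lin_span_base)
        fix i assume "i \<in> {1..m k}"
        then have "(k, i) \<in> I" "e (k, i) = Y k i" by (auto simp: I_def e_def)
        then show "Y k i \<in> e ` I" by force
      qed
      with c show "b \<in> {g. \<exists>h\<in>?S. AE x in ?M. g x = h x}" unfolding b(1) by (intro CollectI bexI)
    next
      show "(\<lambda>_. 0) \<in> {g. \<exists>h\<in>?S. AE x in ?M. g x = h x}" using lin_span.zero[of "e ` I"] by auto
    next
      fix f g assume "f \<in> {g. \<exists>h\<in>?S. AE x in ?M. g x = h x}" "g \<in> {g. \<exists>h\<in>?S. AE x in ?M. g x = h x}"
      then obtain h h' where h: "h \<in> ?S" "AE x in ?M. f x = h x" "h' \<in> ?S" "AE x in ?M. g x = h' x" by auto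
      have "AE x in ?M. f x + g x = h x + h' x" using h(2,4) by eventually_elim simp
      then show "(\<lambda>x. f x + g x) \<in> {g. \<exists>h\<in>?S. AE x in ?M. g x = h x}"
        by (intro CollectI bexI[OF _ lin_span_add[OF h(1,3)]])
    next
      fix c f assume "f \<in> {g. \<exists>h\<in>?S. AE x in ?M. g x = h x}"
      then obtain h where h: "h \<in> ?S" "AE x in ?M. f x = h x" by auto
      have "AE x in ?M. c * f x = c * h x" using h(2) by eventually_elim simp
      then show "(\<lambda>x. c * f x) \<in> {g. \<exists>h\<in>?S. AE x in ?M. g x = h x}"
        by (intro CollectI bexI[OF _ lin_span_scale[OF h(1)]])
    qed
    then show ?thesis by simp
  qed
  have complete: "AE x in ?M. h x = 0" if h: "h \<in> L2 ?M" and o: "\<And>ki. ki \<in> I \<Longrightarrow> (LINT x|?M. h x * e ki x) = 0" for h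
  proof (rule orthogonal_to_dense_imp_zero[OF slit_span_L2[OF pq] subsetD[OF slit_span_dense[OF pq] h]])
    fix g assume "g \<in> slit_span p q"
    then obtain g' where g': "g' \<in> ?S" "AE x in ?M. g x = g' x" using slit_span_e by blast
    have gL: "g \<in> L2 ?M" using slit_span_L2[OF pq] \<open>g \<in> slit_span p q\<close> by blast
    have "(LINT x|?M. h x * g' x) = 0"
      by (rule L2_orthogonal_lin_span[OF h _ _ g'(1)]) (auto intro: e_L2 o)
    moreover have "(LINT x|?M. h x * g x) = (LINT x|?M. h x * g' x)"
    proof (rule integral_cong_AE)
      show "AE x in ?M. h x * g x = h x * g' x" using g'(2) by eventually_elim simp
    qed (intro borel_measurable_times L2_measurable h gL subsetD[OF S_L2 g'(1)])+
    ultimately show "(LINT x|?M. h x * g x) = 0" by simp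
  qed
  have Y_eig: "eigenfunction p q (?\<mu> k) (Y k i)" if i: "i \<in> {1..m k}" for k i
    unfolding eigenfunction_def
  proof (intro conjI slit_eigenfuns_eigenspace[OF pq N YE[OF i]] notI)
    assume "AE x in ?M. Y k i x = 0"
    then have "AE x in ?M. Y k i x * Y k i x = 0" by eventually_elim simp
    then have "(LINT x|?M. Y k i x * Y k i x) = 0" by (rule integral_eq_zero_AE)
    then show False using on[OF i i] by simp
  qed
  \<comment> \<open>the difference of \<open>\<psi>\<close> and its Fourier sum over level \<open>k\<close> is orthogonal to \<open>e\<close>\<close>
  have expand: "\<exists>c. AE x in ?M. \<psi> x = (\<Sum>i=1..m k. c i * Y k i x)" if \<psi>: "\<psi> \<in> eigenspace p q (?\<mu> k)" for \<psi> k
  proof -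
    have \<psi>L: "\<psi> \<in> L2 ?M" by (rule eigenspace_L2[OF \<psi>])
    define c where "c i = (LINT x|?M. \<psi> x * Y k i x)" for i
    define h where "h x = \<psi> x - (\<Sum>i=1..m k. c i * Y k i x)" for x
    have hL: "h \<in> L2 ?M" unfolding h_def[abs_def] by (intro L2_diff \<psi>L L2_sum L2_scale YL)
    have "AE x in ?M. h x = 0"
    proof (rule complete[OF hL])
      fix ki assume ki: "ki \<in> I"
      have eL: "e ki \<in> L2 ?M" by (rule e_L2[OF ki])
      have "(LINT x|?M. h x * e ki x) = (LINT x|?M. \<psi> x * e ki x - (\<Sum>i=1..m k. c i * (Y k i x * e ki x)))"
        by (simp add: h_def left_diff_distrib sum_distrib_right mult.assoc)
      also have "\<dots> = (LINT x|?M. \<psi> x * e ki x) - (LINT x|?M. (\<Sum>i=1..m k. c i * (Y k i x * e ki x)))"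
        by (intro Bochner_Integration.integral_diff Bochner_Integration.integrable_sum integrable_mult_right L2_mult_integrable \<psi>L eL YL)
      also have "(LINT x|?M. (\<Sum>i=1..m k. c i * (Y k i x * e ki x))) = (\<Sum>i=1..m k. LINT x|?M. c i * (Y k i x * e ki x))"
        by (intro Bochner_Integration.integral_sum integrable_mult_right L2_mult_integrable eL YL)
      also have "\<dots> = (\<Sum>i=1..m k. c i * (if (k, i) = ki then 1 else 0))"
      proof (intro sum.cong refl)
        fix i assume "i \<in> {1..m k}"
        then have "(k, i) \<in> I" "e (k, i) = Y k i" by (auto simp: I_def e_def)
        then show "(LINT x|?M. c i * (Y k i x * e ki x)) = c i * (if (k, i) = ki then 1 else 0)"
          using e_on[of "(k, i)" ki] ki by simp
      qed
      also have "\<dots> = (LINT x|?M. \<psi> x * e ki x)"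
      proof (cases "fst ki = k")
        case True
        then obtain i where i: "ki = (k, i)" "i \<in> {1..m k}" using ki by (auto simp: I_def)
        have "(\<Sum>i'=1..m k. c i' * (if (k, i') = ki then 1 else 0)) = (\<Sum>i'=1..m k. if i' = i then c i' else 0)"
          by (intro sum.cong) (auto simp: i)
        also have "\<dots> = c i" using i(2) by simp
        finally show ?thesis by (simp add: c_def i(1) e_def)
      next
        case False
        have "(\<Sum>i=1..m k. c i * (if (k, i) = ki then 1 else 0)) = 0"
          by (intro sum.neutral) (use False in auto)
        moreover have "?\<mu> k \<noteq> ?\<mu> (fst ki)" using slit_eigenvalue_eq_iff[OF pq N, of k "fst ki"] False by auto
        then have "(LINT x|?M. \<psi> x * e ki x) = 0"
          by (rule eigenspace_slit_eigenfuns_orthogonal[OF pq N \<psi> e_E[OF ki]])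
        ultimately show ?thesis by simp
      qed
      finally show "(LINT x|?M. h x * e ki x) = 0" by simp
    qed
    then have "AE x in ?M. \<psi> x = (\<Sum>i=1..m k. c i * Y k i x)" by eventually_elim (simp add: h_def)
    then show ?thesis by blast
  qed
  have basis: "AE_basis ?M (eigenspace p q (?\<mu> k)) (m k) (Y k)" for k
    unfolding AE_basis_def
  proof (intro conjI ballI allI impI)
    show "Y k i \<in> eigenspace p q (?\<mu> k)" if "i \<in> {1..m k}" for i
      by (rule slit_eigenfuns_eigenspace[OF pq N YE[OF that]])
    show "\<exists>c. AE x in ?M. \<psi> x = (\<Sum>i=1..m k. c i * Y k i x)" if "\<psi> \<in> eigenspace p q (?\<mu> k)" for \<psi>
      by (rule expand[OF that])
    fix c j assume c: "AE x in ?M. (\<Sum>i=1..m k. c i * Y k i x) = 0" and j: "j \<in> {1..m k}"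
    have "0 = (LINT x|?M. (\<Sum>i=1..m k. c i * Y k i x) * Y k j x)"
      by (rule integral_eq_zero_AE[symmetric]) (use c in \<open>eventually_elim, simp\<close>)
    also have "\<dots> = (LINT x|?M. (\<Sum>i=1..m k. c i * (Y k i x * Y k j x)))"
      by (simp add: sum_distrib_right mult.assoc)
    also have "\<dots> = (\<Sum>i=1..m k. LINT x|?M. c i * (Y k i x * Y k j x))"
      using j by (intro Bochner_Integration.integral_sum integrable_mult_right L2_mult_integrable YL) auto
    also have "\<dots> = (\<Sum>i=1..m k. if i = j then c i else 0)"
      using on[OF _ j] by (intro sum.cong) auto
    also have "\<dots> = c j" using j by simp
    finally show "c j = 0" by simp
  qed
  have eig: "eigenfunction p q (?\<mu> k) (slit_poly p q k (\<lambda>_. 0))" for k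
    unfolding eigenfunction_def
    using slit_eigenfuns_eigenspace[OF pq N slit_poly_zero_eigenfun[OF pq N]] slit_poly_not_AE_zero[OF pq] by blast
  have spec: "\<exists>k. l = ?\<mu> k" if \<psi>: "eigenfunction p q l \<psi>" for l \<psi>
  proof (rule ccontr)
    assume "\<not> (\<exists>k. l = ?\<mu> k)"
    then have l: "l \<noteq> ?\<mu> k" for k by blast
    have \<psi>e: "\<psi> \<in> eigenspace p q l" using \<psi> by (simp add: eigenfunction_def)
    have "AE x in ?M. \<psi> x = 0"
      by (rule complete[OF eigenspace_L2[OF \<psi>e]]) (rule eigenspace_slit_eigenfuns_orthogonal[OF pq N \<psi>e e_E l])
    then show False using \<psi> by (simp add: eigenfunction_def)
  qed
  have spectrum: "point_spectrum p q = range ?\<mu>"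
    unfolding point_spectrum_def using spec eig by blast
  \<comment> \<open>at level zero there is a single generator, the constant one\<close>
  have m0: "m 0 = 1"
  proof -
    have "level p q 0 \<subseteq> {(0, \<lambda>_. 0)}" by (auto simp: level_def fun_eq_iff)
    then have "F 0 ` level p q 0 \<subseteq> {F 0 (0, \<lambda>_. 0)}" by blast
    then have "card (F 0 ` level p q 0) \<le> card {F 0 (0, \<lambda>_. 0)}" by (intro card_mono) auto
    then have "m 0 \<le> 1" using m_le[of 0] by simp
    moreover have "m 0 \<noteq> 0"
    proof
      assume "m 0 = 0"
      moreover have "slit_poly p q 0 (\<lambda>_. 0) \<in> eigenspace p q (?\<mu> 0)" using eig[of 0] by (simp add: eigenfunction_def)
      ultimately have "AE x in ?M. slit_poly p q 0 (\<lambda>_. 0) x = 0" using expand[of _ 0] by fastforce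
      then show False using slit_poly_not_AE_zero[OF pq] by blast
    qed
    ultimately show ?thesis by simp
  qed
  have onb: "L2_orthonormal_basis ?M I e"
    unfolding L2_orthonormal_basis_def
  proof (intro conjI ballI allI impI e_L2 e_on)
    fix f :: "real ^ 'n \<Rightarrow> real" and \<epsilon> :: real assume f: "f \<in> L2 ?M" and \<epsilon>: "\<epsilon> > 0"
    obtain g where g: "g \<in> slit_span p q" "(LINT x|?M. (f x - g x)\<^sup>2) < \<epsilon>"
      using subsetD[OF slit_span_dense[OF pq] f] \<epsilon> unfolding L2_closure_def by blast
    obtain h where h: "h \<in> ?S" "AE x in ?M. g x = h x" using slit_span_e[OF g(1)] by blast
    have L: "g \<in> L2 ?M" "h \<in> L2 ?M" using slit_span_L2[OF pq] S_L2 g h by auto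
    have "(LINT x|?M. (f x - h x)\<^sup>2) = (LINT x|?M. (f x - g x)\<^sup>2)"
    proof (rule integral_cong_AE)
      show "AE x in ?M. (f x - h x)\<^sup>2 = (f x - g x)\<^sup>2" using h(2) by eventually_elim simp
    qed (intro borel_measurable_power borel_measurable_diff L2_measurable f L)+
    moreover obtain A c where "finite A" "A \<subseteq> I" "\<And>x. h x = (\<Sum>i\<in>A. c i * e i x)"
      using lin_span_image_finite_sum[OF h(1)] by blast
    ultimately show "\<exists>A c. finite A \<and> A \<subseteq> I \<and> (LINT x|?M. (f x - (\<Sum>i\<in>A. c i * e i x))\<^sup>2) < \<epsilon>"
      using g(2) by (intro exI[of _ A] exI[of _ c]) simp
  qed
  have bounded: "\<psi> \<in> L_infinity ?M" if \<psi>: "eigenfunction p q l \<psi>" for l \<psi>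
  proof -
    obtain k where k: "l = ?\<mu> k" using spec[OF \<psi>] by blast
    have \<psi>e: "\<psi> \<in> eigenspace p q (?\<mu> k)" using \<psi> by (simp add: k eigenfunction_def)
    obtain c where c: "AE x in ?M. \<psi> x = (\<Sum>i=1..m k. c i * Y k i x)" using expand[OF \<psi>e] by blast
    have "(\<lambda>x. \<Sum>i=1..m k. c i * Y k i x) \<in> slit_span p q"
      unfolding slit_span_def
      by (intro lin_span_sum lin_span_scale) (use YE in \<open>auto simp: slit_eigenfuns_def slit_span_def\<close>)
    then obtain B where B: "\<And>x. norm x = 1 \<Longrightarrow> \<bar>\<Sum>i=1..m k. c i * Y k i x\<bar> \<le> B"
      using slit_span_bounded[OF pq N] by blast
    have "AE x in ?M. norm x = 1" by (rule AE_I2) simp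
    then have "AE x in ?M. \<bar>\<psi> x\<bar> \<le> B" using c by eventually_elim (use B in auto)
    then show ?thesis using L2_measurable[OF eigenspace_L2[OF \<psi>e]] by (auto simp: L_infinity_def)
  qed
  show ?thesis
    using spectrum slit_eigenvalue_strict_mono[OF N(2)] slit_eigenvalue_at_top[OF N(2)] slit_eigenvalue_nonneg[OF N(2)]
      basis m0 onb[unfolded I_def e_def] Y_eig bounded
    by (intro exI[of _ ?\<mu>] exI[of _ m] exI[of _ Y])
      (auto simp: has_multiplicity_def slit_eigenvalue_def[of N])
qed

end
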